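(* Suppose $\pi(a|s)\le C\mu^b(s)b(a|s)$ for all $s,a$ and some $C>0$, and Assumptions (B1)–(B3) hold. Let $\theta_{t+1}=\mathbf P_{\mathcal C}(\theta_t-\eta_t\hat g_t(\theta_t,z_t))$, $\theta_0\in\mathcal C$, $\bar\theta_T$ the average of the iterates. (a) For direct-SGD or TD-SGD with $\eta_t=\eta_0t^{-1/2}$: $\mathbb E\,l(\bar\theta_T)-l(\theta^* )=O(\log T/\sqrt T)$. (b) If $l$ is strongly convex, then for direct-SGD or TD-SGD with step sizes $\eta_1\in[1/c,2/c]$, $\eta_{t+1}=\exp(-\tfrac12c\eta_t)\eta_t$ (with $c>0$ a lower bound on the strong convexity constant), $\mathbb E\|\bar\theta_T-\theta^*\|^2=O((\log T)^3/T)$ and $\mathbb E\,l(\bar\theta_T)-l(\theta^* )=O((\log T)^3/T)$. (c) If, for TD(0), the averaged direction $\bar g(\theta)=-\sum_s\delta(\theta,s)(\varphi(s)+\zeta)$ is a $c$-contraction towards $\theta^*$, then TD(0) with the step sizes of (b) satisfies the same rates as in (b).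
   Context: Setting. $\mathcal S$ finite state space, $\mathcal A$ finite action space; $P(\cdot|s,a)$ next-state distributions and $P(r|s,a)$ finitely supported reward distributions, independent given $(s,a)$; $\gamma\in(0,1]$. Policies $\pi$ (target) and $b$ (behavior) are families of distributions on $\mathcal A$; $P^\pi(s,s')=\sum_a\pi(a|s)P(s'|s,a)$; $\mu^b$ is the stationary distribution of $P^b$. Features $\varphi:\mathcal S\to\mathbb R^d$, $\zeta\in\mathbb R^d$ with $\zeta=0$ if $\gamma<1$ and $\zeta^T\varphi(s)=0$ for all $s$ if $\gamma=1$. $\xi^\pi(s)=\sum_a\sum_r\pi(a|s)P(r|s,a)r$, $\phi^\pi(s)=\sum_a\sum_{s'}\pi(a|s)P(s'|s,a)\varphi(s')$, $\delta(\theta,s)=\xi^\pi(s)+(-\zeta+\gamma\phi^\pi(s)-\varphi(s))^T\theta$, $l(\theta)=\sum_s\mu^b(s)\frac12\delta(\theta,s)^2$; $\theta^*$ satisfies $\delta(\theta^*,s)=0$ for all $s$. Data: $z_t=(s_t,a_t,r_t,s_{t+1})$ generated by running the MDP under $b$ ($a_t\sim b(\cdot|s_t)$, $r_t\sim P(\cdot|s_t,a_t)$, $s_{t+1}\sim P(\cdot|s_t,a_t)$). Update directions for $z=(s,a,r,s')$: direct-SGD $g(\theta,z)=\delta(\theta,s)(-\zeta+\gamma\phi^\pi(s)-\varphi(s))$; TD-SGD $g(\theta,z)=\frac{\pi(a|s)}{b(a|s)}\delta(\theta,s)(-\zeta+\gamma\varphi(s')-\varphi(s))$; TD(0) $g(\theta,z)=-\frac1{\mu^b(s)}\frac{\pi(a|s)}{b(a|s)}(r-\zeta^T\theta+\gamma\varphi(s')^T\theta-\varphi(s)^T\theta)(\varphi(s)+\zeta)$.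 The approximations $\hat g_t$ are obtained by replacing, in direct-SGD and TD-SGD, $\xi^\pi(s)$ and $\phi^\pi(s)$ by $\sum_r r\,\hat p_t(r|s)$ and $\sum_{s'}\hat p_t(s'|s)\varphi(s')$, where $\hat p_t(\cdot|s)$ are data-based estimates of $p(s'|s)=\sum_a\pi(a|s)P(s'|s,a)$ and $p(r|s)=\sum_a\pi(a|s)P(r|s,a)$; and, in TD(0), by replacing $\mu^b(s)$ by a data-based estimate $\hat\mu^b_t(s)$. $\mathbf P_{\mathcal C}$ is Euclidean projection onto a closed convex $\mathcal C$. (B1) $\theta^*\in\mathcal C$; there are $\tilde M,\tilde C_0,\tilde C_1>0$ with $|r|<\tilde M$ a.s., $\|\zeta\|_\infty,\|\varphi\|_\infty\le\tilde C_0$, $\mathcal C\subset\{\|\theta\|\le\tilde C_1\}$. (B2) $b$ generates an irreducible ergodic chain on $\mathcal S$ with finite mixing time $\tau$ ($\|P^b(s_\tau\in\cdot|s_0)-\mu^b\|_{TV}\le1/4$ for all $s_0$). (B3) There are random variables $\tilde e_t$ with $\mathbb E\tilde e_t^2=O(1/t)$ such that $\|\hat p_t(\cdot|s_t)-p(\cdot|s_t)\|_\infty\le\tilde e_t$ and $|1/\hat\mu^b_t(s_t)-1/\mu^b(s_t)|\le\tilde e_t$. A vector field $\bar g$ is a $c$-contraction towards $\theta^*$ if $\bar g(\theta^* )=0$ and $\langle\theta-\theta^*,\bar g(\theta)\rangle\ge c\|\theta-\theta^*\|^2$. *)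

theory Defs
  imports "HOL-Analysis.Analysis" "HOL-Probability.Probability"
begin

definition kernel_pol :: "('s::finite \<Rightarrow> 'a::finite pmf) \<Rightarrow> ('s \<Rightarrow> 'a \<Rightarrow> 's pmf) \<Rightarrow> 's \<Rightarrow> 's \<Rightarrow> real" where
  "kernel_pol pol P s s' = (\<Sum>a\<in>UNIV. pmf (pol s) a * pmf (P s a) s')"

definition rew_pol :: "('s::finite \<Rightarrow> 'a::finite pmf) \<Rightarrow> ('s \<Rightarrow> 'a \<Rightarrow> real pmf) \<Rightarrow> 's \<Rightarrow> real \<Rightarrow> real" where
  "rew_pol pol R s r = (\<Sum>a\<in>UNIV. pmf (pol s) a * pmf (R s a) r)"

definition rew_support :: "('s::finite \<Rightarrow> 'a::finite \<Rightarrow> real pmf) \<Rightarrow> real set" where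
  "rew_support R = (\<Union>s a. set_pmf (R s a))"

primrec kpow :: "('s::finite \<Rightarrow> 's \<Rightarrow> real) \<Rightarrow> nat \<Rightarrow> 's \<Rightarrow> 's \<Rightarrow> real" where
  "kpow K 0 s s' = (if s = s' then 1 else 0)"
| "kpow K (Suc n) s s' = (\<Sum>u\<in>UNIV. kpow K n s u * K u s')"

definition is_stationary :: "('s::finite \<Rightarrow> 's \<Rightarrow> real) \<Rightarrow> ('s \<Rightarrow> real) \<Rightarrow> bool" where
  "is_stationary K mu \<longleftrightarrow> (\<forall>s. 0 \<le> mu s) \<and> (\<Sum>s\<in>UNIV. mu s) = 1 \<and>
     (\<forall>s'. mu s' = (\<Sum>s\<in>UNIV. mu s * K s s'))"

definition irreducible_kernel :: "('s::finite \<Rightarrow> 's \<Rightarrow> real) \<Rightarrow> bool" where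
  "irreducible_kernel K \<longleftrightarrow> (\<forall>s s'. \<exists>n. kpow K n s s' > 0)"

definition tv_dist :: "('s::finite \<Rightarrow> real) \<Rightarrow> ('s \<Rightarrow> real) \<Rightarrow> real" where
  "tv_dist p q = (1/2) * (\<Sum>s\<in>UNIV. \<bar>p s - q s\<bar>)"

definition has_mixing_time :: "('s::finite \<Rightarrow> 's \<Rightarrow> real) \<Rightarrow> ('s \<Rightarrow> real) \<Rightarrow> nat \<Rightarrow> bool" where
  "has_mixing_time K mu tau \<longleftrightarrow> (\<forall>s0. tv_dist (kpow K tau s0) mu \<le> 1/4)"

text \<open>xi(s) = sum_r r p(r|s), for a (possibly estimated) reward distribution supported on Rs.\<close>
definition xi_of :: "real set \<Rightarrow> ('s \<Rightarrow> real \<Rightarrow> real) \<Rightarrow> 's \<Rightarrow> real" where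
  "xi_of Rs pr s = (\<Sum>r\<in>Rs. r * pr s r)"

definition phi_of :: "('s::finite \<Rightarrow> real^'d) \<Rightarrow> ('s \<Rightarrow> 's \<Rightarrow> real) \<Rightarrow> 's \<Rightarrow> real^'d" where
  "phi_of feat ps s = (\<Sum>s'\<in>UNIV. ps s s' *\<^sub>R feat s')"

definition td_err :: "real^'d \<Rightarrow> real \<Rightarrow> ('s \<Rightarrow> real^'d) \<Rightarrow> ('s \<Rightarrow> real) \<Rightarrow> ('s \<Rightarrow> real^'d)
    \<Rightarrow> real^'d \<Rightarrow> 's \<Rightarrow> real" where
  "td_err zeta gamma feat xi ph theta s = xi s + (- zeta + gamma *\<^sub>R ph s - feat s) \<bullet> theta"

definition loss :: "('s::finite \<Rightarrow> real) \<Rightarrow> real^'d \<Rightarrow> real \<Rightarrow> ('s \<Rightarrow> real^'d) \<Rightarrow> ('s \<Rightarrow> real)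
    \<Rightarrow> ('s \<Rightarrow> real^'d) \<Rightarrow> real^'d \<Rightarrow> real" where
  "loss mu zeta gamma feat xi ph theta =
     (\<Sum>s\<in>UNIV. mu s * (1/2) * (td_err zeta gamma feat xi ph theta s)\<^sup>2)"

definition dir_direct :: "real^'d \<Rightarrow> real \<Rightarrow> ('s \<Rightarrow> real^'d) \<Rightarrow> ('s \<Rightarrow> real) \<Rightarrow> ('s \<Rightarrow> real^'d)
    \<Rightarrow> real^'d \<Rightarrow> 's \<Rightarrow> real^'d" where
  "dir_direct zeta gamma feat xi ph theta s =
     td_err zeta gamma feat xi ph theta s *\<^sub>R (- zeta + gamma *\<^sub>R ph s - feat s)"

definition dir_tdsgd :: "('s \<Rightarrow> 'a pmf) \<Rightarrow> ('s \<Rightarrow> 'a pmf) \<Rightarrow> real^'d \<Rightarrow> real \<Rightarrow> ('s \<Rightarrow> real^'d)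
    \<Rightarrow> ('s \<Rightarrow> real) \<Rightarrow> ('s \<Rightarrow> real^'d) \<Rightarrow> real^'d \<Rightarrow> 's \<times> 'a \<times> real \<times> 's \<Rightarrow> real^'d" where
  "dir_tdsgd pol b zeta gamma feat xi ph theta z = (case z of (s, a, r, s') \<Rightarrow>
     (pmf (pol s) a / pmf (b s) a * td_err zeta gamma feat xi ph theta s) *\<^sub>R
       (- zeta + gamma *\<^sub>R feat s' - feat s))"

text \<open>TD(0) direction for z = (s,a,r,s'), with stationary weights mu (true or estimated).\<close>
definition dir_td0 :: "('s \<Rightarrow> 'a pmf) \<Rightarrow> ('s \<Rightarrow> 'a pmf) \<Rightarrow> real^'d \<Rightarrow> real \<Rightarrow> ('s \<Rightarrow> real^'d)
    \<Rightarrow> ('s \<Rightarrow> real) \<Rightarrow> real^'d \<Rightarrow> 's \<times> 'a \<times> real \<times> 's \<Rightarrow> real^'d" where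
  "dir_td0 pol b zeta gamma feat mu theta z = (case z of (s, a, r, s') \<Rightarrow>
     - ((1 / mu s) * (pmf (pol s) a / pmf (b s) a) *
         (r - zeta \<bullet> theta + gamma * (feat s' \<bullet> theta) - feat s \<bullet> theta)) *\<^sub>R (feat s + zeta))"

definition sample :: "(nat \<Rightarrow> 'w \<Rightarrow> 's) \<Rightarrow> (nat \<Rightarrow> 'w \<Rightarrow> 'a) \<Rightarrow> (nat \<Rightarrow> 'w \<Rightarrow> real) \<Rightarrow> nat \<Rightarrow> 'w
    \<Rightarrow> 's \<times> 'a \<times> real \<times> 's" where
  "sample S A Rw t w = (S t w, A t w, Rw t w, S (Suc t) w)"

definition data_hist :: "(nat \<Rightarrow> 'w \<Rightarrow> 's) \<Rightarrow> (nat \<Rightarrow> 'w \<Rightarrow> 'a) \<Rightarrow> (nat \<Rightarrow> 'w \<Rightarrow> real) \<Rightarrow> nat \<Rightarrow> 'w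
    \<Rightarrow> ('s \<times> 'a \<times> real \<times> 's) list" where
  "data_hist S A Rw t w = map (\<lambda>i. sample S A Rw i w) [0..<Suc t]"

text \<open>Projected SGD: theta_0 given, theta_{t+1} = P_C(theta_t - eta_{t+1} g_t(theta_t)),
  where g t theta w is the (approximate) direction at time t evaluated at theta on outcome w.\<close>
primrec psgd :: "(real^'d) set \<Rightarrow> (nat \<Rightarrow> real) \<Rightarrow> (nat \<Rightarrow> real^'d \<Rightarrow> 'w \<Rightarrow> real^'d) \<Rightarrow> real^'d
    \<Rightarrow> nat \<Rightarrow> 'w \<Rightarrow> real^'d" where
  "psgd C eta g theta0 0 w = theta0"
| "psgd C eta g theta0 (Suc t) w =
     closest_point C (psgd C eta g theta0 t w - eta (Suc t) *\<^sub>R g t (psgd C eta g theta0 t w) w)"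

definition psgd_avg :: "(real^'d) set \<Rightarrow> (nat \<Rightarrow> real) \<Rightarrow> (nat \<Rightarrow> real^'d \<Rightarrow> 'w \<Rightarrow> real^'d) \<Rightarrow> real^'d
    \<Rightarrow> nat \<Rightarrow> 'w \<Rightarrow> real^'d" where
  "psgd_avg C eta g theta0 T w = (1 / real T) *\<^sub>R (\<Sum>t\<in>{1..T}. psgd C eta g theta0 t w)"

definition strongly_convex_on :: "'v::real_normed_vector set \<Rightarrow> real \<Rightarrow> ('v \<Rightarrow> real) \<Rightarrow> bool" where
  "strongly_convex_on S c f \<longleftrightarrow> (\<forall>x\<in>S. \<forall>y\<in>S. \<forall>u::real. 0 \<le> u \<and> u \<le> 1 \<longrightarrow>
     f (u *\<^sub>R x + (1 - u) *\<^sub>R y) \<le> u * f x + (1 - u) * f y - c / 2 * u * (1 - u) * (norm (x - y))\<^sup>2)"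

definition is_contraction_towards :: "real \<Rightarrow> ('v::real_inner \<Rightarrow> 'v) \<Rightarrow> 'v \<Rightarrow> bool" where
  "is_contraction_towards c g thstar \<longleftrightarrow> g thstar = 0 \<and>
     (\<forall>theta. inner (theta - thstar) (g theta) \<ge> c * (norm (theta - thstar))\<^sup>2)"

end

(* The squared distance D_t to theta* obeys
     D_{t+1} <= D_t - 2 eta <g, theta_t - theta*> + O(eta e_t |theta_t - theta*| + eta e_t^2 + eta^2);
   boundedness of C absorbs the region e_t > 1, so second moments of e_t suffice. Since the chain is
   irreducible, the Markovian noise <g - gbar, theta_t - theta*> has the form h - K h for a
   function h of (theta_t, s_t) solving a Poisson equation. In expectation it therefore telescopes
   up to the change of theta in one step, and no mixing lag is needed. Summation by parts then
   gives (a), and in the contractive case T E D_T = O(log T), from which (b) and (c) follow by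
   averaging. *)
theory Submission
  imports Defs
begin

section \<open>Irreducible finite kernels and the Poisson equation\<close>

text \<open>Since \<delta> vanishes at \<open>thstar\<close> in every state, the loss is a quadratic
  form in the distance vector with minimum 0, and the averaged direction of both gradient methods
  pairs with that vector to exactly twice the loss. Hence (a) and (b) differ only in whether this
  pairing also dominates c times the squared distance, and (c) fits the same frame with another
  field. The estimates may depend on all data up to the current transition, and their error may be
  correlated with the iterate. The mixed term (error times distance) is therefore split by Young's
  inequality, whose parameter is left free: (a) takes 1 / sqrt t, the contractive case a constant
  that uses up half of the contraction. Estimated factors can occur in products, so the square of a
  direction may involve e_t^4, of which no moment is available; the split at e_t = 1 answers this.
  The step sizes of (b) satisfy 1 / t \<le> c \<eta>_t \<le> 2 / t, which makes t D_t the right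
  potential.\<close>

lemma kernel_pol_nonneg: "0 \<le> kernel_pol pol P s s'"
  by (simp add: kernel_pol_def sum_nonneg)

lemma sum_pmf_UNIV_finite: "(\<Sum>x\<in>UNIV. pmf p x) = 1" for p :: "'x::finite pmf"
  by (rule sum_pmf_eq_1) auto

lemma kernel_pol_row: "(\<Sum>s'\<in>UNIV. kernel_pol pol P s s') = 1"
proof -
  have "(\<Sum>s'\<in>UNIV. kernel_pol pol P s s')
      = (\<Sum>a\<in>UNIV. \<Sum>s'\<in>UNIV. pmf (pol s) a * pmf (P s a) s')"
    unfolding kernel_pol_def by (rule sum.swap)
  also have "\<dots> = 1"
    by (simp add: sum_distrib_left[symmetric] sum_pmf_UNIV_finite)
  finally show ?thesis .
qed

locale markov_kernel =
  fixes K :: "'s::finite \<Rightarrow> 's \<Rightarrow> real" and mu :: "'s \<Rightarrow> real"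
  assumes K_nonneg: "0 \<le> K s s'"
    and K_row: "(\<Sum>s'\<in>UNIV. K s s') = 1"
    and stationary: "is_stationary K mu"
    and irreducible: "irreducible_kernel K"
begin

lemma mu_nonneg: "0 \<le> mu s" and mu_sum: "(\<Sum>s\<in>UNIV. mu s) = 1"
  and mu_K: "(\<Sum>s\<in>UNIV. mu s * K s s') = mu s'"
  using stationary unfolding is_stationary_def by metis+

lemma kpow_nonneg: "0 \<le> kpow K n s s'"
  by (induction n arbitrary: s') (auto intro!: sum_nonneg simp: K_nonneg)

lemma kpow_row: "(\<Sum>s'\<in>UNIV. kpow K n s s') = 1"
proof (induction n)
  case (Suc n)
  have "(\<Sum>s'\<in>UNIV. kpow K (Suc n) s s') = (\<Sum>u\<in>UNIV. \<Sum>s'\<in>UNIV. kpow K n s u * K u s')"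
    unfolding kpow.simps by (rule sum.swap)
  also have "\<dots> = 1"
    unfolding sum_distrib_left[symmetric] K_row by (simp add: Suc)
  finally show ?case .
qed simp

lemma mu_kpow: "(\<Sum>s\<in>UNIV. mu s * kpow K n s s') = mu s'"
proof (induction n arbitrary: s')
  case 0
  have "(\<Sum>s\<in>UNIV. mu s * kpow K 0 s s') = (\<Sum>s\<in>UNIV. if s = s' then mu s else 0)"
    by (intro sum.cong) auto
  then show ?case by simp
next
  case (Suc n)
  have "(\<Sum>s\<in>UNIV. mu s * kpow K (Suc n) s s')
      = (\<Sum>s\<in>UNIV. \<Sum>u\<in>UNIV. mu s * kpow K n s u * K u s')"
    unfolding kpow.simps sum_distrib_left mult.assoc ..
  also have "\<dots> = (\<Sum>u\<in>UNIV. (\<Sum>s\<in>UNIV. mu s * kpow K n s u) * K u s')"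
    unfolding sum_distrib_right by (rule sum.swap)
  finally show ?case unfolding Suc mu_K .
qed

text \<open>Some state carries mass because \<open>mu\<close> sums to 1; irreducibility leads from
  it to \<open>s\<close> with positive probability, and invariance under \<open>kpow K n\<close>
  transports the mass. Positivity lets the TD(0) weights \<open>1 / mu s\<close> cancel against
  \<open>mu\<close>.\<close>

lemma mu_pos: "0 < mu s"
proof -
  obtain s0 where s0: "mu s0 > 0"
  proof (rule ccontr)
    assume "\<not> thesis"
    then have "\<not> 0 < mu s" for s using that by blast
    then have "(\<Sum>s\<in>UNIV. mu s) \<le> 0" by (intro sum_nonpos) (simp add: not_less)
    with mu_sum show False by simp
  qed
  obtain n where n: "kpow K n s0 s > 0"
    using irreducible by (auto simp: irreducible_kernel_def)
  have "0 < mu s0 * kpow K n s0 s" using s0 n by simp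
  also have "\<dots> \<le> (\<Sum>u\<in>UNIV. mu u * kpow K n u s)"
    by (rule member_le_sum) (auto simp: mu_nonneg kpow_nonneg)
  finally show ?thesis by (simp add: mu_kpow)
qed

section \<open>Harmonic functions and the Poisson equation\<close>

lemma harmonic_kpow:
  assumes "\<And>s. (\<Sum>s'\<in>UNIV. K s s' * h s') = h s"
  shows "(\<Sum>s'\<in>UNIV. kpow K n s s' * h s') = h s"
proof (induction n)
  case 0
  have "(\<Sum>s'\<in>UNIV. kpow K 0 s s' * h s') = (\<Sum>s'\<in>UNIV. if s = s' then h s' else 0)"
    by (intro sum.cong) auto
  then show ?case by simp
next
  case (Suc n)
  have "(\<Sum>s'\<in>UNIV. kpow K (Suc n) s s' * h s')
      = (\<Sum>s'\<in>UNIV. \<Sum>u\<in>UNIV. kpow K n s u * (K u s' * h s'))"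
    unfolding kpow.simps sum_distrib_right mult.assoc ..
  also have "\<dots> = (\<Sum>u\<in>UNIV. kpow K n s u * (\<Sum>s'\<in>UNIV. K u s' * h s'))"
    unfolding sum_distrib_left by (rule sum.swap)
  finally show ?case unfolding assms Suc .
qed

text \<open>Maximum principle: at a maximiser \<open>m\<close> the nonnegative gaps
  \<open>h m - h v\<close> average to 0 under \<open>kpow K n m\<close>, so a gap with positive
  weight vanishes, and irreducibility provides such an \<open>n\<close> for every state.\<close>

lemma harmonic_const:
  assumes "\<And>s. (\<Sum>s'\<in>UNIV. K s s' * h s') = h s"
  shows "h s = h s'"
proof -
  have "Max (range h) \<in> range h" by (rule Max_in) auto
  then obtain m where m: "h m = Max (range h)" by (metis imageE)
  then have le: "h u \<le> h m" for u by (simp add: m)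
  have "h u = h m" for u
  proof -
    obtain n where n: "kpow K n m u > 0"
      using irreducible by (auto simp: irreducible_kernel_def)
    have "(\<Sum>v\<in>UNIV. kpow K n m v * (h m - h v)) = 0"
      using harmonic_kpow[of h n m, OF assms]
      by (simp add: right_diff_distrib sum_subtractf sum_distrib_right[symmetric] kpow_row)
    then have "kpow K n m u * (h m - h u) = 0"
      by (subst (asm) sum_nonneg_eq_0_iff) (auto simp: kpow_nonneg le)
    with n show ?thesis by simp
  qed
  then show ?thesis by metis
qed

text \<open>Adding the rank-one term \<open>mu h\<close> makes \<open>h - K h\<close> injective, hence
  invertible, and changes nothing on the hyperplane \<open>mu u = 0\<close>.\<close>
lemma poisson_equation:
  obtains Z :: "real^'s \<Rightarrow> real^'s" where "linear Z"
    "\<And>u s. (\<Sum>s\<in>UNIV. mu s * u $ s) = 0 \<Longrightarrow> Z u $ s - (\<Sum>s'\<in>UNIV. K s s' * Z u $ s') = u $ s"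
proof -
  define T :: "real^'s \<Rightarrow> real^'s" where
    "T h = (\<chi> s. h $ s - (\<Sum>s'\<in>UNIV. K s s' * h $ s') + (\<Sum>s'\<in>UNIV. mu s' * h $ s'))" for h
  have lin: "linear T"
    by (rule linearI)
      (auto simp: T_def vec_eq_iff algebra_simps sum.distrib sum_distrib_left)
  \<comment> \<open>By stationarity \<open>h - K h\<close> has \<open>mu\<close>-mean 0, so
    \<open>T\<close> preserves the \<open>mu\<close>-mean. This serves twice: an element of the
    kernel of \<open>T\<close> has mean 0 and is thus harmonic, and a right-hand side of mean 0 has
    a preimage of mean 0, where the rank-one term disappears.\<close>
  have mu_T: "(\<Sum>s\<in>UNIV. mu s * T h $ s) = (\<Sum>s\<in>UNIV. mu s * h $ s)" for h
  proof -
    have "(\<Sum>s\<in>UNIV. mu s * (\<Sum>s'\<in>UNIV. K s s' * h $ s'))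
        = (\<Sum>s'\<in>UNIV. (\<Sum>s\<in>UNIV. mu s * K s s') * h $ s')"
      by (simp add: sum_distrib_left sum_distrib_right mult.assoc) (rule sum.swap)
    also have "\<dots> = (\<Sum>s\<in>UNIV. mu s * h $ s)" by (simp add: mu_K)
    finally show ?thesis
      by (simp add: T_def distrib_left right_diff_distrib sum.distrib sum_subtractf
          sum_distrib_right[symmetric] mu_sum)
  qed
  have "inj T"
  proof (subst linear_injective_0[OF lin], intro allI impI)
    fix h assume T0: "T h = 0"
    have mh: "(\<Sum>s\<in>UNIV. mu s * h $ s) = 0"
      using mu_T[of h] by (simp add: T0)
    have "(\<Sum>s'\<in>UNIV. K s s' * h $ s') = h $ s" for s
      using arg_cong[OF T0, of "\<lambda>v. v $ s"] by (simp add: T_def mh)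
    from harmonic_const[of "\<lambda>s. h $ s", OF this] have c: "h $ s = h $ s'" for s s' .
    have "h $ s = 0" for s
    proof -
      have "(\<Sum>s'\<in>UNIV. mu s' * h $ s') = (\<Sum>s'\<in>UNIV. mu s' * h $ s)"
        by (intro sum.cong refl arg_cong2[of _ _ _ _ "(*)"] c)
      then show ?thesis using mh by (simp add: sum_distrib_right[symmetric] mu_sum)
    qed
    then show "h = 0" by (simp add: vec_eq_iff)
  qed
  from linear_injective_isomorphism[OF lin this]
  obtain Z where Z: "linear Z" and TZ: "\<And>x. T (Z x) = x" by auto
  have "Z u $ s - (\<Sum>s'\<in>UNIV. K s s' * Z u $ s') = u $ s"
    if u: "(\<Sum>s\<in>UNIV. mu s * u $ s) = 0" for u s
  proof -
    have "(\<Sum>s\<in>UNIV. mu s * Z u $ s) = 0" using mu_T[of "Z u"] u by (simp add: TZ)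
    then show ?thesis
      using arg_cong[OF TZ[of u], of "\<lambda>v. v $ s"] by (simp add: T_def)
  qed
  with Z show ?thesis by (rule that)
qed

end

section \<open>Trajectories of the decision process\<close>

text \<open>Stands in for conditional expectation: a variable that almost surely takes finitely many
  values turns an expectation into a finite sum over its atoms.\<close>

lemma (in prob_space) integral_finite_range:
  fixes f :: "'a \<Rightarrow> real" and Z :: "'a \<Rightarrow> 'z"
  assumes F: "finite F" and ev: "\<And>z. z \<in> F \<Longrightarrow> {w \<in> space M. Z w = z} \<in> sets M"
    and AE_F: "AE w in M. Z w \<in> F" and f: "f \<in> borel_measurable M"
    and c: "\<And>w. w \<in> space M \<Longrightarrow> Z w \<in> F \<Longrightarrow> f w = c (Z w)"
  shows "(\<integral>w. f w \<partial>M) = (\<Sum>z\<in>F. prob {w \<in> space M. Z w = z} * c z)"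
proof -
  let ?E = "\<lambda>z. {w \<in> space M. Z w = z}"
  have meas: "(\<lambda>w. indicator (?E z) w * c z :: real) \<in> borel_measurable M" if "z \<in> F" for z
    using ev[OF that] by measurable
  have "AE w in M. f w = (\<Sum>z\<in>F. indicator (?E z) w * c z)"
    using AE_F AE_space
  proof eventually_elim
    case (elim w)
    have "(\<Sum>z\<in>F. indicator (?E z) w * c z) = (\<Sum>z\<in>F. if Z w = z then c z else 0)"
      using elim by (intro sum.cong) (auto simp: indicator_def)
    then show ?case using elim F c by simp
  qed
  then have "(\<integral>w. f w \<partial>M) = (\<integral>w. (\<Sum>z\<in>F. indicator (?E z) w * c z) \<partial>M)"
    using f meas by (intro integral_cong_AE borel_measurable_sum) auto
  also have "\<dots> = (\<Sum>z\<in>F. (\<integral>w. indicator (?E z) w * c z \<partial>M))"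
    using ev by (intro Bochner_Integration.integral_sum integrable_mult_left)
      (auto simp: integrable_indicator_iff emeasure_eq_measure)
  also have "\<dots> = (\<Sum>z\<in>F. prob (?E z) * c z)"
    using ev by (intro sum.cong refl) (simp add: Int_absorb2 Collect_restrict)
  finally show ?thesis .
qed

text \<open>The dynamics enter only through the probability of each finite path, without
  filtrations; the Markov property is recovered in \<open>integral_next_move\<close>.\<close>

locale mdp_path = prob_space M
  for M :: "'w measure" +
  fixes S :: "nat \<Rightarrow> 'w \<Rightarrow> 's::finite" and A :: "nat \<Rightarrow> 'w \<Rightarrow> 'a::finite" and Rw :: "nat \<Rightarrow> 'w \<Rightarrow> real"
    and P :: "'s \<Rightarrow> 'a \<Rightarrow> 's pmf" and R :: "'s \<Rightarrow> 'a \<Rightarrow> real pmf" and b :: "'s \<Rightarrow> 'a pmf"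
  assumes fin_rew: "finite (set_pmf (R s a))"
    and S_meas [measurable]: "S t \<in> measurable M (count_space UNIV)"
    and A_meas [measurable]: "A t \<in> measurable M (count_space UNIV)"
    and Rw_meas [measurable]: "Rw t \<in> borel_measurable M"
    and path_law: "prob {w \<in> space M. (\<forall>i<n. S i w = ss i \<and> A i w = as i \<and> Rw i w = rs i) \<and> S n w = ss n}
       = prob {w \<in> space M. S 0 w = ss 0} *
         (\<Prod>i<n. pmf (b (ss i)) (as i) * pmf (R (ss i) (as i)) (rs i) * pmf (P (ss i) (as i)) (ss (Suc i)))"
begin

section \<open>Pasts, moves and their probabilities\<close>

abbreviation "Rs \<equiv> rew_support R"

definition moves :: "('a \<times> real \<times> 's) set" where
  "moves = UNIV \<times> Rs \<times> UNIV"

definition move_prob :: "'s \<Rightarrow> 'a \<times> real \<times> 's \<Rightarrow> real" where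
  "move_prob s x = (case x of (a, r, s') \<Rightarrow> pmf (b s) a * pmf (R s a) r * pmf (P s a) s')"

definition hist :: "nat \<Rightarrow> 'w \<Rightarrow> ('s \<times> 'a \<times> real \<times> 's) list" where
  "hist t w = map (\<lambda>i. sample S A Rw i w) [0..<t]"

text \<open>The current state is recorded separately because the empty history at time 0 does not
  contain it; at later times it is already the last component of the last sample.\<close>

definition past :: "nat \<Rightarrow> 'w \<Rightarrow> ('s \<times> 'a \<times> real \<times> 's) list \<times> 's" where
  "past t w = (hist t w, S t w)"

definition move :: "nat \<Rightarrow> 'w \<Rightarrow> 'a \<times> real \<times> 's" where
  "move t w = (A t w, Rw t w, S (Suc t) w)"

lemma data_hist_eq: "data_hist S A Rw t w = hist (Suc t) w"
  by (simp add: data_hist_def hist_def)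

lemma finite_rew_support: "finite Rs"
  by (simp add: rew_support_def fin_rew)

lemma finite_moves: "finite moves"
  by (simp add: moves_def finite_rew_support)

lemma move_prob_nonneg: "0 \<le> move_prob s x"
  by (simp add: move_prob_def split: prod.split)

lemma sum_moves: "(\<Sum>x\<in>moves. f x) = (\<Sum>a\<in>UNIV. \<Sum>r\<in>Rs. \<Sum>s'\<in>UNIV. f (a, r, s'))"
  by (simp add: moves_def sum.cartesian_product)

lemma sum_rew: "(\<Sum>r\<in>Rs. pmf (R s a) r) = 1"
  by (rule sum_pmf_eq_1) (auto simp: finite_rew_support, auto simp: rew_support_def)

lemma move_prob_sum: "(\<Sum>x\<in>moves. move_prob s x) = 1"
  by (simp add: sum_moves move_prob_def sum_distrib_left[symmetric] sum_rew sum_pmf_UNIV_finite)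

lemma hist_eq_iff: "hist t w = hist t w' \<longleftrightarrow> (\<forall>i<t. sample S A Rw i w = sample S A Rw i w')"
  by (auto simp: hist_def)

lemma past_eq_iff: "past t w = past t w' \<longleftrightarrow>
   (\<forall>i<t. S i w = S i w' \<and> A i w = A i w' \<and> Rw i w = Rw i w') \<and> S t w = S t w'"
proof -
  have "S (Suc i) w = S (Suc i) w'"
    if "\<forall>i<t. S i w = S i w' \<and> A i w = A i w' \<and> Rw i w = Rw i w'" "S t w = S t w'" "i < t" for i
    using that by (cases "Suc i = t") auto
  then show ?thesis
    by (auto simp: past_def hist_eq_iff sample_def)
qed

lemma past_Suc_eq_iff: "past (Suc t) w = past (Suc t) w' \<longleftrightarrow> past t w = past t w' \<and> move t w = move t w'"
  by (auto simp: past_eq_iff move_def less_Suc_eq)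

lemma past_eq_hist: "past (Suc t) w = past (Suc t) w' \<longleftrightarrow> hist (Suc t) w = hist (Suc t) w'"
  by (auto simp: past_def hist_eq_iff sample_def)

text \<open>An outcome \<open>w0\<close> realising \<open>y\<close> turns the event into finitely
  many coordinate equations, each of them measurable; an unrealised \<open>y\<close> gives the empty
  event.\<close>

lemma past_event: "{w \<in> space M. past t w = y} \<in> sets M"
proof (cases "\<exists>w0\<in>space M. past t w0 = y")
  case True
  then obtain w0 where "y = past t w0" by auto
  then show ?thesis by (simp add: past_eq_iff)
next
  case False
  then have "{w \<in> space M. past t w = y} = {}" by auto
  then show ?thesis by (metis sets.empty_sets)
qed

lemma move_event: "{w \<in> space M. move t w = x} \<in> sets M"
  by (cases x) (simp add: move_def)

lemma past_move_event: "{w \<in> space M. (past t w, move t w) = z} \<in> sets M"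
proof -
  have "{w \<in> space M. (past t w, move t w) = z}
      = {w \<in> space M. past t w = fst z} \<inter> {w \<in> space M. move t w = snd z}"
    by auto
  then show ?thesis using past_event move_event by auto
qed

text \<open>The two events are cylinders of one path, cut off at \<open>Suc t\<close> and at
  \<open>t\<close>, so their probabilities differ by the last factor of the product. The path is
  read off a realising outcome \<open>w0\<close> and continued by the given move.\<close>

lemma prob_past_move:
  "prob {w \<in> space M. (past t w, move t w) = (y, x)}
     = prob {w \<in> space M. past t w = y} * move_prob (snd y) x"
proof (cases "\<exists>w0\<in>space M. past t w0 = y")
  case True
  then obtain w0 where y: "y = past t w0" by auto
  obtain a r s' where x: "x = (a, r, s')" by (cases x)
  define ss where "ss = (\<lambda>i. S i w0)(Suc t := s')"
  define as where "as = (\<lambda>i. A i w0)(t := a)"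
  define rs where "rs = (\<lambda>i. Rw i w0)(t := r)"
  have "{w \<in> space M. (past t w, move t w) = (y, x)}
     = {w \<in> space M. (\<forall>i<Suc t. S i w = ss i \<and> A i w = as i \<and> Rw i w = rs i) \<and> S (Suc t) w = ss (Suc t)}"
    by (auto simp: y x past_eq_iff move_def ss_def as_def rs_def less_Suc_eq)
  moreover have "{w \<in> space M. past t w = y}
     = {w \<in> space M. (\<forall>i<t. S i w = ss i \<and> A i w = as i \<and> Rw i w = rs i) \<and> S t w = ss t}"
    by (auto simp: y past_eq_iff ss_def as_def rs_def)
  moreover have "move_prob (snd y) x
     = pmf (b (ss t)) (as t) * pmf (R (ss t) (as t)) (rs t) * pmf (P (ss t) (as t)) (ss (Suc t))"
    by (simp add: y past_def x move_prob_def ss_def as_def rs_def)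
  ultimately show ?thesis
    by (simp only: path_law prod.lessThan_Suc mult.assoc)
next
  case False
  then have "{w \<in> space M. (past t w, move t w) = (y, x)} = {}" "{w \<in> space M. past t w = y} = {}"
    by auto
  then show ?thesis by (simp only: measure_empty mult_zero_left)
qed

definition pasts :: "nat \<Rightarrow> (('s \<times> 'a \<times> real \<times> 's) list \<times> 's) set" where
  "pasts t = {l. set l \<subseteq> UNIV \<times> UNIV \<times> Rs \<times> UNIV \<and> length l = t} \<times> UNIV"

lemma finite_pasts: "finite (pasts t)"
  unfolding pasts_def by (intro finite_cartesian_product finite_lists_length_eq) (auto simp: finite_rew_support)

lemma past_in_pasts: "past t w \<in> pasts t \<longleftrightarrow> (\<forall>i<t. Rw i w \<in> Rs)"
  by (auto simp: past_def pasts_def hist_def sample_def image_subset_iff)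

text \<open>Rewards are real-valued, so leaving \<open>Rs\<close> is not a countable union of events
  whose probability \<open>path_law\<close> states. Instead mass is counted: inductively the
  finitely many supported pasts have total probability 1, the moves out of each have total
  probability 1, and so the supported continuations exhaust the space.\<close>

lemma AE_Rw: "AE w in M. Rw t w \<in> Rs"
proof -
  have "AE w in M. \<forall>i<t. Rw i w \<in> Rs" for t
  proof (induction t)
    case (Suc t)
    have AEp: "AE w in M. past t w \<in> pasts t"
      using Suc by (simp add: past_in_pasts)
    have one: "(\<Sum>y\<in>pasts t. prob {w \<in> space M. past t w = y}) = 1"
      using integral_finite_range[OF finite_pasts past_event AEp, of "\<lambda>_. 1" "\<lambda>_. 1"]
      by (simp add: prob_space)
    let ?E = "\<lambda>z. {w \<in> space M. (past t w, move t w) = z}"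
    have "prob (\<Union>z\<in>pasts t \<times> moves. ?E z) = (\<Sum>z\<in>pasts t \<times> moves. prob (?E z))"
      using past_move_event
      by (intro finite_measure_finite_Union)
        (auto simp: finite_pasts finite_moves disjoint_family_on_def)
    also have "\<dots> = (\<Sum>y\<in>pasts t. \<Sum>x\<in>moves. prob (?E (y, x)))"
      unfolding sum.cartesian_product by (intro sum.cong refl) auto
    also have "\<dots> = 1"
      unfolding prob_past_move by (simp add: sum_distrib_left[symmetric] move_prob_sum one)
    finally have "AE w in M. w \<in> (\<Union>z\<in>pasts t \<times> moves. ?E z)"
      using past_move_event finite_pasts finite_moves
      by (subst prob_eq_1[symmetric]) (auto intro!: sets.finite_UN)
    then show ?case
      by eventually_elim (auto simp: less_Suc_eq past_in_pasts moves_def move_def)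
  qed simp
  note this[of "Suc t"]
  then show ?thesis by eventually_elim auto
qed

lemma AE_past: "AE w in M. past t w \<in> pasts t"
proof -
  have "AE w in M. \<forall>i\<in>{..<t}. Rw i w \<in> Rs"
    by (subst AE_finite_all) (auto intro: AE_Rw)
  then show ?thesis by (simp add: past_in_pasts Ball_def)
qed

text \<open>The Markov property in integral form. Both integrands almost surely take finitely many
  values, so both integrals become finite sums over pasts, which \<open>prob_past_move\<close>
  matches term by term.\<close>

theorem integral_next_move:
  fixes f :: "'w \<Rightarrow> 'a \<times> real \<times> 's \<Rightarrow> real"
  assumes past: "\<And>w w' x. past t w = past t w' \<Longrightarrow> f w x = f w' x"
    and m1: "(\<lambda>w. f w (move t w)) \<in> borel_measurable M"
    and m2: "(\<lambda>w. \<Sum>x\<in>moves. move_prob (S t w) x * f w x) \<in> borel_measurable M"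
  shows "(\<integral>w. f w (move t w) \<partial>M) = (\<integral>w. (\<Sum>x\<in>moves. move_prob (S t w) x * f w x) \<partial>M)"
proof -
  \<comment> \<open>A representative outcome for each past. Since \<open>f\<close> depends on the
    outcome only through its past, this exhibits \<open>f\<close> as a function of the finite-range
    variable \<open>past t\<close>.\<close>
  define W where "W y = (SOME w. past t w = y)" for y
  have W: "past t (W (past t w)) = past t w" for w
    unfolding W_def by (rule someI[of _ w]) simp
  have f: "f w x = f (W (past t w)) x" for w x
    by (rule past) (simp add: W)
  have AE2: "AE w in M. (past t w, move t w) \<in> pasts t \<times> moves"
    using AE_past[of t] AE_Rw[of t] by eventually_elim (auto simp: moves_def move_def)
  have "(\<integral>w. f w (move t w) \<partial>M)
     = (\<Sum>z\<in>pasts t \<times> moves. prob {w \<in> space M. (past t w, move t w) = z} * f (W (fst z)) (snd z))"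
    by (rule integral_finite_range[OF _ past_move_event AE2 m1])
      (use f in \<open>auto simp: finite_pasts finite_moves\<close>)
  also have "\<dots> = (\<Sum>y\<in>pasts t. \<Sum>x\<in>moves.
       prob {w \<in> space M. (past t w, move t w) = (y, x)} * f (W y) x)"
    unfolding sum.cartesian_product by (intro sum.cong refl) auto
  also have "\<dots> = (\<Sum>y\<in>pasts t. prob {w \<in> space M. past t w = y} *
       (\<Sum>x\<in>moves. move_prob (snd y) x * f (W y) x))"
    unfolding prob_past_move by (simp add: sum_distrib_left mult.assoc)
  also have "\<dots> = (\<integral>w. (\<Sum>x\<in>moves. move_prob (S t w) x * f w x) \<partial>M)"
    by (rule integral_finite_range[OF finite_pasts past_event AE_past m2, symmetric])
      (subst f, simp add: past_def)
  finally show ?thesis .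
qed

end

section \<open>Rates from the scalar recursion\<close>

lemma sum_inverse_le_ln: "1 \<le> T \<Longrightarrow> (\<Sum>t=1..T. 1 / real t) \<le> 1 + ln (real T)"
proof (induction T rule: dec_induct)
  case (step T)
  have "1 / (1 + real T) \<le> ln (1 + real T) - ln (real T)"
  proof -
    have "ln (real T / (1 + real T)) \<le> real T / (1 + real T) - 1"
      using step.hyps by (intro ln_le_minus_one) auto
    then show ?thesis
      using step.hyps by (simp add: ln_div field_simps)
  qed
  then show ?case using step.IH by (simp add: add.commute)
qed simp

text \<open>With x = c eta_t / 2 the recursion reads x' = x exp(-x), so the reciprocal grows by (exp
  x - 1) / x, which lies in [1, 2] for 0 < x \<le> 1. Starting from 1 / x in [1, 2], the reciprocal
  stays between t and 2 t.\<close>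

lemma step_size_bounds:
  fixes eta :: "nat \<Rightarrow> real"
  assumes c: "0 < c" and eta1: "1 / c \<le> eta 1" "eta 1 \<le> 2 / c"
    and rec: "\<And>t. 1 \<le> t \<Longrightarrow> eta (Suc t) = exp (- (1/2) * c * eta t) * eta t"
    and t: "1 \<le> t"
  shows "1 / real t \<le> c * eta t" "c * eta t \<le> 2 / real t"
proof -
  have "0 < eta t \<and> real t \<le> 1 / (c * eta t / 2) \<and> 1 / (c * eta t / 2) \<le> 2 * real t"
    using t
  proof (induction t rule: dec_induct)
    case base
    have "0 < 1 / c" using c by simp
    with eta1 have "0 < eta 1" by linarith
    then show ?case using eta1 c by (simp add: field_simps)
  next
    case (step t)
    define x where "x = c * eta t / 2"
    have x: "0 < x" "real t \<le> 1 / x" "1 / x \<le> 2 * real t"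
      using step.IH c by (auto simp: x_def)
    have "x * real t \<le> 1" using x by (simp add: field_simps)
    moreover have "x * 1 \<le> x * real t" using x step.hyps by (intro mult_left_mono) auto
    ultimately have x1: "x \<le> 1" by simp
    have ex: "c * eta (Suc t) / 2 = x * exp (- x)"
      using rec[OF step.hyps(1)] by (simp add: x_def field_simps)
    have inv: "1 / (c * eta (Suc t) / 2) = exp x / x"
      unfolding ex using x by (simp add: exp_minus field_simps)
    have "1 / x + 1 = (1 + x) / x" using x by (simp add: field_simps)
    also have "\<dots> \<le> exp x / x" using x by (intro divide_right_mono) auto
    finally have lo: "1 / x + 1 \<le> exp x / x" .
    have "exp x \<le> 1 + x + x\<^sup>2" using x x1 by (intro exp_bound) auto
    also have "\<dots> \<le> 1 + 2 * x" using x x1 by (simp add: power2_eq_square mult_left_le_one_le)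
    finally have "exp x / x \<le> (1 + 2 * x) / x" using x by (intro divide_right_mono) auto
    also have "\<dots> = 1 / x + 2" using x by (simp add: field_simps)
    finally have hi: "exp x / x \<le> 1 / x + 2" .
    show ?case
      unfolding inv using lo hi x rec[OF step.hyps(1)] step.IH by auto
  qed
  then show "1 / real t \<le> c * eta t" "c * eta t \<le> 2 / real t"
    using c t by (auto simp: field_simps)
qed

text \<open>The interface between probability and rates: \<open>a\<close> is the mean squared
  distance, \<open>m\<close> the mean pairing with the averaged field, \<open>H\<close> the mean of
  the Poisson solution along the path. \<open>lam\<close> is the Young parameter, quantified
  universally so that each rate can choose its own. The recursion starts at \<open>t = 1\<close>,
  where the moment bound on the estimation error starts.\<close>

definition sgd_drift :: "real \<Rightarrow> (nat \<Rightarrow> real) \<Rightarrow> (nat \<Rightarrow> real) \<Rightarrow> (nat \<Rightarrow> real) \<Rightarrow> (nat \<Rightarrow> real) \<Rightarrow> bool" where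
  "sgd_drift K eta m H a \<longleftrightarrow> 0 < K \<and> (\<forall>t. 0 \<le> a t \<and> a t \<le> K \<and> \<bar>H t\<bar> \<le> K) \<and>
     (\<forall>t\<ge>1. \<forall>lam>0. a (Suc t) \<le> a t - 2 * eta (Suc t) * m t - 2 * eta (Suc t) * (H t - H (Suc t))
        + K * eta (Suc t) * (lam * a t + 1 / (lam * real t) + 1 / real t + eta (Suc t)))"

text \<open>The choice lam = 1 / sqrt t balances \<open>lam * a t\<close> against
  \<open>1 / (lam * real t)\<close>. Division by twice the step size makes \<open>H\<close>
  telescope exactly and leaves an error of order 1 / sqrt t, while \<open>a\<close> acquires
  increasing weights and is handled by summation by parts. The logarithm enters only in the final
  estimate.\<close>

lemma drift_rate_sqrt:
  assumes drift: "sgd_drift K (\<lambda>t. eta0 / sqrt (real t)) m H a" and eta0: "0 < eta0"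
  obtains K' where "\<And>T. 2 \<le> T \<Longrightarrow> (1 / real T) * (\<Sum>t=1..T. m t) \<le> K' * ln (real T) / sqrt (real T)"
proof -
  have K: "0 < K" and a0: "0 \<le> a t" and aK: "a t \<le> K" and HK: "\<bar>H t\<bar> \<le> K" for t
    using drift by (auto simp: sgd_drift_def)
  \<comment> \<open>The bracket of the recursion is at most (K + 2 + eta0) / sqrt t:
    \<open>K\<close> comes from \<open>lam * a t\<close>, 1 from each of the two terms with
    \<open>1 / t\<close>, and \<open>eta0\<close> from the step size. The half comes from dividing
    by \<open>2 * eta\<close>.\<close>
  define B where "B = K * (K + 2 + eta0) / 2"
  have B0: "0 \<le> B" using K eta0 by (simp add: B_def)
  define q where "q t = sqrt (real t) / (2 * eta0)" for t
  have step: "m t \<le> q (Suc t) * (a t - a (Suc t)) - (H t - H (Suc t)) + B / sqrt (real t)"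
    if t: "1 \<le> t" for t
  proof -
    let ?e = "eta0 / sqrt (real (Suc t))"
    let ?r = "1 / sqrt (real t)"
    have r0: "0 < ?r" "?r \<le> 1" using t by auto
    have e0: "0 < ?e" using eta0 by simp
    have rr: "1 / real t = ?r * ?r" by simp
    have "1 / real t \<le> ?r" unfolding rr by (rule mult_left_le) (use r0 in auto)
    moreover have "1 / (?r * real t) = ?r"
      using t by (simp add: field_simps)
    moreover have "?r * a t \<le> ?r * K" using r0 aK by (intro mult_left_mono) auto
    moreover have "?e \<le> eta0 * ?r"
      using t eta0 by (simp add: field_simps)
    ultimately have "?r * a t + 1 / (?r * real t) + 1 / real t + ?e \<le> (K + 2 + eta0) * ?r"
      by (simp only: distrib_right) simp
    then have "K * ?e * (?r * a t + 1 / (?r * real t) + 1 / real t + ?e) \<le> K * ?e * ((K + 2 + eta0) * ?r)"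
      by (rule mult_left_mono) (use K eta0 in simp)
    also have "\<dots> = 2 * ?e * (B * ?r)" by (simp add: B_def)
    finally have "a (Suc t) \<le> a t - 2 * ?e * m t - 2 * ?e * (H t - H (Suc t)) + 2 * ?e * (B * ?r)"
      using drift t r0 unfolding sgd_drift_def by fastforce
    moreover have "2 * x * (m t + h - B * r) \<le> a t - y"
      if "y \<le> a t - 2 * x * m t - 2 * x * h + 2 * x * (B * r)" for x r h y
      using that by (simp add: algebra_simps)
    ultimately have "2 * ?e * (m t + (H t - H (Suc t)) - B * ?r) \<le> a t - a (Suc t)"
      by blast
    then have "m t + (H t - H (Suc t)) - B * ?r \<le> (a t - a (Suc t)) / (2 * ?e)"
      using mult_pos_pos[of 2, OF _ e0] by (subst pos_le_divide_eq) (simp_all only: mult.commute)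
    also have "\<dots> = q (Suc t) * (a t - a (Suc t))" by (simp add: q_def)
    finally show ?thesis by simp
  qed
  have qmono: "q t \<le> q (Suc t)" for t using eta0 by (simp add: q_def divide_right_mono)
  \<comment> \<open>The boundary term \<open>q (Suc T) * a (Suc T)\<close> stays on the left so that
    the induction carries out the summation by parts; the increments of \<open>q\<close> are paid
    for with the bound \<open>K\<close> on \<open>a\<close> and add up to
    \<open>K * q (Suc T)\<close>.\<close>
  have main: "(\<Sum>t=1..T. m t) + q (Suc T) * a (Suc T)
      \<le> H (Suc T) - H 1 + K * q (Suc T) + 2 * B * sqrt (real T)" for T
  proof (induction T)
    case 0
    show ?case using aK[of 1] eta0 by (simp add: q_def mult.commute mult_left_mono divide_right_mono)
  next
    case (Suc T)
    have "(q (Suc (Suc T)) - q (Suc T)) * a (Suc T) \<le> (q (Suc (Suc T)) - q (Suc T)) * K"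
      using qmono aK by (intro mult_left_mono) auto
    moreover have "B / sqrt (real (Suc T)) \<le> 2 * B * sqrt (real (Suc T)) - 2 * B * sqrt (real T)"
    proof -
      let ?u = "sqrt (real (Suc T))" and ?v = "sqrt (real T)"
      have u: "0 < ?u" "0 \<le> ?v" "?v \<le> ?u" by auto
      have "1 = (?u - ?v) * (?u + ?v)" by (simp add: algebra_simps)
      also have "\<dots> \<le> (?u - ?v) * (2 * ?u)" using u by (intro mult_left_mono) auto
      finally have "1 \<le> 2 * (?u - ?v) * ?u" by (simp only: mult_ac)
      then have "1 / ?u \<le> 2 * (?u - ?v)" using u(1) by (simp only: pos_divide_le_eq)
      from mult_left_mono[OF this B0] show ?thesis by (simp add: algebra_simps)
    qed
    ultimately show ?case
      using step[of "Suc T"] Suc by (simp add: algebra_simps)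
  qed
  \<comment> \<open>The inner factor bounds the sum divided by sqrt T; the outer 2 pays for
    \<open>1 \<le> 2 * ln (real T)\<close>, valid from T = 2 on.\<close>
  define K' where "K' = 2 * (2 * K + K / eta0 + 2 * B)"
  show ?thesis
  proof (rule that[of K'])
    fix T :: nat assume T: "2 \<le> T"
    let ?s = "sqrt (real T)"
    have s1: "1 \<le> ?s" using T by simp
    have "sqrt (real (Suc T)) \<le> sqrt (4 * real T)" using T by (intro real_sqrt_le_mono) auto
    also have "\<dots> = 2 * ?s" by (simp add: real_sqrt_mult)
    finally have "q (Suc T) \<le> ?s / eta0" using eta0 by (simp add: q_def field_simps)
    then have "K * q (Suc T) \<le> K * (?s / eta0)" using K by (intro mult_left_mono) auto
    moreover have "0 \<le> q (Suc T) * a (Suc T)" using a0 eta0 by (simp add: q_def)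
    moreover have "H (Suc T) - H 1 \<le> 2 * K" using HK[of "Suc T"] HK[of 1] by linarith
    moreover have "2 * K \<le> 2 * K * ?s" using K s1 by simp
    ultimately have "(\<Sum>t=1..T. m t) \<le> 2 * K * ?s + K * (?s / eta0) + 2 * B * ?s"
      using main[of T] by linarith
    also have "\<dots> = K' / 2 * ?s" by (simp add: K'_def algebra_simps)
    also have "\<dots> \<le> K' * ln (real T) * ?s"
    proof -
      have "1 / 2 \<le> ln (2::real)" using ln2_ge_two_thirds by linarith
      also have "\<dots> \<le> ln (real T)" using T by simp
      finally have "K' * (1 / 2) \<le> K' * ln (real T)"
        using K B0 eta0 by (intro mult_left_mono) (auto simp: K'_def)
      then show ?thesis using s1 by (intro mult_right_mono) auto
    qed
    finally have "(1 / real T) * (\<Sum>t=1..T. m t) \<le> (1 / real T) * (K' * ln (real T) * ?s)"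
      by (intro mult_left_mono) auto
    also have "\<dots> = K' * ln (real T) / ?s"
    proof -
      have "real T = ?s * ?s" by simp
      then show ?thesis using s1 by (subst \<open>real T = _\<close>) (simp add: field_simps)
    qed
    finally show "(1 / real T) * (\<Sum>t=1..T. m t) \<le> K' * ln (real T) / ?s" .
  qed
qed

text \<open>With lam = c / K the Young term equals \<open>c * eta * a t\<close>, half of what the
  contraction supplies. Multiplication by t + 1 turns \<open>1 - c * eta (Suc t)\<close> into at
  most t, because \<open>c * eta (Suc t)\<close> is at least 1 / (t + 1), so
  \<open>real t * a t\<close> telescopes up to errors of order 1 / t. Thus \<open>a t\<close> is
  O(log t / t) and averaging adds a second logarithm; the third is slack.\<close>

lemma drift_rate_log:
  assumes drift: "sgd_drift K eta m H a" and c: "0 < c" and m: "\<And>t. c * a t \<le> m t"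
    and eta1: "1 / c \<le> eta 1" "eta 1 \<le> 2 / c"
    and rec: "\<And>t. 1 \<le> t \<Longrightarrow> eta (Suc t) = exp (- (1/2) * c * eta t) * eta t"
  obtains K' where "0 \<le> K'"
    "\<And>T. 2 \<le> T \<Longrightarrow> (1 / real T) * (\<Sum>t=1..T. a t) \<le> K' * (ln (real T))^3 / real T"
proof -
  have K: "0 < K" and a0: "0 \<le> a t" and aK: "a t \<le> K" and HK: "\<bar>H t\<bar> \<le> K" for t
    using drift by (auto simp: sgd_drift_def)
  have lo: "1 / real t \<le> c * eta t" and hi: "c * eta t \<le> 2 / real t" if "1 \<le> t" for t
    using step_size_bounds[of c eta t] c eta1 rec that by blast+
  have eta_pos: "0 < eta t" if "1 \<le> t" for t
  proof -
    have "0 < 1 / real t" using that by simp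
    also have "\<dots> \<le> c * eta t" by (rule lo[OF that])
    finally show ?thesis using c by (simp add: zero_less_mult_iff)
  qed
  have eta_hi: "eta t \<le> 2 / c / real t" if "1 \<le> t" for t
  proof -
    have "eta t = c * eta t / c" using c by simp
    also have "\<dots> \<le> 2 / real t / c" using hi[OF that] c by (intro divide_right_mono) auto
    finally show ?thesis by (simp add: mult.commute)
  qed
  \<comment> \<open>The weight that \<open>H\<close> receives after multiplication by the time
    index. It is bounded and varies by O(1 / t), so summation by parts against the bounded
    \<open>H\<close> costs only a harmonic sum.\<close>
  define w where "w t = real t * eta t" for t
  have w_hi: "w t \<le> 2 / c" if "1 \<le> t" for t
  proof -
    have "real t * eta t \<le> real t * (2 / c / real t)"
      using eta_hi[OF that] by (intro mult_left_mono) auto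
    then show ?thesis using that by (simp add: w_def)
  qed
  have w_pos: "0 < w t" if "1 \<le> t" for t
    using eta_pos[OF that] that by (simp add: w_def)
  \<comment> \<open>\<open>K * (2 / c)\<close> bounds \<open>K * w\<close>; the bracket collects the
    remaining terms, using 1 / t \<le> 2 / s and eta \<le> (2 / c) / s for s = t + 1. The
    \<open>8 * K / c\<close> added in \<open>B\<close> is 2 times 4 / c times K, from the variation
    of \<open>w\<close> against \<open>H\<close>.\<close>
  define B1 where "B1 = K * (2 / c) * (2 * K / c + 2 + 2 / c)"
  define B where "B = B1 + 8 * K / c"
  have B0: "0 \<le> B" using K c by (simp add: B_def B1_def)
  have descent: "real (Suc t) * a (Suc t) - 2 * w (Suc t) * H (Suc t)
     \<le> real t * a t - 2 * w t * H t + B / real (Suc t)" if t: "1 \<le> t" for t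
  proof -
    define s where "s = real (Suc t)"
    define e where "e = eta (Suc t)"
    have s: "0 < s" "s = real t + 1" by (auto simp: s_def)
    have e: "0 < e" using eta_pos[of "Suc t"] by (simp add: e_def)
    have it: "1 / real t \<le> 2 / s" using t by (simp add: s(2) field_simps)
    have eh: "e \<le> 2 / c / s" using eta_hi[of "Suc t"] by (simp add: e_def s_def)
    have we: "w (Suc t) = s * e" by (simp add: w_def s_def e_def)
    have "a (Suc t) \<le> a t - 2 * e * m t - 2 * e * (H t - H (Suc t))
        + K * e * (c / K * a t + 1 / (c / K * real t) + 1 / real t + e)"
      using drift t K c unfolding sgd_drift_def e_def by (meson divide_pos_pos)
    also have "K * e * (c / K * a t + 1 / (c / K * real t) + 1 / real t + e)
        = e * c * a t + K * e * (K / c * (1 / real t) + 1 / real t + e)"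
      using K c t by (simp add: field_simps)
    finally have "a (Suc t) \<le> a t - 2 * e * m t - 2 * e * (H t - H (Suc t))
        + (e * c * a t + K * e * (K / c * (1 / real t) + 1 / real t + e))" .
    moreover have "2 * e * (c * a t) \<le> 2 * e * m t" using e m by (intro mult_left_mono) auto
    ultimately have 1: "a (Suc t) \<le> (1 - c * e) * a t - 2 * e * (H t - H (Suc t))
        + K * e * (K / c * (1 / real t) + 1 / real t + e)"
      by (simp add: algebra_simps)
    have "K / c * (1 / real t) \<le> K / c * (2 / s)" using K c it by (intro mult_left_mono) auto
    then have "K / c * (1 / real t) + 1 / real t + e \<le> (2 * K / c + 2 + 2 / c) * (1 / s)"
      using it eh by (simp add: algebra_simps add_divide_distrib)
    then have "K * e * (K / c * (1 / real t) + 1 / real t + e)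
        \<le> K * e * ((2 * K / c + 2 + 2 / c) * (1 / s))"
      using K e by (intro mult_left_mono) auto
    with 1 have "a (Suc t) \<le> (1 - c * e) * a t - 2 * e * (H t - H (Suc t))
        + K * e * ((2 * K / c + 2 + 2 / c) * (1 / s))" by linarith
    from mult_left_mono[OF this, of s] s(1)
    have "s * a (Suc t) \<le> s * ((1 - c * e) * a t - 2 * e * (H t - H (Suc t))
        + K * e * ((2 * K / c + 2 + 2 / c) * (1 / s)))"
      by (simp only: less_imp_le)
    moreover have "s * ((1 - c * e) * x - 2 * e * y + K * e * z)
        = (s - c * (s * e)) * x - 2 * (s * e) * y + K * (s * e) * z" for x y z
      by (simp add: algebra_simps)
    ultimately have 2: "s * a (Suc t) \<le> (s - c * (s * e)) * a t - 2 * (s * e) * (H t - H (Suc t))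
        + K * (s * e) * ((2 * K / c + 2 + 2 / c) * (1 / s))"
      by metis
    have "1 \<le> c * (s * e)"
      using lo[of "Suc t"] s by (simp add: e_def s_def field_simps)
    then have "(s - c * (s * e)) * a t \<le> real t * a t"
      using a0 s by (intro mult_right_mono) auto
    moreover have "K * (s * e) * ((2 * K / c + 2 + 2 / c) * (1 / s)) \<le> B1 / s"
    proof -
      have "K * (s * e) * ((2 * K / c + 2 + 2 / c) * (1 / s))
          \<le> K * (2 / c) * ((2 * K / c + 2 + 2 / c) * (1 / s))"
        using K c s w_hi[of "Suc t"] we by (intro mult_right_mono mult_left_mono) auto
      then show ?thesis by (simp add: B1_def)
    qed
    ultimately have 3: "s * a (Suc t) \<le> real t * a t - 2 * w (Suc t) * (H t - H (Suc t)) + B1 / s"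
      using 2 unfolding we by linarith
    \<comment> \<open>The recursion gives
      \<open>w (Suc t) - w t = eta t * (s * exp (- x) - real t)\<close>. By 1 - x \<le> exp(-x)
      \<le> 1 and s x \<le> 2 the second factor lies in [-1, 1], so the variation is at most
      \<open>eta t\<close>.\<close>
    have "\<bar>w (Suc t) - w t\<bar> \<le> 4 / c * (1 / s)"
    proof -
      define x where "x = c * eta t / 2"
      have x: "0 < x" "x * real t \<le> 1"
        using hi[of t] t c eta_pos[OF t] by (auto simp: x_def field_simps)
      have "w (Suc t) - w t = eta t * (s * exp (- x) - real t)"
        using rec[OF t] by (simp add: w_def s_def x_def algebra_simps)
      moreover have "\<bar>s * exp (- x) - real t\<bar> \<le> 1"
      proof -
        have "s * exp (- x) \<le> s * 1" using s x by (intro mult_left_mono) auto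
        moreover have "s * (1 - x) \<le> s * exp (- x)"
          using s exp_ge_add_one_self[of "- x"] by (intro mult_left_mono) auto
        moreover have "s * x \<le> 2"
        proof -
          have "x * 1 \<le> x * real t" using x t by (intro mult_left_mono) auto
          then have "x \<le> 1" using x by linarith
          then show ?thesis using x by (simp add: s(2) algebra_simps)
        qed
        ultimately show ?thesis using s(2) by (simp add: algebra_simps)
      qed
      ultimately have "\<bar>w (Suc t) - w t\<bar> \<le> eta t * 1"
        using eta_pos[OF t] by (simp add: abs_mult)
      also have "\<dots> \<le> 2 / c * (1 / real t)" using eta_hi[OF t] by simp
      also have "\<dots> \<le> 2 / c * (2 / s)" using c it by (intro mult_left_mono) auto
      finally show ?thesis by simp
    qed
    then have "\<bar>w (Suc t) - w t\<bar> * \<bar>H t\<bar> \<le> 4 / c * (1 / s) * K"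
      using HK[of t] c s by (intro mult_mono) auto
    then have "- 2 * ((w (Suc t) - w t) * H t) \<le> 8 * K / c * (1 / s)"
      unfolding abs_mult[symmetric] by (simp add: abs_le_iff)
    then show ?thesis
      using 3 unfolding s_def[symmetric] B_def by (simp add: algebra_simps add_divide_distrib)
  qed
  \<comment> \<open>\<open>a 1\<close> plus the two boundary values of \<open>2 * w t * H t\<close>,
    at time 1 and at the final time, each at most 4 K / c.\<close>
  define Q where "Q = a 1 + 4 * K / c + 4 * K / c"
  have wH: "\<bar>2 * w t * H t\<bar> \<le> 4 * K / c" if "1 \<le> t" for t
  proof -
    have "\<bar>w t\<bar> * \<bar>H t\<bar> \<le> (2 / c) * K"
      using w_hi[OF that] w_pos[OF that] HK c by (intro mult_mono) auto
    from mult_left_mono[OF this, of 2] show ?thesis by (simp add: abs_mult mult_ac)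
  qed
  have main: "real T * a T - 2 * w T * H T \<le> a 1 - 2 * w 1 * H 1 + B * (\<Sum>t=1..T. 1 / real t)"
    if "1 \<le> T" for T
    using that
  proof (induction T rule: dec_induct)
    case (step T)
    then show ?case using descent[of T] by (simp add: distrib_left del: of_nat_Suc)
  qed (use B0 in simp)
  have aT: "a T \<le> (Q + B) * (1 + ln (real T)) * (1 / real T)" if T: "1 \<le> T" for T
  proof -
    have Q0: "0 \<le> Q" using a0 K c by (simp add: Q_def)
    have ln0: "0 \<le> ln (real T)" using T by simp
    have "real T * a T \<le> Q + B * (\<Sum>t=1..T. 1 / real t)"
      using main[OF T] wH[OF T] wH[of 1] unfolding Q_def by (simp add: abs_le_iff)
    also have "\<dots> \<le> Q + B * (1 + ln (real T))"
      using sum_inverse_le_ln[OF T] B0 by (intro add_left_mono mult_left_mono) auto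
    also have "\<dots> \<le> (Q + B) * (1 + ln (real T))"
      using Q0 ln0 by (simp add: algebra_simps)
    finally show ?thesis using T by (simp add: field_simps)
  qed
  show ?thesis
  \<comment> \<open>For L = ln T \<ge> 1 / 2 one has 1 + L \<le> 3 L and 1 \<le> 2 L, so the square
    of 1 + L is at most 9 * 2 times the cube of L.\<close>
  proof (rule that[of "18 * (Q + B)"])
    show QB: "0 \<le> 18 * (Q + B)" using a0 K c B0 by (simp add: Q_def)
    fix T :: nat assume T: "2 \<le> T"
    let ?L = "ln (real T)"
    have "ln 2 \<le> ?L" using T by simp
    then have L: "1 / 2 \<le> ?L" using ln2_ge_two_thirds by linarith
    have "(\<Sum>t=1..T. a t) \<le> (\<Sum>t=1..T. (Q + B) * (1 + ?L) * (1 / real t))"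
    proof (rule sum_mono)
      fix t assume t: "t \<in> {1..T}"
      then have "a t \<le> (Q + B) * (1 + ln (real t)) * (1 / real t)" using aT by auto
      also have "\<dots> \<le> (Q + B) * (1 + ?L) * (1 / real t)"
        using t QB by (intro mult_right_mono mult_left_mono) auto
      finally show "a t \<le> (Q + B) * (1 + ?L) * (1 / real t)" .
    qed
    also have "\<dots> = (Q + B) * (1 + ?L) * (\<Sum>t=1..T. 1 / real t)" by (simp add: sum_distrib_left)
    also have "\<dots> \<le> (Q + B) * (1 + ?L) * (1 + ?L)"
      using sum_inverse_le_ln[of T] T QB L by (intro mult_left_mono) auto
    also have "\<dots> = (Q + B) * (1 + ?L)\<^sup>2" by (simp add: power2_eq_square)
    also have "\<dots> \<le> (Q + B) * (18 * ?L ^ 3)"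
    proof -
      have "(1 + ?L)\<^sup>2 \<le> (3 * ?L)\<^sup>2" using L by (intro power_mono) auto
      also have "\<dots> = 9 * ?L\<^sup>2 * 1" by (simp add: power2_eq_square)
      also have "\<dots> \<le> 9 * ?L\<^sup>2 * (2 * ?L)" using L by (intro mult_left_mono) auto
      also have "\<dots> = 18 * ?L ^ 3" by (simp add: power2_eq_square power3_eq_cube)
      finally show ?thesis using QB by (intro mult_left_mono) auto
    qed
    finally have "(1 / real T) * (\<Sum>t=1..T. a t) \<le> (1 / real T) * ((Q + B) * (18 * ?L ^ 3))"
      by (intro mult_left_mono) auto
    also have "\<dots> = 18 * (Q + B) * ?L ^ 3 / real T" by simp
    finally show "(1 / real T) * (\<Sum>t=1..T. a t) \<le> 18 * (Q + B) * ?L ^ 3 / real T" .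
  qed
qed

text \<open>For e \<le> 1 the square is expanded, with \<open>gh\<close> bounded by 3 K. For e > 1
  that would produce e^4, so the distance is compared through the displacement: it is at most 3 K
  eta e^2 and gets multiplied by at most 6 r, the displacement plus twice the distance. Then 22 = 18
  + 4, where 4 pays for reinstating the pairing with \<open>g\<close>, at most 2 K r e^2 in absolute
  value. The first bound, linear in e^2, later controls how the Poisson solution changes between
  iterates.\<close>

lemma projected_step:
  fixes th ths g gh :: "'v::euclidean_space"
  assumes C: "closed C" "convex C" "th \<in> C" "ths \<in> C" "\<And>x. x \<in> C \<Longrightarrow> norm x \<le> r"
    and g: "norm g \<le> K" and gh: "norm (gh - g) \<le> K * (e + e\<^sup>2)"
    and e: "0 \<le> e" and eta: "0 \<le> eta"
  defines "th' \<equiv> closest_point C (th - eta *\<^sub>R gh)"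
  shows "norm (th' - th) \<le> 2 * K * eta * (1 + e\<^sup>2)"
    and "(norm (th' - ths))\<^sup>2 \<le> (norm (th - ths))\<^sup>2 - 2 * eta * (g \<bullet> (th - ths))
           + 4 * K * eta * e * norm (th - ths) + 22 * K * r * eta * e\<^sup>2 + 9 * K\<^sup>2 * eta\<^sup>2"
proof -
  have K: "0 \<le> K" using g norm_ge_zero[of g] by linarith
  have r: "0 \<le> r" using C(5)[OF C(3)] norm_ge_zero[of th] by linarith
  have ne: "C \<noteq> {}" using C by auto
  have proj: "norm (th' - x) \<le> norm (th - eta *\<^sub>R gh - x)" if "x \<in> C" for x
    using closest_point_lipschitz[OF C(2,1) ne, of "th - eta *\<^sub>R gh" x] that
    by (simp add: th'_def closest_point_self dist_norm)
  have th': "th' \<in> C" unfolding th'_def using C ne by (simp add: closest_point_in_set)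
  have "norm gh \<le> norm g + norm (gh - g)" using norm_triangle_ineq[of g "gh - g"] by simp
  with g gh have gh0: "norm gh \<le> K * (1 + e + e\<^sup>2)" by (simp add: algebra_simps)
  have "0 \<le> (e - 1)\<^sup>2" by simp
  then have "e \<le> 1 + e\<^sup>2" using e by (simp add: power2_diff)
  then have "K * (1 + e + e\<^sup>2) \<le> K * (2 * (1 + e\<^sup>2))" using K by (intro mult_left_mono) auto
  with gh0 have gh1: "norm gh \<le> 2 * K * (1 + e\<^sup>2)" by (simp add: algebra_simps)
  have d: "norm (th' - th) \<le> eta * norm gh"
    using proj[OF C(3)] eta by simp
  also have "\<dots> \<le> eta * (2 * K * (1 + e\<^sup>2))" using gh1 eta by (rule mult_left_mono)
  finally show "norm (th' - th) \<le> 2 * K * eta * (1 + e\<^sup>2)" by (simp add: mult_ac)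
  let ?D = "th - ths"
  show "(norm (th' - ths))\<^sup>2 \<le> (norm ?D)\<^sup>2 - 2 * eta * (g \<bullet> ?D)
           + 4 * K * eta * e * norm ?D + 22 * K * r * eta * e\<^sup>2 + 9 * K\<^sup>2 * eta\<^sup>2"
  proof (cases "e \<le> 1")
    case True
    have ee: "e\<^sup>2 \<le> e" using True e by (simp add: power2_eq_square mult_left_le_one_le)
    have "(norm (th' - ths))\<^sup>2 \<le> (norm (?D - eta *\<^sub>R gh))\<^sup>2"
      using proj[OF C(4)] by (intro power_mono) (auto simp: algebra_simps)
    also have "\<dots> = (norm ?D)\<^sup>2 - 2 * eta * (gh \<bullet> ?D) + eta\<^sup>2 * (norm gh)\<^sup>2"
      unfolding power2_norm_eq_inner
      by (simp add: inner_diff_left inner_diff_right inner_commute power2_eq_square algebra_simps)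
    also have "gh \<bullet> ?D = g \<bullet> ?D + (gh - g) \<bullet> ?D" by (simp add: inner_diff_left)
    finally have 1: "(norm (th' - ths))\<^sup>2 \<le> (norm ?D)\<^sup>2 - 2 * eta * (g \<bullet> ?D)
       + 2 * eta * (- ((gh - g) \<bullet> ?D)) + eta\<^sup>2 * (norm gh)\<^sup>2" by (simp add: algebra_simps)
    have "\<bar>(gh - g) \<bullet> ?D\<bar> \<le> norm (gh - g) * norm ?D" by (rule Cauchy_Schwarz_ineq2)
    also have "\<dots> \<le> K * (e + e\<^sup>2) * norm ?D" using gh by (intro mult_right_mono) auto
    also have "\<dots> \<le> K * (2 * e) * norm ?D" using ee K by (intro mult_right_mono mult_left_mono) auto
    finally have "2 * eta * (- ((gh - g) \<bullet> ?D)) \<le> 2 * eta * (K * (2 * e) * norm ?D)"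
      using eta by (intro mult_left_mono) auto
    moreover have "eta\<^sup>2 * (norm gh)\<^sup>2 \<le> eta\<^sup>2 * (3 * K)\<^sup>2"
    proof -
      have "K * (1 + e + e\<^sup>2) \<le> K * 3" using True ee K by (intro mult_left_mono) auto
      with gh0 show ?thesis by (intro mult_left_mono power_mono) auto
    qed
    moreover have "0 \<le> 22 * K * r * eta * e\<^sup>2" using K r eta by simp
    moreover have "2 * eta * (K * (2 * e) * norm ?D) = 4 * K * eta * e * norm ?D"
      "eta\<^sup>2 * (3 * K)\<^sup>2 = 9 * K\<^sup>2 * eta\<^sup>2" by (simp_all add: power_mult_distrib)
    ultimately show ?thesis using 1 by linarith
  next
    case False
    then have e1: "1 \<le> e" "e \<le> e\<^sup>2" by (simp_all add: self_le_power)
    have D: "norm ?D \<le> 2 * r"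
      using norm_triangle_ineq4[of th ths] C(5)[OF C(3)] C(5)[OF C(4)] by linarith
    have d': "norm (th' - th) \<le> 2 * r"
      using norm_triangle_ineq4[of th' th] C(5)[OF C(3)] C(5)[OF th'] by linarith
    have "norm (th' - ths) \<le> norm (th' - th) + norm ?D"
      using norm_triangle_ineq[of "th' - th" ?D] by simp
    then have "(norm (th' - ths))\<^sup>2 \<le> (norm (th' - th) + norm ?D)\<^sup>2"
      by (intro power_mono) auto
    also have "\<dots> = (norm ?D)\<^sup>2 + norm (th' - th) * (norm (th' - th) + 2 * norm ?D)"
      by (simp add: power2_eq_square algebra_simps)
    also have "\<dots> \<le> (norm ?D)\<^sup>2 + norm (th' - th) * (6 * r)"
      using D d' by (intro add_left_mono mult_left_mono) auto
    also have "\<dots> \<le> (norm ?D)\<^sup>2 + eta * (K * (3 * e\<^sup>2)) * (6 * r)"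
    proof -
      have "K * (1 + e + e\<^sup>2) \<le> K * (3 * e\<^sup>2)" using e1 K by (intro mult_left_mono) auto
      then have "eta * norm gh \<le> eta * (K * (3 * e\<^sup>2))" using gh0 eta by (intro mult_left_mono) auto
      then have "norm (th' - th) * (6 * r) \<le> eta * (K * (3 * e\<^sup>2)) * (6 * r)"
        using d r by (intro mult_right_mono) auto
      then show ?thesis by simp
    qed
    finally have 1: "(norm (th' - ths))\<^sup>2 \<le> (norm ?D)\<^sup>2 + 18 * K * r * eta * e\<^sup>2" by (simp add: mult_ac)
    have "\<bar>g \<bullet> ?D\<bar> \<le> norm g * norm ?D" by (rule Cauchy_Schwarz_ineq2)
    also have "\<dots> \<le> K * (2 * r)" using g D K by (intro mult_mono) auto
    also have "\<dots> \<le> K * (2 * r) * e\<^sup>2"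
      using e1 K r mult_left_mono[of 1 "e\<^sup>2" "K * (2 * r)"] by auto
    finally have "2 * eta * (g \<bullet> ?D) \<le> 2 * eta * (K * (2 * r) * e\<^sup>2)" using eta by (intro mult_left_mono) auto
    moreover have "0 \<le> 4 * K * eta * e * norm ?D" "0 \<le> 9 * K\<^sup>2 * eta\<^sup>2" using K eta e by auto
    moreover have "2 * eta * (K * (2 * r) * e\<^sup>2) = 4 * K * r * eta * e\<^sup>2" by simp
    ultimately show ?thesis using 1 by linarith
  qed
qed

section \<open>Projected stochastic approximation with Markovian noise\<close>

text \<open>\<open>ghat t\<close> may use the transition at time \<open>t\<close> itself, hence
  adaptedness to \<open>hist (Suc t)\<close>. The error bound is asked for rewards in the support,
  which is an almost sure event. \<open>G\<close>, the mean of \<open>g\<close> given the state, is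
  a parameter so that instances can supply a closed form; \<open>LG\<close> carries no sign.\<close>

locale markov_sgd =
  mdp_path M S A Rw P R b + markov_kernel "kernel_pol b P" mu
  for M :: "'w measure" and S :: "nat \<Rightarrow> 'w \<Rightarrow> 's::finite" and A :: "nat \<Rightarrow> 'w \<Rightarrow> 'a::finite"
    and Rw P R b mu +
  fixes CC :: "(real^'d) set" and thstar theta0 :: "real^'d" and r Kg LG :: real
    and etl :: "nat \<Rightarrow> 'w \<Rightarrow> real"
    and ghat :: "nat \<Rightarrow> real^'d \<Rightarrow> 'w \<Rightarrow> real^'d"
    and g :: "real^'d \<Rightarrow> 's \<times> 'a \<times> real \<times> 's \<Rightarrow> real^'d"
    and G :: "real^'d \<Rightarrow> 's \<Rightarrow> real^'d"
  assumes CC: "closed CC" "convex CC" and CC_bound: "\<And>x. x \<in> CC \<Longrightarrow> norm x \<le> r"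
    and thstar_in: "thstar \<in> CC" and theta0_in: "theta0 \<in> CC"
    and etl_meas [measurable]: "\<And>t. etl t \<in> borel_measurable M"
    and etl_int: "\<And>t. integrable M (\<lambda>w. (etl t w)\<^sup>2)"
    and etl_rate: "\<exists>K. \<forall>t\<ge>1. (\<integral>w. (etl t w)\<^sup>2 \<partial>M) \<le> K / real t"
    and etl_nonneg: "\<And>t w. w \<in> space M \<Longrightarrow> 0 \<le> etl t w"
    and ghat_adapted: "\<And>t th w w'. hist (Suc t) w = hist (Suc t) w' \<Longrightarrow> ghat t th w = ghat t th w'"
    and ghat_meas: "\<And>t th. th \<in> borel_measurable M \<Longrightarrow> (\<lambda>w. ghat t (th w) w) \<in> borel_measurable M"
    and g_meas: "\<And>t th. th \<in> borel_measurable M \<Longrightarrow>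
        (\<lambda>w. g (th w) (sample S A Rw t w)) \<in> borel_measurable M"
    and g_bound: "\<And>th s x. th \<in> CC \<Longrightarrow> x \<in> moves \<Longrightarrow> norm (g th (s, x)) \<le> Kg"
    and approx: "\<And>t th w. w \<in> space M \<Longrightarrow> th \<in> CC \<Longrightarrow> Rw t w \<in> Rs \<Longrightarrow>
        norm (ghat t th w - g th (sample S A Rw t w)) \<le> Kg * (etl t w + (etl t w)\<^sup>2)"
    and G_mean: "\<And>th s. G th s = (\<Sum>x\<in>moves. move_prob s x *\<^sub>R g th (s, x))"
    and G_lipschitz: "\<And>th th' s. norm (G th s - G th' s) \<le> LG * norm (th - th')"
begin

lemma sample_eq: "sample S A Rw t w = (S t w, move t w)"
  by (simp add: sample_def move_def)

lemma sum_move_prob_next: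
  "(\<Sum>x\<in>moves. move_prob s x * f (snd (snd x))) = (\<Sum>s'\<in>UNIV. kernel_pol b P s s' * f s')"
proof -
  have "(\<Sum>x\<in>moves. move_prob s x * f (snd (snd x)))
      = (\<Sum>a\<in>UNIV. \<Sum>q\<in>Rs. pmf (R s a) q * (\<Sum>s'\<in>UNIV. pmf (b s) a * pmf (P s a) s' * f s'))"
    by (simp add: sum_moves move_prob_def sum_distrib_left mult_ac)
  also have "\<dots> = (\<Sum>a\<in>UNIV. \<Sum>s'\<in>UNIV. pmf (b s) a * pmf (P s a) s' * f s')"
    by (simp only: sum_distrib_right[symmetric] sum_rew mult_1)
  also have "\<dots> = (\<Sum>s'\<in>UNIV. kernel_pol b P s s' * f s')"
    by (subst sum.swap) (simp add: kernel_pol_def sum_distrib_right)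
  finally show ?thesis .
qed

section \<open>Bounds for the averaged field and the Markovian noise\<close>

lemma r_nonneg: "0 \<le> r"
  using CC_bound[OF thstar_in] norm_ge_zero[of thstar] by linarith

lemma CC_diff: "x \<in> CC \<Longrightarrow> y \<in> CC \<Longrightarrow> norm (x - y) \<le> 2 * r"
  using norm_triangle_ineq4[of x y] CC_bound[of x] CC_bound[of y] by linarith

lemma Kg_nonneg: "0 \<le> Kg"
proof -
  have "moves \<noteq> {}"
    using move_prob_sum by (metis sum.empty zero_neq_one)
  then obtain x where "x \<in> moves" by auto
  from g_bound[OF thstar_in this] show ?thesis using norm_ge_zero order_trans by blast
qed

lemma G_bound: "th \<in> CC \<Longrightarrow> norm (G th s) \<le> Kg"
proof -
  assume th: "th \<in> CC"
  have "norm (G th s) \<le> (\<Sum>x\<in>moves. norm (move_prob s x *\<^sub>R g th (s, x)))"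
    unfolding G_mean by (rule norm_sum)
  also have "\<dots> \<le> (\<Sum>x\<in>moves. move_prob s x * Kg)"
    using g_bound[OF th] by (intro sum_mono) (auto simp: move_prob_nonneg mult_left_mono)
  also have "\<dots> = Kg" by (simp add: sum_distrib_right[symmetric] move_prob_sum)
  finally show ?thesis .
qed

definition gbar :: "real^'d \<Rightarrow> real^'d" where
  "gbar th = (\<Sum>s\<in>UNIV. mu s *\<^sub>R G th s)"

lemma gbar_bound: assumes th: "th \<in> CC" shows "norm (gbar th) \<le> Kg"
proof -
  have "norm (gbar th) \<le> (\<Sum>s\<in>UNIV. norm (mu s *\<^sub>R G th s))"
    unfolding gbar_def by (rule norm_sum)
  also have "\<dots> \<le> (\<Sum>s\<in>UNIV. mu s * Kg)"
    using G_bound[OF th] by (intro sum_mono) (auto simp: mu_nonneg mult_left_mono)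
  also have "\<dots> = Kg" by (simp add: sum_distrib_right[symmetric] mu_sum)
  finally show ?thesis .
qed

lemma gbar_lipschitz: "norm (gbar th - gbar th') \<le> LG * norm (th - th')"
proof -
  have "norm (gbar th - gbar th') = norm (\<Sum>s\<in>UNIV. mu s *\<^sub>R (G th s - G th' s))"
    by (simp add: gbar_def sum_subtractf scaleR_diff_right)
  also have "\<dots> \<le> (\<Sum>s\<in>UNIV. norm (mu s *\<^sub>R (G th s - G th' s)))" by (rule norm_sum)
  also have "\<dots> \<le> (\<Sum>s\<in>UNIV. mu s * (LG * norm (th - th')))"
    using G_lipschitz by (intro sum_mono) (auto simp: mu_nonneg mult_left_mono)
  also have "\<dots> = LG * norm (th - th')" by (simp add: sum_distrib_right[symmetric] mu_sum)
  finally show ?thesis .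
qed

lemma lipschitz_continuous:
  fixes F :: "real^'d \<Rightarrow> real^'d"
  assumes "\<And>x y. norm (F x - F y) \<le> L * norm (x - y)"
  shows "continuous_on UNIV F"
proof -
  have "(max L 0)-lipschitz_on UNIV F"
  proof (rule lipschitz_onI)
    fix x y :: "real^'d"
    have "L * norm (x - y) \<le> max L 0 * norm (x - y)" by (intro mult_right_mono) auto
    then show "dist (F x) (F y) \<le> max L 0 * dist x y"
      using assms[of x y] by (simp add: dist_norm)
  qed simp
  then show ?thesis by (rule lipschitz_on_continuous_on)
qed

lemma G_continuous: "continuous_on UNIV (\<lambda>th. G th s)"
  using G_lipschitz by (rule lipschitz_continuous)

lemma gbar_continuous: "continuous_on UNIV gbar"
  using gbar_lipschitz by (rule lipschitz_continuous)

text \<open>The deviation that need not average out at a fixed time, because the law of the state is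
  not assumed to be \<open>mu\<close>. It is a function of iterate and state jointly, as the iterate
  moves along with the chain.\<close>

definition noise :: "real^'d \<Rightarrow> 's \<Rightarrow> real" where
  "noise th s = (G th s - gbar th) \<bullet> (th - thstar)"

lemma noise_mean: "(\<Sum>s\<in>UNIV. mu s * noise th s) = 0"
proof -
  have "(\<Sum>s\<in>UNIV. mu s * noise th s) = (\<Sum>s\<in>UNIV. mu s *\<^sub>R (G th s - gbar th)) \<bullet> (th - thstar)"
    by (simp add: noise_def inner_sum_left)
  also have "(\<Sum>s\<in>UNIV. mu s *\<^sub>R (G th s - gbar th)) = gbar th - (\<Sum>s\<in>UNIV. mu s) *\<^sub>R gbar th"
    by (simp only: scaleR_diff_right sum_subtractf gbar_def scaleR_sum_left)
  also have "\<dots> = 0" by (simp add: mu_sum)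
  finally show ?thesis by simp
qed

lemma noise_bound: assumes "th \<in> CC" shows "\<bar>noise th s\<bar> \<le> 4 * Kg * r"
proof -
  have "\<bar>noise th s\<bar> \<le> norm (G th s - gbar th) * norm (th - thstar)"
    unfolding noise_def by (rule Cauchy_Schwarz_ineq2)
  also have "\<dots> \<le> (2 * Kg) * (2 * r)"
    using norm_triangle_ineq4[of "G th s" "gbar th"] G_bound[OF assms, of s] gbar_bound[OF assms]
      CC_diff[OF assms thstar_in] Kg_nonneg
    by (intro mult_mono) auto
  finally show ?thesis by simp
qed

text \<open>Product rule: the change of the centred field against the bounded vector
  \<open>th - thstar\<close>, plus the bounded centred field against the change of
  \<open>th\<close>.\<close>

lemma noise_lipschitz:
  assumes "th \<in> CC" "th' \<in> CC"
  shows "\<bar>noise th s - noise th' s\<bar> \<le> (4 * \<bar>LG\<bar> * r + 2 * Kg) * norm (th - th')"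
proof -
  have "noise th s - noise th' s
      = ((G th s - G th' s) - (gbar th - gbar th')) \<bullet> (th - thstar) + (G th' s - gbar th') \<bullet> (th - th')"
    by (simp add: noise_def inner_diff_left inner_diff_right)
  moreover have "\<bar>((G th s - G th' s) - (gbar th - gbar th')) \<bullet> (th - thstar)\<bar>
      \<le> (2 * (\<bar>LG\<bar> * norm (th - th'))) * (2 * r)"
  proof -
    have "LG * norm (th - th') \<le> \<bar>LG\<bar> * norm (th - th')" by (intro mult_right_mono) auto
    then have "norm ((G th s - G th' s) - (gbar th - gbar th')) \<le> 2 * (\<bar>LG\<bar> * norm (th - th'))"
      using norm_triangle_ineq4[of "G th s - G th' s" "gbar th - gbar th'"]
        G_lipschitz[of th s th'] gbar_lipschitz[of th th'] by linarith
    then have "norm ((G th s - G th' s) - (gbar th - gbar th')) * norm (th - thstar)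
        \<le> (2 * (\<bar>LG\<bar> * norm (th - th'))) * (2 * r)"
      using CC_diff[OF assms(1) thstar_in] by (intro mult_mono) auto
    then show ?thesis using Cauchy_Schwarz_ineq2 order_trans by blast
  qed
  moreover have "\<bar>(G th' s - gbar th') \<bullet> (th - th')\<bar> \<le> (2 * Kg) * norm (th - th')"
  proof -
    have "norm (G th' s - gbar th') \<le> 2 * Kg"
      using norm_triangle_ineq4[of "G th' s" "gbar th'"] G_bound[OF assms(2), of s] gbar_bound[OF assms(2)]
      by linarith
    then have "norm (G th' s - gbar th') * norm (th - th') \<le> (2 * Kg) * norm (th - th')"
      by (intro mult_right_mono) auto
    then show ?thesis using Cauchy_Schwarz_ineq2 order_trans by blast
  qed
  ultimately show ?thesis by (simp add: algebra_simps)
qed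

text \<open>For frozen \<open>th\<close> the noise is a mean-zero vector indexed by states, so the
  solution operator applies separately for each \<open>th\<close>. Being linear in finite dimension,
  it passes bound, Lipschitz constant and continuity from the noise to \<open>h\<close>; the factor
  \<open>CARD('s)\<close> comes from estimating the norm by the sum over states.\<close>

lemma noise_poisson:
  obtains h :: "real^'d \<Rightarrow> 's \<Rightarrow> real" and Bh Lh :: real where
    "\<And>th s. h th s - (\<Sum>s'\<in>UNIV. kernel_pol b P s s' * h th s') = noise th s"
    "\<And>s. (\<lambda>th. h th s) \<in> borel_measurable borel"
    "0 \<le> Bh" "\<And>th s. th \<in> CC \<Longrightarrow> \<bar>h th s\<bar> \<le> Bh"
    "0 \<le> Lh" "\<And>th th' s. th \<in> CC \<Longrightarrow> th' \<in> CC \<Longrightarrow> \<bar>h th s - h th' s\<bar> \<le> Lh * norm (th - th')"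
proof -
  obtain Z :: "real^'s \<Rightarrow> real^'s" where Z: "linear Z" and
    ZP: "\<And>u s. (\<Sum>s\<in>UNIV. mu s * u $ s) = 0 \<Longrightarrow>
       Z u $ s - (\<Sum>s'\<in>UNIV. kernel_pol b P s s' * Z u $ s') = u $ s"
    using poisson_equation by blast
  obtain BZ where BZ: "0 < BZ" "\<And>x. norm (Z x) \<le> BZ * norm x"
    using linear_bounded_pos[OF Z] by blast
  define U where "U th = (\<chi> s. noise th s)" for th
  have Zc: "\<bar>Z x $ s\<bar> \<le> BZ * (\<Sum>i\<in>UNIV. \<bar>x $ i\<bar>)" for x s
  proof -
    have "\<bar>Z x $ s\<bar> \<le> BZ * norm x" using component_le_norm_cart[of "Z x" s] BZ(2)[of x] by linarith
    also have "\<dots> \<le> BZ * (\<Sum>i\<in>UNIV. \<bar>x $ i\<bar>)"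
      using BZ(1) by (intro mult_left_mono norm_le_l1_cart) auto
    finally show ?thesis .
  qed
  let ?h = "\<lambda>th s. Z (U th) $ s"
  show ?thesis
  proof (rule that[of ?h "BZ * (real CARD('s) * (4 * Kg * r))"
        "BZ * (real CARD('s) * (4 * \<bar>LG\<bar> * r + 2 * Kg))"])
    show "?h th s - (\<Sum>s'\<in>UNIV. kernel_pol b P s s' * ?h th s') = noise th s" for th s
      using ZP[of "U th" s] by (simp add: U_def noise_mean)
    have "continuous_on UNIV (\<lambda>th. noise th s)" for s
      unfolding noise_def by (intro continuous_intros G_continuous gbar_continuous)
    then have "continuous_on UNIV U"
      unfolding U_def by (intro continuous_on_vec_lambda)
    then have "continuous_on UNIV (\<lambda>th. Z (U th))"
      using Z by (rule linear_continuous_on_compose)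
    then have "continuous_on UNIV (\<lambda>th. ?h th s)" for s
      by (intro continuous_on_component)
    then show "(\<lambda>th. ?h th s) \<in> borel_measurable borel" for s
      by (rule borel_measurable_continuous_onI)
    show "0 \<le> BZ * (real CARD('s) * (4 * Kg * r))" "0 \<le> BZ * (real CARD('s) * (4 * \<bar>LG\<bar> * r + 2 * Kg))"
      using BZ Kg_nonneg r_nonneg by auto
    show "\<bar>?h th s\<bar> \<le> BZ * (real CARD('s) * (4 * Kg * r))" if "th \<in> CC" for th s
    proof -
      have "(\<Sum>i\<in>UNIV. \<bar>U th $ i\<bar>) \<le> (\<Sum>i\<in>(UNIV::'s set). 4 * Kg * r)"
        using noise_bound[OF that] by (intro sum_mono) (simp add: U_def)
      also have "\<dots> = real CARD('s) * (4 * Kg * r)" by simp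
      finally have "BZ * (\<Sum>i\<in>UNIV. \<bar>U th $ i\<bar>) \<le> BZ * (real CARD('s) * (4 * Kg * r))"
        using BZ(1) by (intro mult_left_mono) auto
      then show ?thesis using Zc[of "U th" s] by linarith
    qed
    show "\<bar>?h th s - ?h th' s\<bar> \<le> BZ * (real CARD('s) * (4 * \<bar>LG\<bar> * r + 2 * Kg)) * norm (th - th')"
      if "th \<in> CC" "th' \<in> CC" for th th' s
    proof -
      have "(\<Sum>i\<in>UNIV. \<bar>(U th - U th') $ i\<bar>)
          \<le> (\<Sum>i\<in>(UNIV::'s set). (4 * \<bar>LG\<bar> * r + 2 * Kg) * norm (th - th'))"
        using noise_lipschitz[OF that] by (intro sum_mono) (simp add: U_def)
      also have "\<dots> = real CARD('s) * ((4 * \<bar>LG\<bar> * r + 2 * Kg) * norm (th - th'))" by simp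
      finally have "BZ * (\<Sum>i\<in>UNIV. \<bar>(U th - U th') $ i\<bar>)
          \<le> BZ * (real CARD('s) * ((4 * \<bar>LG\<bar> * r + 2 * Kg) * norm (th - th')))"
        using BZ(1) by (intro mult_left_mono) auto
      moreover have "?h th s - ?h th' s = Z (U th - U th') $ s" by (simp add: linear_diff[OF Z])
      ultimately show ?thesis using Zc[of "U th - U th'" s] by (simp add: mult.assoc)
    qed
  qed
qed

section \<open>Iterates for a fixed step-size sequence\<close>

context
  fixes eta :: "nat \<Rightarrow> real"
  assumes eta_nonneg: "\<And>t. 1 \<le> t \<Longrightarrow> 0 \<le> eta t"
begin

abbreviation "th t w \<equiv> psgd CC eta ghat theta0 t w"

lemma th_in: "th t w \<in> CC"
  using CC theta0_in by (cases t) (auto intro!: closest_point_in_set)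

text \<open>The iterate at time t has consumed the moves before t only, so it is fixed before the
  move at time t is drawn; this is what permits averaging over that move.\<close>

lemma th_past: "past t w = past t w' \<Longrightarrow> th t w = th t w'"
proof (induction t)
  case (Suc t)
  then have "hist (Suc t) w = hist (Suc t) w'" "past t w = past t w'"
    by (simp_all add: past_eq_hist[symmetric] past_Suc_eq_iff)
  then show ?case using Suc.IH ghat_adapted[of t w w'] by simp
qed simp

lemma th_meas [measurable]: "th t \<in> borel_measurable M"
proof (induction t)
  case 0
  then show ?case by simp
next
  case (Suc t)
  have "closest_point CC \<in> borel_measurable borel"
    using CC theta0_in by (intro borel_measurable_continuous_onI continuous_on_closest_point) auto
  moreover have "(\<lambda>w. th t w - eta (Suc t) *\<^sub>R ghat t (th t w) w) \<in> borel_measurable M"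
    using Suc ghat_meas[OF Suc] by simp
  ultimately have "(\<lambda>w. closest_point CC (th t w - eta (Suc t) *\<^sub>R ghat t (th t w) w)) \<in> borel_measurable M"
    by (rule measurable_compose[rotated])
  then show ?case by simp
qed

lemma th_norm: "norm (th t w - thstar) \<le> 2 * r"
  by (rule CC_diff[OF th_in thstar_in])

lemma state_meas:
  fixes f :: "real^'d \<Rightarrow> 's \<Rightarrow> 'z::topological_space"
  assumes "\<And>s. (\<lambda>x. f x s) \<in> borel_measurable borel"
  shows "(\<lambda>w. f (th t w) (S n w)) \<in> borel_measurable M"
  by (rule measurable_compose_countable[OF _ S_meas])
    (rule measurable_compose[OF th_meas assms])

lemma integrable_bounded:
  fixes f :: "'w \<Rightarrow> real"
  assumes "f \<in> borel_measurable M" "\<And>w. w \<in> space M \<Longrightarrow> \<bar>f w\<bar> \<le> B"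
  shows "integrable M f"
  using assms by (intro integrable_const_bound[of _ B]) auto

lemma expectation_g:
  "(\<integral>w. g (th t w) (sample S A Rw t w) \<bullet> (th t w - thstar) \<partial>M)
     = (\<integral>w. G (th t w) (S t w) \<bullet> (th t w - thstar) \<partial>M)"
proof -
  let ?f = "\<lambda>w x. g (th t w) (S t w, x) \<bullet> (th t w - thstar)"
  have sumf: "(\<Sum>x\<in>moves. move_prob (S t w) x * ?f w x) = G (th t w) (S t w) \<bullet> (th t w - thstar)" for w
    by (simp add: G_mean inner_sum_left)
  have Gm: "(\<lambda>w. G (th t w) (S t w)) \<in> borel_measurable M"
    by (rule state_meas) (rule borel_measurable_continuous_onI[OF G_continuous])
  have "(\<integral>w. ?f w (move t w) \<partial>M) = (\<integral>w. (\<Sum>x\<in>moves. move_prob (S t w) x * ?f w x) \<partial>M)"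
  proof (rule integral_next_move)
    show "?f w x = ?f w' x" if "past t w = past t w'" for w w' x
      using th_past[OF that] that by (simp add: past_def)
    show "(\<lambda>w. ?f w (move t w)) \<in> borel_measurable M"
      using g_meas[OF th_meas[of t], of t] by (simp add: sample_eq)
    show "(\<lambda>w. \<Sum>x\<in>moves. move_prob (S t w) x * ?f w x) \<in> borel_measurable M"
      unfolding sumf using Gm by simp
  qed
  then show ?thesis by (simp add: sumf sample_eq)
qed

text \<open>The parameter stays at time \<open>t\<close> while the state advances, which is where
  the kernel applied to \<open>h\<close> appears. Passing to the next iterate is a separate cost,
  charged to the Lipschitz constant of \<open>h\<close>.\<close>

lemma expectation_kernel:
  fixes h :: "real^'d \<Rightarrow> 's \<Rightarrow> real"
  assumes h: "\<And>s. (\<lambda>x. h x s) \<in> borel_measurable borel"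
  shows "(\<integral>w. h (th t w) (S (Suc t) w) \<partial>M)
     = (\<integral>w. (\<Sum>s'\<in>UNIV. kernel_pol b P (S t w) s' * h (th t w) s') \<partial>M)"
proof -
  let ?f = "\<lambda>w x. h (th t w) (snd (snd x))"
  have sumf: "(\<Sum>x\<in>moves. move_prob (S t w) x * ?f w x)
      = (\<Sum>s'\<in>UNIV. kernel_pol b P (S t w) s' * h (th t w) s')" for w
    by (rule sum_move_prob_next)
  have "(\<integral>w. ?f w (move t w) \<partial>M) = (\<integral>w. (\<Sum>x\<in>moves. move_prob (S t w) x * ?f w x) \<partial>M)"
  proof (rule integral_next_move)
    show "?f w x = ?f w' x" if "past t w = past t w'" for w w' x
      using th_past[OF that] by simp
    show "(\<lambda>w. ?f w (move t w)) \<in> borel_measurable M"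
      using state_meas[OF h] by (simp add: move_def)
    show "(\<lambda>w. \<Sum>x\<in>moves. move_prob (S t w) x * ?f w x) \<in> borel_measurable M"
      unfolding sumf by (rule state_meas) (use h in measurable)
  qed
  then show ?thesis by (simp add: sumf move_def)
qed

text \<open>The Markovian noise is a coboundary \<open>h - K h\<close>, so its expectation telescopes
  up to the variation of \<open>h\<close> between consecutive iterates.\<close>
theorem drift:
  obtains K H where "sgd_drift K eta (\<lambda>t. \<integral>w. gbar (th t w) \<bullet> (th t w - thstar) \<partial>M) H
     (\<lambda>t. \<integral>w. (norm (th t w - thstar))\<^sup>2 \<partial>M)"
proof -
  obtain h Bh Lh where h_eq: "\<And>x s. h x s - (\<Sum>s'\<in>UNIV. kernel_pol b P s s' * h x s') = noise x s"
    and h_meas: "\<And>s. (\<lambda>x. h x s) \<in> borel_measurable borel"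
    and Bh: "0 \<le> Bh" "\<And>x s. x \<in> CC \<Longrightarrow> \<bar>h x s\<bar> \<le> Bh"
    and Lh: "0 \<le> Lh" "\<And>x y s. x \<in> CC \<Longrightarrow> y \<in> CC \<Longrightarrow> \<bar>h x s - h y s\<bar> \<le> Lh * norm (x - y)"
  proof (rule noise_poisson, goal_cases)
    case (1 h Bh Lh)
    from 1(1)[OF 1(2-)] show ?case .
  qed
  obtain Ke0 where Ke0: "\<And>t. 1 \<le> t \<Longrightarrow> (\<integral>w. (etl t w)\<^sup>2 \<partial>M) \<le> Ke0 / real t"
    using etl_rate by blast
  define Ke where "Ke = max 0 Ke0"
  have Ke: "0 \<le> Ke" "(\<integral>w. (etl t w)\<^sup>2 \<partial>M) \<le> Ke / real t" if "1 \<le> t" for t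
    using Ke0[OF that] that by (auto simp: Ke_def max_def field_simps)
  have Ke0': "0 \<le> Ke" by (simp add: Ke_def)
  define D where "D t w = th t w - thstar" for t w
  define a where "a t = (\<integral>w. (norm (D t w))\<^sup>2 \<partial>M)" for t
  define m where "m t = (\<integral>w. gbar (th t w) \<bullet> D t w \<partial>M)" for t
  define H where "H t = (\<integral>w. h (th t w) (S t w) \<partial>M)" for t
  have D_meas [measurable]: "D t \<in> borel_measurable M" for t
    unfolding D_def by measurable
  have D_bound: "norm (D t w) \<le> 2 * r" for t w unfolding D_def by (rule th_norm)
  have D2: "(norm (D t w))\<^sup>2 \<le> 4 * r\<^sup>2" for t w
    using power_mono[OF D_bound[of t w], of 2] by (simp add: power_mult_distrib)
  have int_D2: "integrable M (\<lambda>w. (norm (D t w))\<^sup>2)" for t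
    using D2 by (intro integrable_bounded[of _ "4 * r\<^sup>2"]) auto
  have int_h: "integrable M (\<lambda>w. h (th t w) (S n w))" for t n
    using Bh(2) th_in by (intro integrable_bounded[of _ Bh] state_meas h_meas) auto
  have gbar_meas: "(\<lambda>w. gbar (th t w)) \<in> borel_measurable M" for t
    by (rule measurable_compose[OF th_meas borel_measurable_continuous_onI[OF gbar_continuous]])
  have G_meas: "(\<lambda>w. G (th t w) (S t w)) \<in> borel_measurable M" for t
    by (rule state_meas) (rule borel_measurable_continuous_onI[OF G_continuous])
  have inner_bound: "\<bar>x \<bullet> D t w\<bar> \<le> Kg * (2 * r)" if "norm x \<le> Kg" for x t w
  proof -
    have "norm x * norm (D t w) \<le> Kg * (2 * r)"
      using that D_bound[of t w] Kg_nonneg by (intro mult_mono) auto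
    then show ?thesis using Cauchy_Schwarz_ineq2 order_trans by blast
  qed
  have int_gbar: "integrable M (\<lambda>w. gbar (th t w) \<bullet> D t w)" for t
    using inner_bound[OF gbar_bound[OF th_in]] gbar_meas[of t]
    by (intro integrable_bounded[of _ "Kg * (2 * r)"]) auto
  have int_G: "integrable M (\<lambda>w. G (th t w) (S t w) \<bullet> D t w)" for t
    using inner_bound[OF G_bound[OF th_in]] G_meas[of t]
    by (intro integrable_bounded[of _ "Kg * (2 * r)"]) auto
  have AE_move: "AE w in M. w \<in> space M \<and> move t w \<in> moves \<and> Rw t w \<in> Rs" for t
    using AE_Rw[of t] AE_space by eventually_elim (auto simp: move_def moves_def)
  have int_g: "integrable M (\<lambda>w. g (th t w) (sample S A Rw t w) \<bullet> D t w)" for t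
  proof (rule integrable_const_bound[of _ "Kg * (2 * r)"])
    show "AE w in M. norm (g (th t w) (sample S A Rw t w) \<bullet> D t w) \<le> Kg * (2 * r)"
      using AE_move[of t]
      by eventually_elim (use inner_bound[OF g_bound[OF th_in]] in \<open>simp add: sample_eq\<close>)
    show "(\<lambda>w. g (th t w) (sample S A Rw t w) \<bullet> D t w) \<in> borel_measurable M"
      using g_meas[OF th_meas[of t], of t] by simp
  qed
  have int_eD: "integrable M (\<lambda>w. etl t w * norm (D t w))" for t
  proof (rule Bochner_Integration.integrable_bound[of _ "\<lambda>w. (etl t w)\<^sup>2 + (norm (D t w))\<^sup>2"])
    show "integrable M (\<lambda>w. (etl t w)\<^sup>2 + (norm (D t w))\<^sup>2)"
      using etl_int int_D2 by simp
    show "AE w in M. norm (etl t w * norm (D t w)) \<le> norm ((etl t w)\<^sup>2 + (norm (D t w))\<^sup>2)"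
    proof (rule AE_I2)
      fix w
      have "2 * \<bar>etl t w\<bar> * norm (D t w) \<le> \<bar>etl t w\<bar>\<^sup>2 + (norm (D t w))\<^sup>2"
        by (rule sum_squares_bound)
      moreover have "0 \<le> \<bar>etl t w\<bar> * norm (D t w)" by simp
      ultimately show "norm (etl t w * norm (D t w)) \<le> norm ((etl t w)\<^sup>2 + (norm (D t w))\<^sup>2)"
        unfolding real_norm_def abs_mult abs_norm_cancel power2_abs by linarith
    qed
  qed measurable
  have step_norm: "AE w in M. norm (th (Suc t) w - th t w) \<le> 2 * Kg * eta (Suc t) * (1 + (etl t w)\<^sup>2)" for t
    using AE_move[of t]
  proof eventually_elim
    case (elim w)
    then show ?case
      using projected_step(1)[OF CC th_in thstar_in CC_bound, of "g (th t w) (sample S A Rw t w)" Kg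
          "ghat t (th t w) w" "etl t w" "eta (Suc t)"]
        g_bound[OF th_in] approx[OF _ th_in] etl_nonneg eta_nonneg by (simp add: sample_eq)
  qed
  have step_dist: "AE w in M. (norm (D (Suc t) w))\<^sup>2 \<le> (norm (D t w))\<^sup>2
      - 2 * eta (Suc t) * (g (th t w) (sample S A Rw t w) \<bullet> D t w)
      + 4 * Kg * eta (Suc t) * (etl t w * norm (D t w)) + 22 * Kg * r * eta (Suc t) * (etl t w)\<^sup>2
      + 9 * Kg\<^sup>2 * (eta (Suc t))\<^sup>2" for t
    using AE_move[of t]
  proof eventually_elim
    case (elim w)
    then show ?case
      using projected_step(2)[OF CC th_in thstar_in CC_bound, of "g (th t w) (sample S A Rw t w)" Kg
          "ghat t (th t w) w" "etl t w" "eta (Suc t)"]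
        g_bound[OF th_in] approx[OF _ th_in] etl_nonneg eta_nonneg by (simp add: sample_eq D_def mult.assoc)
  qed
  \<comment> \<open>The mean noise is \<open>H t\<close> minus the mean of \<open>h\<close> at the
    old iterate and the new state. Replacing the old iterate by the new one produces
    \<open>H (Suc t)\<close> and costs \<open>Lh\<close> times the mean displacement, in which only
    the second moment of the error occurs.\<close>
  have noise_lower: "(\<integral>w. noise (th t w) (S t w) \<partial>M)
      \<ge> H t - H (Suc t) - 2 * Lh * Kg * (1 + Ke) * eta (Suc t)" if t: "1 \<le> t" for t
  proof -
    have int_Kh: "integrable M (\<lambda>w. \<Sum>s'\<in>UNIV. kernel_pol b P (S t w) s' * h (th t w) s')"
    proof -
      have eq: "(\<Sum>s'\<in>UNIV. kernel_pol b P (S t w) s' * h (th t w) s')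
          = h (th t w) (S t w) - (G (th t w) (S t w) \<bullet> D t w - gbar (th t w) \<bullet> D t w)" for w
        using h_eq[of "th t w" "S t w"] by (simp add: noise_def D_def inner_diff_left)
      show ?thesis unfolding eq using int_h int_G int_gbar by simp
    qed
    have "(\<integral>w. noise (th t w) (S t w) \<partial>M) = H t - (\<integral>w. h (th t w) (S (Suc t) w) \<partial>M)"
      unfolding H_def expectation_kernel[of h, OF h_meas]
      by (subst Bochner_Integration.integral_diff[OF int_h int_Kh, symmetric]) (simp add: h_eq)
    moreover have "(\<integral>w. h (th t w) (S (Suc t) w) \<partial>M) - H (Suc t)
        = (\<integral>w. h (th t w) (S (Suc t) w) - h (th (Suc t) w) (S (Suc t) w) \<partial>M)"
      unfolding H_def by (rule Bochner_Integration.integral_diff[OF int_h int_h, symmetric])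
    moreover have "\<dots> \<le> (\<integral>w. Lh * (2 * Kg * eta (Suc t) * (1 + (etl t w)\<^sup>2)) \<partial>M)"
    proof (rule integral_mono_AE)
      show "integrable M (\<lambda>w. h (th t w) (S (Suc t) w) - h (th (Suc t) w) (S (Suc t) w))"
        using int_h by (intro Bochner_Integration.integrable_diff)
      show "integrable M (\<lambda>w. Lh * (2 * Kg * eta (Suc t) * (1 + (etl t w)\<^sup>2)))"
        using etl_int by simp
      show "AE w in M. h (th t w) (S (Suc t) w) - h (th (Suc t) w) (S (Suc t) w)
          \<le> Lh * (2 * Kg * eta (Suc t) * (1 + (etl t w)\<^sup>2))"
        using step_norm[of t]
      proof eventually_elim
        case (elim w)
        have "h (th t w) (S (Suc t) w) - h (th (Suc t) w) (S (Suc t) w) \<le> Lh * norm (th (Suc t) w - th t w)"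
        proof -
          have "\<bar>h (th t w) (S (Suc t) w) - h (th (Suc t) w) (S (Suc t) w)\<bar> \<le> Lh * norm (th t w - th (Suc t) w)"
            by (rule Lh(2)[OF th_in th_in])
          then show ?thesis by (simp only: norm_minus_commute[of "th t w"] abs_le_iff)
        qed
        also have "\<dots> \<le> Lh * (2 * Kg * eta (Suc t) * (1 + (etl t w)\<^sup>2))"
          using elim Lh(1) by (intro mult_left_mono)
        finally show ?case .
      qed
    qed
    moreover have "(\<integral>w. Lh * (2 * Kg * eta (Suc t) * (1 + (etl t w)\<^sup>2)) \<partial>M)
        = Lh * (2 * Kg * eta (Suc t) * (1 + (\<integral>w. (etl t w)\<^sup>2 \<partial>M)))"
      using etl_int[of t] by (simp add: prob_space)
    moreover have "\<dots> \<le> Lh * (2 * Kg * eta (Suc t) * (1 + Ke))"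
    proof -
      have "Ke / real t \<le> Ke / 1" using t Ke0' by (intro divide_left_mono) auto
      then have "(\<integral>w. (etl t w)\<^sup>2 \<partial>M) \<le> Ke" using Ke(2)[OF t] by simp
      then show ?thesis
        using Lh(1) Kg_nonneg eta_nonneg[of "Suc t"] by (intro mult_left_mono) auto
    qed
    moreover have "Lh * (2 * Kg * eta (Suc t) * (1 + Ke)) = 2 * Lh * Kg * (1 + Ke) * eta (Suc t)" by simp
    ultimately show ?thesis by linarith
  qed
  \<comment> \<open>A sum of nonnegative terms, so that it dominates each of them: \<open>Bh\<close>
    bounds \<open>H\<close>, \<open>4 * r\<^sup>2\<close> bounds \<open>a\<close>, and the rest are
    the coefficients of \<open>lam * a t\<close>, \<open>1 / (lam * real t)\<close>,
    \<open>1 / real t\<close> and the step size, in this order. The 1 makes \<open>K\<close>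
    positive.\<close>
  define K where "K = 1 + Bh + 4 * r\<^sup>2 + 4 * Kg + 4 * Kg * Ke + 22 * Kg * r * Ke
     + 9 * Kg\<^sup>2 + 4 * Lh * Kg * (1 + Ke)"
  have nn: "0 \<le> 4 * r\<^sup>2" "0 \<le> 4 * Kg" "0 \<le> 4 * Kg * Ke" "0 \<le> 22 * Kg * r * Ke"
    "0 \<le> 9 * Kg\<^sup>2" "0 \<le> 4 * Lh * Kg * (1 + Ke)"
    using Kg_nonneg Ke0' r_nonneg Lh(1) by auto
  have "sgd_drift K eta m H a"
    unfolding sgd_drift_def
  proof (intro conjI allI impI)
    show "0 < K" unfolding K_def using nn Bh(1) by linarith
    fix t
    show "0 \<le> a t" by (simp add: a_def)
    have "a t \<le> (\<integral>w. 4 * r\<^sup>2 \<partial>M)"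
      unfolding a_def using D2 by (intro integral_mono int_D2) auto
    then have "a t \<le> 4 * r\<^sup>2" by (simp add: prob_space)
    then show "a t \<le> K" unfolding K_def using nn Bh(1) by linarith
    have "\<bar>H t\<bar> \<le> (\<integral>w. \<bar>h (th t w) (S t w)\<bar> \<partial>M)"
      unfolding H_def by (rule integral_abs_bound)
    also have "\<dots> \<le> (\<integral>w. Bh \<partial>M)"
      using Bh(2)[OF th_in] by (intro integral_mono integrable_abs int_h) auto
    finally have "\<bar>H t\<bar> \<le> Bh" by (simp add: prob_space)
    then show "\<bar>H t\<bar> \<le> K" unfolding K_def using nn by linarith
  next
    fix t :: nat and lam :: real assume t: "1 \<le> t" and lam: "0 < lam"
    define e where "e = eta (Suc t)"
    have e: "0 \<le> e" unfolding e_def by (rule eta_nonneg) simp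
    define Ee where "Ee = (\<integral>w. (etl t w)\<^sup>2 \<partial>M)"
    have "a (Suc t) \<le> (\<integral>w. (norm (D t w))\<^sup>2 - 2 * e * (g (th t w) (sample S A Rw t w) \<bullet> D t w)
      + 4 * Kg * e * (etl t w * norm (D t w)) + 22 * Kg * r * e * (etl t w)\<^sup>2 + 9 * Kg\<^sup>2 * e\<^sup>2 \<partial>M)"
      unfolding a_def e_def
      using int_D2 int_g int_eD etl_int step_dist by (intro integral_mono_AE) simp_all
    also have "\<dots> = a t - 2 * e * (\<integral>w. g (th t w) (sample S A Rw t w) \<bullet> D t w \<partial>M)
      + 4 * Kg * e * (\<integral>w. etl t w * norm (D t w) \<partial>M) + 22 * Kg * r * e * Ee + 9 * Kg\<^sup>2 * e\<^sup>2"
      unfolding a_def Ee_def using int_D2 int_g int_eD etl_int by (simp add: prob_space)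
    also have "(\<integral>w. g (th t w) (sample S A Rw t w) \<bullet> D t w \<partial>M)
        = (\<integral>w. noise (th t w) (S t w) \<partial>M) + m t"
    proof -
      have "(\<integral>w. noise (th t w) (S t w) \<partial>M)
          = (\<integral>w. G (th t w) (S t w) \<bullet> D t w - gbar (th t w) \<bullet> D t w \<partial>M)"
        by (simp add: noise_def D_def inner_diff_left)
      also have "\<dots> = (\<integral>w. G (th t w) (S t w) \<bullet> D t w \<partial>M) - m t"
        unfolding m_def by (rule Bochner_Integration.integral_diff[OF int_G int_gbar])
      finally show ?thesis using expectation_g[of t] by (simp add: D_def)
    qed
    finally have 1: "a (Suc t) \<le> a t - 2 * e * ((\<integral>w. noise (th t w) (S t w) \<partial>M) + m t)
      + 4 * Kg * e * (\<integral>w. etl t w * norm (D t w) \<partial>M) + 22 * Kg * r * e * Ee + 9 * Kg\<^sup>2 * e\<^sup>2" .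
    have 2: "2 * e * (H t - H (Suc t) - 2 * Lh * Kg * (1 + Ke) * e)
        \<le> 2 * e * (\<integral>w. noise (th t w) (S t w) \<partial>M)"
      using noise_lower[OF t] e unfolding e_def by (intro mult_left_mono) auto
    \<comment> \<open>Young's inequality: it separates the error from the distance without any
      independence between them.\<close>
    have "(\<integral>w. etl t w * norm (D t w) \<partial>M) \<le> (\<integral>w. 1 / lam * (etl t w)\<^sup>2 + lam * (norm (D t w))\<^sup>2 \<partial>M)"
    proof (rule integral_mono)
      show "integrable M (\<lambda>w. etl t w * norm (D t w))" by (rule int_eD)
      show "integrable M (\<lambda>w. 1 / lam * (etl t w)\<^sup>2 + lam * (norm (D t w))\<^sup>2)"
        using etl_int int_D2 by simp
      fix w assume "w \<in> space M"
      let ?x = "etl t w" and ?y = "norm (D t w)"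
      have xy: "0 \<le> ?x * ?y" using etl_nonneg[OF \<open>w \<in> space M\<close>] by simp
      have "0 \<le> (?x - lam * ?y)\<^sup>2 / lam" using lam by simp
      also have "\<dots> = 1 / lam * ?x\<^sup>2 + lam * ?y\<^sup>2 - 2 * (?x * ?y)"
        using lam by (simp add: power2_eq_square field_simps)
      finally show "?x * ?y \<le> 1 / lam * ?x\<^sup>2 + lam * ?y\<^sup>2" using xy by linarith
    qed
    also have "\<dots> = 1 / lam * Ee + lam * a t"
      unfolding Ee_def a_def using etl_int int_D2 by simp
    also have "\<dots> \<le> 1 / lam * (Ke / real t) + lam * a t"
      using Ke(2)[OF t] lam unfolding Ee_def by (intro add_right_mono mult_left_mono) auto
    finally have "4 * Kg * e * (\<integral>w. etl t w * norm (D t w) \<partial>M)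
        \<le> 4 * Kg * e * (1 / lam * (Ke / real t) + lam * a t)"
      using Kg_nonneg e by (intro mult_left_mono) auto
    also have "\<dots> = e * ((4 * Kg * Ke) * (1 / (lam * real t)) + (4 * Kg) * (lam * a t))"
      by (simp add: algebra_simps)
    finally have 3: "4 * Kg * e * (\<integral>w. etl t w * norm (D t w) \<partial>M)
        \<le> e * ((4 * Kg * Ke) * (1 / (lam * real t)) + (4 * Kg) * (lam * a t))" .
    have "22 * Kg * r * e * Ee \<le> 22 * Kg * r * e * (Ke / real t)"
      using Ke(2)[OF t] Kg_nonneg r_nonneg e unfolding Ee_def by (intro mult_left_mono) auto
    then have 4: "22 * Kg * r * e * Ee \<le> e * ((22 * Kg * r * Ke) * (1 / real t))" by (simp add: mult_ac)
    let ?R = "(4 * Kg * Ke) * (1 / (lam * real t)) + (4 * Kg) * (lam * a t)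
        + (22 * Kg * r * Ke) * (1 / real t) + (9 * Kg\<^sup>2 + 4 * Lh * Kg * (1 + Ke)) * e"
    have at: "0 \<le> a t" by (simp add: a_def)
    have "?R \<le> K * (1 / (lam * real t)) + K * (lam * a t) + K * (1 / real t) + K * e"
    proof (intro add_mono mult_right_mono)
      show "4 * Kg * Ke \<le> K" "4 * Kg \<le> K" "22 * Kg * r * Ke \<le> K"
        "9 * Kg\<^sup>2 + 4 * Lh * Kg * (1 + Ke) \<le> K"
        unfolding K_def using nn Bh(1) by linarith+
    qed (use lam at e in auto)
    then have "e * ?R \<le> e * (K * (1 / (lam * real t)) + K * (lam * a t) + K * (1 / real t) + K * e)"
      using e by (intro mult_left_mono)
    also have "\<dots> = K * e * (lam * a t + 1 / (lam * real t) + 1 / real t + e)"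
      by (simp add: algebra_simps)
    finally have 5: "e * ?R \<le> \<dots>" .
    have 6: "e * ?R = e * ((4 * Kg * Ke) * (1 / (lam * real t)) + (4 * Kg) * (lam * a t))
       + e * ((22 * Kg * r * Ke) * (1 / real t)) + 9 * Kg\<^sup>2 * e\<^sup>2 + 2 * e * (2 * Lh * Kg * (1 + Ke) * e)"
      by (simp add: algebra_simps power2_eq_square)
    have 7: "2 * e * (H t - H (Suc t) - 2 * Lh * Kg * (1 + Ke) * e)
        = 2 * e * (H t - H (Suc t)) - 2 * e * (2 * Lh * Kg * (1 + Ke) * e)"
      by (rule right_diff_distrib)
    have 8: "2 * e * ((\<integral>w. noise (th t w) (S t w) \<partial>M) + m t)
        = 2 * e * (\<integral>w. noise (th t w) (S t w) \<partial>M) + 2 * e * m t" by (rule distrib_left)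
    show "a (Suc t) \<le> a t - 2 * eta (Suc t) * m t - 2 * eta (Suc t) * (H t - H (Suc t))
        + K * eta (Suc t) * (lam * a t + 1 / (lam * real t) + 1 / real t + eta (Suc t))"
      using 1 2 3 4 5 unfolding 6 7 8 e_def[symmetric] by linarith
  qed
  then show ?thesis unfolding a_def m_def D_def by (rule that)
qed

lemma integrable_iterate:
  assumes cont: "continuous_on UNIV f"
  shows "integrable M (\<lambda>w. f (th t w) :: real)"
proof -
  have "compact CC" using CC CC_bound by (auto simp: compact_eq_bounded_closed bounded_iff)
  then have "bounded (f ` CC)"
    using compact_continuous_image[of CC f] continuous_on_subset[OF cont] compact_imp_bounded by blast
  then obtain B where B: "\<And>x. x \<in> CC \<Longrightarrow> \<bar>f x\<bar> \<le> B" by (auto simp: bounded_iff)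
  show ?thesis
    using B[OF th_in]
    by (intro integrable_bounded[of _ B] measurable_compose[OF th_meas borel_measurable_continuous_onI[OF cont]])
      auto
qed

text \<open>Jensen's inequality for the average of the iterates. Nonnegativity allows the integrals
  to be compared with integrability of the upper bound alone.\<close>

lemma integral_avg_le:
  assumes cont: "continuous_on UNIV f" and nonneg: "\<And>x. 0 \<le> f x" and conv: "convex_on UNIV f"
    and T: "1 \<le> T"
  shows "(\<integral>w. f (psgd_avg CC eta ghat theta0 T w) \<partial>M) \<le> (1 / real T) * (\<Sum>t=1..T. \<integral>w. f (th t w) \<partial>M)"
proof -
  note int = integrable_iterate[OF cont]
  have "(\<integral>w. f (psgd_avg CC eta ghat theta0 T w) \<partial>M) \<le> (\<integral>w. (\<Sum>t=1..T. (1 / real T) * f (th t w)) \<partial>M)"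
  proof (rule integral_mono')
    show "integrable M (\<lambda>w. \<Sum>t=1..T. (1 / real T) * f (th t w))" using int by simp
    fix w
    have "f (\<Sum>t=1..T. (1 / real T) *\<^sub>R th t w) \<le> (\<Sum>t=1..T. (1 / real T) * f (th t w))"
      using T by (intro convex_on_sum[OF _ _ conv]) auto
    then show "f (psgd_avg CC eta ghat theta0 T w) \<le> (\<Sum>t=1..T. (1 / real T) * f (th t w))"
      by (simp add: psgd_avg_def scaleR_sum_right)
    show "0 \<le> (\<Sum>t=1..T. (1 / real T) * f (th t w))"
      using nonneg by (intro sum_nonneg) auto
  qed
  also have "\<dots> = (1 / real T) * (\<Sum>t=1..T. \<integral>w. f (th t w) \<partial>M)"
    using int by (simp add: sum_divide_distrib)
  finally show "(\<integral>w. f (psgd_avg CC eta ghat theta0 T w) \<partial>M)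
      \<le> (1 / real T) * (\<Sum>t=1..T. \<integral>w. f (th t w) \<partial>M)" .
qed

lemma gbar_integrable: "integrable M (\<lambda>w. gbar (th t w) \<bullet> (th t w - thstar))"
proof (rule integrable_bounded)
  show "(\<lambda>w. gbar (th t w) \<bullet> (th t w - thstar)) \<in> borel_measurable M"
    using measurable_compose[OF th_meas borel_measurable_continuous_onI[OF gbar_continuous]] by simp
  show "\<bar>gbar (th t w) \<bullet> (th t w - thstar)\<bar> \<le> Kg * (2 * r)" for w
  proof -
    have "norm (gbar (th t w)) * norm (th t w - thstar) \<le> Kg * (2 * r)"
      using gbar_bound[OF th_in] th_norm Kg_nonneg by (intro mult_mono) auto
    then show ?thesis using Cauchy_Schwarz_ineq2 order_trans by blast
  qed
qed

end

section \<open>Rates for the averaged iterates\<close>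

lemma convex_on_norm_diff_sq: "convex_on UNIV (\<lambda>x::real^'d. (norm (x - y))\<^sup>2)"
proof (rule convex_onI)
  fix t :: real and x z :: "real^'d" assume t: "0 < t" "t < 1"
  have "(1 - t) *\<^sub>R x + t *\<^sub>R z - y = (1 - t) *\<^sub>R (x - y) + t *\<^sub>R (z - y)" by (simp add: algebra_simps)
  then have "(1 - t) * (norm (x - y))\<^sup>2 + t * (norm (z - y))\<^sup>2 - (norm ((1 - t) *\<^sub>R x + t *\<^sub>R z - y))\<^sup>2
      = t * (1 - t) * (norm ((x - y) - (z - y)))\<^sup>2"
    unfolding power2_norm_eq_inner
    by (simp add: inner_add_left inner_add_right inner_diff_left inner_diff_right inner_commute algebra_simps)
  also have "\<dots> \<ge> 0" using t by simp
  finally show "(norm ((1 - t) *\<^sub>R x + t *\<^sub>R z - y))\<^sup>2 \<le> (1 - t) * (norm (x - y))\<^sup>2 + t * (norm (z - y))\<^sup>2"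
    by linarith
qed simp

text \<open>\<open>grad\<close> plays the role of the gradient inequality of a convex function with
  minimal value 0; Jensen then carries the bound on the summed pairings over to the averaged
  iterate.\<close>

theorem rate_sqrt:
  assumes L: "continuous_on UNIV L" "\<And>x. 0 \<le> L x" "convex_on UNIV L"
    and grad: "\<And>x. x \<in> CC \<Longrightarrow> L x \<le> gbar x \<bullet> (x - thstar)" and eta0: "0 < eta0"
  shows "\<exists>K. \<forall>T\<ge>2. (\<integral>w. L (psgd_avg CC (\<lambda>t. eta0 / sqrt (real t)) ghat theta0 T w) \<partial>M)
      \<le> K * ln (real T) / sqrt (real T)"
proof -
  let ?eta = "\<lambda>t. eta0 / sqrt (real t)"
  have eta_nonneg: "0 \<le> ?eta t" for t using eta0 by simp
  let ?th = "psgd CC ?eta ghat theta0"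
  obtain K H where drift: "sgd_drift K ?eta (\<lambda>t. \<integral>w. gbar (?th t w) \<bullet> (?th t w - thstar) \<partial>M) H
     (\<lambda>t. \<integral>w. (norm (?th t w - thstar))\<^sup>2 \<partial>M)"
    using drift[of ?eta, OF eta_nonneg] by blast
  obtain K' where K': "\<And>T. 2 \<le> T \<Longrightarrow>
     (1 / real T) * (\<Sum>t=1..T. \<integral>w. gbar (?th t w) \<bullet> (?th t w - thstar) \<partial>M) \<le> K' * ln (real T) / sqrt (real T)"
    using drift_rate_sqrt[OF drift eta0] by blast
  show ?thesis
  proof (intro exI allI impI)
    fix T :: nat assume T: "2 \<le> T"
    have "(\<integral>w. L (psgd_avg CC ?eta ghat theta0 T w) \<partial>M) \<le> (1 / real T) * (\<Sum>t=1..T. \<integral>w. L (?th t w) \<partial>M)"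
      using T by (intro integral_avg_le[of ?eta, OF eta_nonneg L]) auto
    also have "\<dots> \<le> (1 / real T) * (\<Sum>t=1..T. \<integral>w. gbar (?th t w) \<bullet> (?th t w - thstar) \<partial>M)"
      using grad[OF th_in[of ?eta, OF eta_nonneg]] integrable_iterate[of ?eta, OF eta_nonneg L(1)] gbar_integrable[of ?eta, OF eta_nonneg]
      by (intro mult_left_mono sum_mono integral_mono) auto
    also have "\<dots> \<le> K' * ln (real T) / sqrt (real T)" by (rule K'[OF T])
    finally show "(\<integral>w. L (psgd_avg CC ?eta ghat theta0 T w) \<partial>M) \<le> K' * ln (real T) / sqrt (real T)" .
  qed
qed

text \<open>The squared distance gets its rate from the contraction, and \<open>L\<close> inherits
  it through the quadratic upper bound \<open>LB\<close>; the factor \<open>1 + B\<close> serves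
  both claims.\<close>

theorem rate_log:
  assumes L: "continuous_on UNIV L" "\<And>x. 0 \<le> L x" "convex_on UNIV L"
    and LB: "\<And>x. L x \<le> B * (norm (x - thstar))\<^sup>2" "0 \<le> B"
    and contr: "\<And>x. x \<in> CC \<Longrightarrow> c * (norm (x - thstar))\<^sup>2 \<le> gbar x \<bullet> (x - thstar)" and c: "0 < c"
    and eta1: "1 / c \<le> eta 1" "eta 1 \<le> 2 / c"
    and rec: "\<And>t. 1 \<le> t \<Longrightarrow> eta (Suc t) = exp (- (1/2) * c * eta t) * eta t"
  shows "\<exists>K. \<forall>T\<ge>2.
      (\<integral>w. (norm (psgd_avg CC eta ghat theta0 T w - thstar))\<^sup>2 \<partial>M) \<le> K * (ln (real T))^3 / real T \<and>
      (\<integral>w. L (psgd_avg CC eta ghat theta0 T w) \<partial>M) \<le> K * (ln (real T))^3 / real T"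
proof -
  have eta_nonneg: "0 \<le> eta t" if "1 \<le> t" for t
  proof -
    have "0 \<le> 1 / real t" by simp
    also have "\<dots> \<le> c * eta t" using step_size_bounds(1)[of c eta t] c eta1 rec that by blast
    finally show ?thesis using c by (simp add: zero_le_mult_iff)
  qed
  let ?th = "psgd CC eta ghat theta0"
  let ?N = "\<lambda>x. (norm (x - thstar))\<^sup>2"
  have N: "continuous_on UNIV ?N" "\<And>x. 0 \<le> ?N x" "convex_on UNIV ?N"
    by (intro continuous_intros, simp, rule convex_on_norm_diff_sq)
  note int_N = integrable_iterate[of eta, OF eta_nonneg N(1)]
  obtain K H where drift: "sgd_drift K eta (\<lambda>t. \<integral>w. gbar (?th t w) \<bullet> (?th t w - thstar) \<partial>M) H
     (\<lambda>t. \<integral>w. ?N (?th t w) \<partial>M)"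
    using drift[of eta, OF eta_nonneg] by blast
  have m: "c * (\<integral>w. ?N (?th t w) \<partial>M) \<le> (\<integral>w. gbar (?th t w) \<bullet> (?th t w - thstar) \<partial>M)" for t
  proof -
    have "(\<integral>w. c * ?N (?th t w) \<partial>M) \<le> (\<integral>w. gbar (?th t w) \<bullet> (?th t w - thstar) \<partial>M)"
      using contr[OF th_in[of eta, OF eta_nonneg]] int_N gbar_integrable[of eta, OF eta_nonneg]
      by (intro integral_mono) auto
    then show ?thesis by simp
  qed
  obtain K' where K': "0 \<le> K'" "\<And>T. 2 \<le> T \<Longrightarrow>
     (1 / real T) * (\<Sum>t=1..T. \<integral>w. ?N (?th t w) \<partial>M) \<le> K' * (ln (real T))^3 / real T"
    using drift_rate_log[OF drift c m eta1 rec] by blast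
  show ?thesis
  proof (intro exI[of _ "(1 + B) * K'"] allI impI)
    fix T :: nat assume T: "2 \<le> T"
    define q where "q = (ln (real T))^3 / real T"
    have q: "0 \<le> q" using T by (simp add: q_def)
    have avg: "(1 / real T) * (\<Sum>t=1..T. \<integral>w. ?N (?th t w) \<partial>M) \<le> K' * q"
      using K'(2)[OF T] by (simp add: q_def)
    have 1: "(\<integral>w. ?N (psgd_avg CC eta ghat theta0 T w) \<partial>M) \<le> K' * q"
      using integral_avg_le[of eta, OF eta_nonneg N, of T] T avg by simp
    have "(\<integral>w. L (psgd_avg CC eta ghat theta0 T w) \<partial>M) \<le> (1 / real T) * (\<Sum>t=1..T. \<integral>w. L (?th t w) \<partial>M)"
      using T by (intro integral_avg_le[of eta, OF eta_nonneg L]) auto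
    also have "\<dots> \<le> (1 / real T) * (\<Sum>t=1..T. \<integral>w. B * ?N (?th t w) \<partial>M)"
      using LB(1) integrable_iterate[of eta, OF eta_nonneg L(1)] int_N
      by (intro mult_left_mono sum_mono integral_mono) auto
    also have "\<dots> = B * ((1 / real T) * (\<Sum>t=1..T. \<integral>w. ?N (?th t w) \<partial>M))"
      by (simp add: sum_distrib_left)
    also have "\<dots> \<le> B * (K' * q)" using avg LB(2) by (intro mult_left_mono)
    finally have 2: "(\<integral>w. L (psgd_avg CC eta ghat theta0 T w) \<partial>M) \<le> B * (K' * q)" .
    have "0 \<le> K' * q" "0 \<le> B * (K' * q)" using K'(1) q LB(2) by auto
    moreover have "(1 + B) * K' * (ln (real T))^3 / real T = K' * q + B * (K' * q)"
      by (simp add: q_def algebra_simps add_divide_distrib)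
    ultimately show "(\<integral>w. ?N (psgd_avg CC eta ghat theta0 T w) \<partial>M) \<le> (1 + B) * K' * (ln (real T))^3 / real T \<and>
      (\<integral>w. L (psgd_avg CC eta ghat theta0 T w) \<partial>M) \<le> (1 + B) * K' * (ln (real T))^3 / real T"
      using 1 2 by linarith
  qed
qed

end

section \<open>Temporal difference directions\<close>

text \<open>The estimators receive the data list as an argument, which makes them adapted by
  construction. One variable \<open>etl\<close> dominates all three estimation errors.\<close>

locale td_learning =
  mdp_path M S A Rw P R b + markov_kernel "kernel_pol b P" mu
  for M :: "'w measure" and S :: "nat \<Rightarrow> 'w \<Rightarrow> 's::finite" and A :: "nat \<Rightarrow> 'w \<Rightarrow> 'a::finite"
    and Rw P R b mu +
  fixes pol :: "'s \<Rightarrow> 'a pmf" and gamma :: real and feat :: "'s \<Rightarrow> real^'d" and zeta :: "real^'d"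
    and CC :: "(real^'d) set" and thstar theta0 :: "real^'d" and r :: real
    and PSest :: "nat \<Rightarrow> ('s \<times> 'a \<times> real \<times> 's) list \<Rightarrow> 's \<Rightarrow> 's \<Rightarrow> real"
    and PRest :: "nat \<Rightarrow> ('s \<times> 'a \<times> real \<times> 's) list \<Rightarrow> 's \<Rightarrow> real \<Rightarrow> real"
    and MUest :: "nat \<Rightarrow> ('s \<times> 'a \<times> real \<times> 's) list \<Rightarrow> 's \<Rightarrow> real"
    and etl :: "nat \<Rightarrow> 'w \<Rightarrow> real"
  assumes gamma: "0 < gamma"
    and thstar: "\<And>s. td_err zeta gamma feat (xi_of (rew_support R) (rew_pol pol R))
                          (phi_of feat (kernel_pol pol P)) thstar s = 0"
    and coverage: "\<And>s a. pmf (b s) a = 0 \<Longrightarrow> pmf (pol s) a = 0"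
    and CC: "closed CC" "convex CC" and CC_bound: "\<And>x. x \<in> CC \<Longrightarrow> norm x \<le> r"
    and thstar_in: "thstar \<in> CC" and theta0_in: "theta0 \<in> CC"
    and PSest_meas: "\<And>t s s'. (\<lambda>w. PSest t (data_hist S A Rw t w) s s') \<in> borel_measurable M"
    and PRest_meas: "\<And>t s q. (\<lambda>w. PRest t (data_hist S A Rw t w) s q) \<in> borel_measurable M"
    and MUest_meas: "\<And>t s. (\<lambda>w. MUest t (data_hist S A Rw t w) s) \<in> borel_measurable M"
    and etl_meas: "\<And>t. etl t \<in> borel_measurable M"
    and etl_int: "\<And>t. integrable M (\<lambda>w. (etl t w)\<^sup>2)"
    and etl_rate: "\<exists>K. \<forall>t\<ge>1. (\<integral>w. (etl t w)\<^sup>2 \<partial>M) \<le> K / real t"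
    and PSest_err: "\<And>t w s'. w \<in> space M \<Longrightarrow>
        \<bar>PSest t (data_hist S A Rw t w) (S t w) s' - kernel_pol pol P (S t w) s'\<bar> \<le> etl t w"
    and PRest_err: "\<And>t w q. w \<in> space M \<Longrightarrow>
        \<bar>PRest t (data_hist S A Rw t w) (S t w) q - rew_pol pol R (S t w) q\<bar> \<le> etl t w"
    and MUest_err: "\<And>t w. w \<in> space M \<Longrightarrow>
        \<bar>1 / MUest t (data_hist S A Rw t w) (S t w) - 1 / mu (S t w)\<bar> \<le> etl t w"
begin

lemma etl_nonneg: "w \<in> space M \<Longrightarrow> 0 \<le> etl t w"
  using PSest_err[of w t] abs_ge_zero order_trans by blast

lemma r_nonneg: "0 \<le> r"
  using CC_bound[OF thstar_in] norm_ge_zero[of thstar] by linarith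

abbreviation "xi \<equiv> xi_of Rs (rew_pol pol R)"
abbreviation "ph \<equiv> phi_of feat (kernel_pol pol P)"
abbreviation "xi_hat t w \<equiv> xi_of Rs (PRest t (data_hist S A Rw t w))"
abbreviation "ph_hat t w \<equiv> phi_of feat (PSest t (data_hist S A Rw t w))"
abbreviation "delta \<equiv> td_err zeta gamma feat xi ph"
abbreviation "delta_hat t w \<equiv> td_err zeta gamma feat (xi_hat t w) (ph_hat t w)"
abbreviation "L \<equiv> loss mu zeta gamma feat xi ph"

text \<open>The gradient of \<open>delta\<close> with respect to the parameter; \<open>u\<close>
  below is its one-sample version, whose mean under the target policy is \<open>v\<close>.\<close>

definition v :: "'s \<Rightarrow> real^'d" where
  "v s = - zeta + gamma *\<^sub>R ph s - feat s"

definition v_hat :: "nat \<Rightarrow> 'w \<Rightarrow> 's \<Rightarrow> real^'d" where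
  "v_hat t w s = - zeta + gamma *\<^sub>R ph_hat t w s - feat s"

definition u :: "'s \<Rightarrow> 's \<Rightarrow> real^'d" where
  "u s s' = - zeta + gamma *\<^sub>R feat s' - feat s"

definition ratio :: "'s \<Rightarrow> 'a \<Rightarrow> real" where
  "ratio s a = pmf (pol s) a / pmf (b s) a"

section \<open>The loss as a quadratic form around \<open>thstar\<close>\<close>

lemma delta_diff: "delta x s - delta y s = v s \<bullet> (x - y)"
  by (simp add: td_err_def v_def inner_diff_right)

lemma delta_eq: "delta x s = v s \<bullet> (x - thstar)"
  using delta_diff[of x s thstar] by (simp add: thstar)

lemma loss_eq: "L x = (\<Sum>s\<in>UNIV. mu s / 2 * (v s \<bullet> (x - thstar))\<^sup>2)"
  by (simp add: loss_def delta_eq)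

lemma loss_thstar: "L thstar = 0"
  by (simp add: loss_eq)

lemma loss_nonneg: "0 \<le> L x"
  unfolding loss_eq by (intro sum_nonneg) (simp add: mu_nonneg)

lemma loss_continuous: "continuous_on UNIV L"
  unfolding loss_eq[abs_def] by (intro continuous_intros)

lemma loss_convex: "convex_on UNIV L"
proof (rule convex_onI)
  fix t :: real and x y :: "real^'d" assume t: "0 < t" "t < 1"
  let ?p = "\<lambda>s. v s \<bullet> (x - thstar)" and ?q = "\<lambda>s. v s \<bullet> (y - thstar)"
  have "L ((1 - t) *\<^sub>R x + t *\<^sub>R y) \<le> (\<Sum>s\<in>UNIV. mu s / 2 * ((1 - t) * (?p s)\<^sup>2 + t * (?q s)\<^sup>2))"
    unfolding loss_eq
  proof (intro sum_mono mult_left_mono)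
    fix s
    have "(1 - t) *\<^sub>R x + t *\<^sub>R y - thstar = (1 - t) *\<^sub>R (x - thstar) + t *\<^sub>R (y - thstar)"
      by (simp add: algebra_simps)
    then have "v s \<bullet> ((1 - t) *\<^sub>R x + t *\<^sub>R y - thstar) = (1 - t) * ?p s + t * ?q s"
      by (simp add: inner_add_right)
    moreover have "(1 - t) * p\<^sup>2 + t * q\<^sup>2 - ((1 - t) * p + t * q)\<^sup>2 = t * (1 - t) * (p - q)\<^sup>2" for p q :: real
      by (simp add: power2_eq_square algebra_simps)
    moreover have "0 \<le> t * (1 - t) * (?p s - ?q s)\<^sup>2" using t by simp
    ultimately show "(v s \<bullet> ((1 - t) *\<^sub>R x + t *\<^sub>R y - thstar))\<^sup>2 \<le> (1 - t) * (?p s)\<^sup>2 + t * (?q s)\<^sup>2"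
      by (metis diff_ge_0_iff_ge)
    show "0 \<le> mu s / 2" by (simp add: mu_nonneg)
  qed
  also have "\<dots> = (1 - t) * L x + t * L y"
    unfolding loss_eq sum_distrib_left sum.distrib[symmetric]
    by (intro sum.cong refl) (simp only: distrib_left mult.left_commute)
  finally show "L ((1 - t) *\<^sub>R x + t *\<^sub>R y) \<le> (1 - t) * L x + t * L y" .
qed simp

lemma loss_le: "L x \<le> (\<Sum>s\<in>UNIV. mu s / 2 * (norm (v s))\<^sup>2) * (norm (x - thstar))\<^sup>2"
  unfolding loss_eq sum_distrib_right
proof (rule sum_mono)
  fix s
  have "\<bar>v s \<bullet> (x - thstar)\<bar>\<^sup>2 \<le> (norm (v s) * norm (x - thstar))\<^sup>2"
    by (intro power_mono Cauchy_Schwarz_ineq2) simp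
  then have "(v s \<bullet> (x - thstar))\<^sup>2 \<le> (norm (v s))\<^sup>2 * (norm (x - thstar))\<^sup>2"
    by (simp add: power_mult_distrib)
  from mult_left_mono[OF this, of "mu s / 2"]
  show "mu s / 2 * (v s \<bullet> (x - thstar))\<^sup>2 \<le> mu s / 2 * (norm (v s))\<^sup>2 * (norm (x - thstar))\<^sup>2"
    by (simp add: mu_nonneg mult.assoc)
qed

text \<open>On the segment from \<open>thstar\<close> to \<open>x\<close> the loss is nonnegative
  and starts at 0. Dividing the strong convexity inequality by the weight \<open>t\<close> of
  \<open>x\<close> and letting \<open>t\<close> tend to 0 gives the claim. As the averaged direction
  pairs to twice the loss, it is a contraction with the same constant \<open>c\<close>.\<close>

lemma strongly_convex_loss:
  assumes sc: "strongly_convex_on UNIV c L" and c: "0 < c"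
  shows "c * (norm (x - thstar))\<^sup>2 \<le> 2 * L x"
proof -
  let ?N = "(norm (x - thstar))\<^sup>2"
  have le: "c * ?N - 2 * L x \<le> t * (c * ?N)" if t: "0 < t" "t < 1" for t :: real
  proof -
    have "L (t *\<^sub>R x + (1 - t) *\<^sub>R thstar) \<le> t * L x + (1 - t) * L thstar - c / 2 * t * (1 - t) * ?N"
      using sc t unfolding strongly_convex_on_def by (meson UNIV_I less_imp_le)
    then have "0 \<le> t * L x - c / 2 * t * (1 - t) * ?N"
      using loss_nonneg[of "t *\<^sub>R x + (1 - t) *\<^sub>R thstar"] unfolding loss_thstar by linarith
    also have "\<dots> = t * (L x - c / 2 * (1 - t) * ?N)"
      by (simp add: field_simps)
    finally have "0 \<le> t * (L x - c / 2 * (1 - t) * ?N)" .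
    then have "0 \<le> L x - c / 2 * (1 - t) * ?N" using t by (simp add: zero_le_mult_iff)
    then show ?thesis by (simp add: algebra_simps)
  qed
  have "c * ?N - 2 * L x \<le> 0"
  proof (rule tendsto_lowerbound)
    show "((\<lambda>t. t * (c * ?N)) \<longlongrightarrow> 0) (at_right 0)" by (auto intro!: tendsto_eq_intros)
    show "eventually (\<lambda>t. c * ?N - 2 * L x \<le> t * (c * ?N)) (at_right 0)"
      using eventually_at_right_real[OF zero_less_one] by eventually_elim (use le in auto)
  qed simp
  then show ?thesis by simp
qed

section \<open>Uniform bounds over the finite spaces and errors of the estimated quantities\<close>

definition Xb :: real where "Xb = (\<Sum>q\<in>Rs. \<bar>q\<bar>)"
definition Nb :: real where "Nb = (\<Sum>s\<in>UNIV. norm (feat s))"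
definition Vb :: real where "Vb = (\<Sum>s\<in>UNIV. norm (v s))"
definition Ub :: real where "Ub = (\<Sum>s\<in>UNIV. \<Sum>s'\<in>UNIV. norm (u s s'))"
definition Fb :: real where "Fb = (\<Sum>s\<in>UNIV. norm (feat s + zeta))"
definition Ib :: real where "Ib = (\<Sum>s\<in>UNIV. 1 / mu s)"
definition Rb :: real where "Rb = (\<Sum>s\<in>UNIV. \<Sum>a\<in>UNIV. ratio s a)"

lemma ratio_nonneg: "0 \<le> ratio s a" by (simp add: ratio_def)

lemma bounds_nonneg: "0 \<le> Xb" "0 \<le> Nb" "0 \<le> Vb" "0 \<le> Ub" "0 \<le> Fb" "0 \<le> Ib" "0 \<le> Rb"
  unfolding Xb_def Nb_def Vb_def Ub_def Fb_def Ib_def Rb_def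
  by (auto intro!: sum_nonneg simp: ratio_nonneg mu_nonneg)

lemma rew_le: "q \<in> Rs \<Longrightarrow> \<bar>q\<bar> \<le> Xb"
  unfolding Xb_def by (rule member_le_sum) (auto simp: finite_rew_support)

lemma v_le: "norm (v s) \<le> Vb"
  unfolding Vb_def by (rule member_le_sum) auto

lemma feat_zeta_le: "norm (feat s + zeta) \<le> Fb"
  unfolding Fb_def by (rule member_le_sum) auto

lemma inv_mu_le: "1 / mu s \<le> Ib"
  unfolding Ib_def by (rule member_le_sum) (auto simp: mu_nonneg)

lemma u_le: "norm (u s s') \<le> Ub"
proof -
  have "norm (u s s') \<le> (\<Sum>s'\<in>UNIV. norm (u s s'))" by (rule member_le_sum) auto
  also have "\<dots> \<le> Ub" unfolding Ub_def by (rule member_le_sum) (auto intro: sum_nonneg)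
  finally show ?thesis .
qed

lemma ratio_le: "ratio s a \<le> Rb"
proof -
  have "ratio s a \<le> (\<Sum>a\<in>UNIV. ratio s a)" by (rule member_le_sum) (auto simp: ratio_nonneg)
  also have "\<dots> \<le> Rb" unfolding Rb_def by (rule member_le_sum) (auto intro: sum_nonneg simp: ratio_nonneg)
  finally show ?thesis .
qed

lemma delta_bound: "x \<in> CC \<Longrightarrow> \<bar>delta x s\<bar> \<le> Vb * (2 * r)"
proof -
  assume x: "x \<in> CC"
  have "norm (x - thstar) \<le> 2 * r"
    using norm_triangle_ineq4[of x thstar] CC_bound[OF x] CC_bound[OF thstar_in] by linarith
  then have "norm (v s) * norm (x - thstar) \<le> Vb * (2 * r)"
    using v_le bounds_nonneg by (intro mult_mono) auto
  then show ?thesis unfolding delta_eq using Cauchy_Schwarz_ineq2 order_trans by blast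
qed

lemma xi_hat_err: "w \<in> space M \<Longrightarrow> \<bar>xi_hat t w (S t w) - xi (S t w)\<bar> \<le> Xb * etl t w"
proof -
  assume w: "w \<in> space M"
  have "\<bar>xi_hat t w (S t w) - xi (S t w)\<bar>
      = \<bar>\<Sum>q\<in>Rs. q * (PRest t (data_hist S A Rw t w) (S t w) q - rew_pol pol R (S t w) q)\<bar>"
    by (simp add: xi_of_def sum_subtractf right_diff_distrib)
  also have "\<dots> \<le> (\<Sum>q\<in>Rs. \<bar>q\<bar> * etl t w)"
    using PRest_err[OF w] by (intro order_trans[OF sum_abs] sum_mono) (simp add: abs_mult mult_left_mono)
  finally show ?thesis by (simp add: Xb_def sum_distrib_right)
qed

lemma v_hat_err: "w \<in> space M \<Longrightarrow> norm (v_hat t w (S t w) - v (S t w)) \<le> gamma * Nb * etl t w"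
proof -
  assume w: "w \<in> space M"
  have "ph_hat t w (S t w) - ph (S t w) = (\<Sum>s'\<in>UNIV.
      (PSest t (data_hist S A Rw t w) (S t w) s' - kernel_pol pol P (S t w) s') *\<^sub>R feat s')"
    by (simp add: phi_of_def sum_subtractf scaleR_diff_left)
  also have "norm \<dots> \<le> (\<Sum>s'\<in>UNIV. etl t w * norm (feat s'))"
    using PSest_err[OF w] by (intro order_trans[OF norm_sum] sum_mono) (simp add: mult_right_mono)
  finally have "norm (ph_hat t w (S t w) - ph (S t w)) \<le> Nb * etl t w"
    by (simp add: Nb_def sum_distrib_left mult.commute)
  moreover have "v_hat t w (S t w) - v (S t w) = gamma *\<^sub>R (ph_hat t w (S t w) - ph (S t w))"
    by (simp add: v_hat_def v_def scaleR_diff_right)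
  ultimately show ?thesis using gamma by (simp add: mult.assoc)
qed

text \<open>The TD error is affine in the two estimated means, so no product of errors occurs; the
  quadratic term of the direct method arises only on multiplication by \<open>v_hat\<close>.\<close>

lemma delta_hat_err:
  assumes w: "w \<in> space M" and x: "x \<in> CC"
  shows "\<bar>delta_hat t w x (S t w) - delta x (S t w)\<bar> \<le> (Xb + gamma * Nb * r) * etl t w"
proof -
  have "delta_hat t w x (S t w) - delta x (S t w)
      = (xi_hat t w (S t w) - xi (S t w)) + (v_hat t w (S t w) - v (S t w)) \<bullet> x"
    by (simp add: td_err_def v_hat_def v_def inner_diff_left)
  moreover have "\<bar>(v_hat t w (S t w) - v (S t w)) \<bullet> x\<bar> \<le> gamma * Nb * etl t w * r"
  proof -
    have "norm (v_hat t w (S t w) - v (S t w)) * norm x \<le> gamma * Nb * etl t w * r"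
      using v_hat_err[OF w] CC_bound[OF x] gamma bounds_nonneg etl_nonneg[OF w]
      by (intro mult_mono) auto
    then show ?thesis using Cauchy_Schwarz_ineq2 order_trans by blast
  qed
  ultimately show ?thesis using xi_hat_err[OF w, of t] by (simp add: algebra_simps)
qed

text \<open>States and actions are finite-valued, so measurability can be checked with them frozen;
  the reward remains inside \<open>f\<close> through its outcome argument.\<close>

lemma sample_meas:
  assumes "\<And>s a s'. f s a s' \<in> borel_measurable M"
  shows "(\<lambda>w. f (S t w) (A t w) (S (Suc t) w) w) \<in> borel_measurable M"
proof -
  have "(\<lambda>w. f s a (S (Suc t) w) w) \<in> borel_measurable M" for s a
    by (rule measurable_compose_countable[of "\<lambda>s' w. f s a s' w", OF assms S_meas])
  then have "(\<lambda>w. f s (A t w) (S (Suc t) w) w) \<in> borel_measurable M" for s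
    by (rule measurable_compose_countable[of "\<lambda>a w. f s a (S (Suc t) w) w", OF _ A_meas])
  then show ?thesis
    by (rule measurable_compose_countable[of "\<lambda>s w. f s (A t w) (S (Suc t) w) w", OF _ S_meas])
qed

lemma xi_hat_meas: "(\<lambda>w. xi_hat t w s) \<in> borel_measurable M"
  unfolding xi_of_def using PRest_meas by measurable

lemma ph_hat_meas: "(\<lambda>w. ph_hat t w s) \<in> borel_measurable M"
  unfolding phi_of_def using PSest_meas by measurable

lemma delta_hat_meas: "f \<in> borel_measurable M \<Longrightarrow> (\<lambda>w. delta_hat t w (f w) s) \<in> borel_measurable M"
  unfolding td_err_def using xi_hat_meas ph_hat_meas by measurable

abbreviation "ghat_direct \<equiv> \<lambda>t x w. dir_direct zeta gamma feat (xi_hat t w) (ph_hat t w) x (S t w)"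
abbreviation "ghat_tdsgd \<equiv> \<lambda>t x w. dir_tdsgd pol b zeta gamma feat (xi_hat t w) (ph_hat t w) x (sample S A Rw t w)"
abbreviation "ghat_td0 \<equiv> \<lambda>t x w. dir_td0 pol b zeta gamma feat (MUest t (data_hist S A Rw t w)) x (sample S A Rw t w)"

section \<open>Importance weighting and conditional means\<close>

lemma dir_tdsgd_eq:
  "dir_tdsgd pol b zeta gamma feat X Y x (s, a, q, s') = (ratio s a * td_err zeta gamma feat X Y x s) *\<^sub>R u s s'"
  by (simp add: dir_tdsgd_def ratio_def u_def)

lemma dir_td0_eq:
  "dir_td0 pol b zeta gamma feat m x (s, a, q, s')
     = - ((1 / m s) * ratio s a * (q + u s s' \<bullet> x)) *\<^sub>R (feat s + zeta)"
proof -
  have "q + u s s' \<bullet> x = q - zeta \<bullet> x + gamma * (feat s' \<bullet> x) - feat s \<bullet> x"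
    by (simp add: u_def inner_add_left inner_diff_left)
  then show ?thesis by (simp only: dir_td0_def ratio_def prod.case)
qed

text \<open>\<open>coverage\<close> makes \<open>pmf (b s) a * ratio s a = pmf (pol s) a\<close>
  hold even where \<open>b\<close> vanishes and the quotient is 0 by convention, so an average over
  behavior moves becomes one under the target policy.\<close>

lemma importance_mean:
  "(\<Sum>x\<in>moves. move_prob s x *\<^sub>R (ratio s (fst x) *\<^sub>R f (fst (snd x)) (snd (snd x))))
     = (\<Sum>a\<in>UNIV. \<Sum>q\<in>Rs. \<Sum>s'\<in>UNIV. (pmf (pol s) a * pmf (R s a) q * pmf (P s a) s') *\<^sub>R f q s')"
  for f :: "real \<Rightarrow> 's \<Rightarrow> 'v::real_vector"
proof -
  have "pmf (b s) a * ratio s a = pmf (pol s) a" for a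
    using coverage[of s a] by (simp add: ratio_def)
  then have eq: "pmf (b s) a * y * z * ratio s a = pmf (pol s) a * y * z" for a y z
    by (metis mult.assoc mult.commute)
  show ?thesis by (simp only: sum_moves move_prob_def prod.case fst_conv snd_conv scaleR_scaleR eq)
qed

lemma pol_mean_const: "(\<Sum>a\<in>UNIV. \<Sum>q\<in>Rs. \<Sum>s'\<in>UNIV. pmf (pol s) a * pmf (R s a) q * pmf (P s a) s') = 1"
  by (simp add: sum_distrib_left[symmetric] sum_rew sum_pmf_UNIV_finite)

lemma pol_mean_rew: "(\<Sum>a\<in>UNIV. \<Sum>q\<in>Rs. \<Sum>s'\<in>UNIV. pmf (pol s) a * pmf (R s a) q * pmf (P s a) s' * q) = xi s"
proof -
  have "(\<Sum>a\<in>UNIV. \<Sum>q\<in>Rs. \<Sum>s'\<in>UNIV. pmf (pol s) a * pmf (R s a) q * pmf (P s a) s' * q)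
      = (\<Sum>a\<in>UNIV. \<Sum>q\<in>Rs. pmf (pol s) a * pmf (R s a) q * q)"
    by (simp add: sum_distrib_left[symmetric] sum_distrib_right[symmetric] sum_pmf_UNIV_finite)
  also have "\<dots> = xi s"
    by (subst sum.swap) (simp add: xi_of_def rew_pol_def sum_distrib_left mult_ac)
  finally show ?thesis .
qed

lemma pol_mean_feat:
  "(\<Sum>a\<in>UNIV. \<Sum>q\<in>Rs. \<Sum>s'\<in>UNIV. (pmf (pol s) a * pmf (R s a) q * pmf (P s a) s') *\<^sub>R feat s') = ph s"
proof -
  have "(\<Sum>q\<in>Rs. \<Sum>s'\<in>UNIV. (pmf (pol s) a * pmf (R s a) q * pmf (P s a) s') *\<^sub>R feat s')
      = (\<Sum>s'\<in>UNIV. (pmf (pol s) a * pmf (P s a) s') *\<^sub>R feat s')" for a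
  proof -
    have "(\<Sum>q\<in>Rs. pmf (pol s) a * pmf (R s a) q * pmf (P s a) s') = pmf (pol s) a * pmf (P s a) s'" for s'
      by (simp add: sum_distrib_left[symmetric] sum_distrib_right[symmetric] sum_rew)
    then show ?thesis by (subst sum.swap) (simp add: scaleR_sum_left[symmetric])
  qed
  then show ?thesis
    by (simp, subst sum.swap) (simp add: phi_of_def kernel_pol_def scaleR_sum_left)
qed

lemma pol_mean_u:
  "(\<Sum>a\<in>UNIV. \<Sum>q\<in>Rs. \<Sum>s'\<in>UNIV. (pmf (pol s) a * pmf (R s a) q * pmf (P s a) s') *\<^sub>R u s s') = v s"
proof -
  have "u s s' = gamma *\<^sub>R feat s' + (- zeta - feat s)" for s' by (simp add: u_def)
  then have "(\<Sum>a\<in>UNIV. \<Sum>q\<in>Rs. \<Sum>s'\<in>UNIV. (pmf (pol s) a * pmf (R s a) q * pmf (P s a) s') *\<^sub>R u s s')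
     = gamma *\<^sub>R (\<Sum>a\<in>UNIV. \<Sum>q\<in>Rs. \<Sum>s'\<in>UNIV. (pmf (pol s) a * pmf (R s a) q * pmf (P s a) s') *\<^sub>R feat s')
     + (\<Sum>a\<in>UNIV. \<Sum>q\<in>Rs. \<Sum>s'\<in>UNIV. pmf (pol s) a * pmf (R s a) q * pmf (P s a) s') *\<^sub>R (- zeta - feat s)"
    by (simp only: scaleR_add_right sum.distrib scaleR_sum_right scaleR_sum_left scaleR_left_commute)
  then show ?thesis unfolding pol_mean_feat pol_mean_const by (simp add: v_def)
qed

lemma adapted:
  assumes "hist (Suc t) w = hist (Suc t) w'"
  shows "data_hist S A Rw t w = data_hist S A Rw t w'" "sample S A Rw t w = sample S A Rw t w'" "S t w = S t w'"
  using assms by (auto simp: data_hist_eq hist_eq_iff sample_def)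

section \<open>The three methods as stochastic approximation schemes\<close>

lemma gradient_lipschitz: "norm (delta x s *\<^sub>R v s - delta y s *\<^sub>R v s) \<le> Vb * Vb * norm (x - y)"
proof -
  have "\<bar>v s \<bullet> (x - y)\<bar> \<le> norm (v s) * norm (x - y)" by (rule Cauchy_Schwarz_ineq2)
  also have "\<dots> \<le> Vb * norm (x - y)" using v_le by (intro mult_right_mono) auto
  finally have "\<bar>v s \<bullet> (x - y)\<bar> * norm (v s) \<le> Vb * norm (x - y) * Vb"
    using v_le bounds_nonneg by (intro mult_mono) auto
  then show ?thesis
    unfolding scaleR_diff_left[symmetric] delta_diff by (simp add: mult_ac)
qed

text \<open>The direction uses the sample only through its state, so it is its own conditional mean.
  The estimated direction is a product of two estimated factors, and multiplying out produces the
  e^2 in the error bound.\<close>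

lemma direct_sgd:
  obtains Kg where "markov_sgd M S A Rw P R b mu CC thstar theta0 r Kg (Vb * Vb) etl ghat_direct
     (\<lambda>x z. delta x (fst z) *\<^sub>R v (fst z)) (\<lambda>x s. delta x s *\<^sub>R v s)"
proof -
  define k1 where "k1 = Xb + gamma * Nb * r"
  define k2 where "k2 = gamma * Nb"
  define d where "d = Vb * (2 * r)"
  have k: "0 \<le> k1" "0 \<le> k2" "0 \<le> d"
    using bounds_nonneg gamma r_nonneg by (auto simp: k1_def k2_def d_def)
  have V: "0 \<le> Vb" by (rule bounds_nonneg)
  \<comment> \<open>The sum of all coefficients, so that one constant bounds the exact direction by
    \<open>d * Vb\<close>, the linear part of the error and its quadratic part.\<close>
  define Kg where "Kg = d * Vb + (k1 * Vb + d * k2) + k1 * k2"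
  show ?thesis
  proof (rule that[of Kg], unfold_locales)
    show "norm (delta x (fst (s, z)) *\<^sub>R v (fst (s, z))) \<le> Kg" if "x \<in> CC" for x s z
    proof -
      have "\<bar>delta x s\<bar> * norm (v s) \<le> d * Vb"
        using delta_bound[OF that] v_le k unfolding d_def by (intro mult_mono) auto
      moreover have "0 \<le> k1 * Vb + d * k2 + k1 * k2" using k V by simp
      ultimately show ?thesis by (simp add: Kg_def)
    qed
    show "norm (ghat_direct t x w - delta x (fst (sample S A Rw t w)) *\<^sub>R v (fst (sample S A Rw t w)))
        \<le> Kg * (etl t w + (etl t w)\<^sup>2)" if w: "w \<in> space M" and x: "x \<in> CC" for t x w
    proof -
      let ?s = "S t w" and ?e = "etl t w"
      let ?d = "delta x ?s" and ?dd = "delta_hat t w x ?s - delta x ?s"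
      let ?v = "v ?s" and ?dv = "v_hat t w ?s - v ?s"
      have e: "0 \<le> ?e" by (rule etl_nonneg[OF w])
      have dd: "\<bar>?dd\<bar> \<le> k1 * ?e" using delta_hat_err[OF w x] by (simp add: k1_def)
      have dv: "norm ?dv \<le> k2 * ?e" using v_hat_err[OF w] by (simp add: k2_def)
      have "a *\<^sub>R y - d *\<^sub>R z = (a - d) *\<^sub>R z + d *\<^sub>R (y - z) + (a - d) *\<^sub>R (y - z)"
        for a d and y z :: "real^'d" by (simp add: algebra_simps)
      then have "ghat_direct t x w - ?d *\<^sub>R ?v = ?dd *\<^sub>R ?v + ?d *\<^sub>R ?dv + ?dd *\<^sub>R ?dv"
        unfolding dir_direct_def v_hat_def by blast
      then have "norm (ghat_direct t x w - ?d *\<^sub>R ?v)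
          \<le> \<bar>?dd\<bar> * norm ?v + \<bar>?d\<bar> * norm ?dv + \<bar>?dd\<bar> * norm ?dv"
        using norm_triangle_ineq[of "?dd *\<^sub>R ?v + ?d *\<^sub>R ?dv" "?dd *\<^sub>R ?dv"]
          norm_triangle_ineq[of "?dd *\<^sub>R ?v" "?d *\<^sub>R ?dv"] by (simp only: norm_scaleR)
      also have "\<dots> \<le> (k1 * ?e) * Vb + d * (k2 * ?e) + (k1 * ?e) * (k2 * ?e)"
        using dd dv delta_bound[OF x, of ?s] v_le k e V unfolding d_def[symmetric]
        by (intro add_mono mult_mono) auto
      also have "\<dots> = (k1 * Vb + d * k2) * ?e + (k1 * k2) * ?e\<^sup>2"
        by (simp add: power2_eq_square algebra_simps)
      also have "\<dots> \<le> Kg * ?e + Kg * ?e\<^sup>2"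
        using k V e by (intro add_mono mult_right_mono) (auto simp: Kg_def)
      finally show ?thesis by (simp add: sample_def distrib_left)
    qed
    show "(\<lambda>w. ghat_direct t (f w) w) \<in> borel_measurable M" if "f \<in> borel_measurable M" for t f
      using sample_meas[of "\<lambda>s _ _ w. dir_direct zeta gamma feat (xi_hat t w) (ph_hat t w) (f w) s" t]
        delta_hat_meas[OF that] ph_hat_meas unfolding dir_direct_def by simp
    show "(\<lambda>w. delta (f w) (fst (sample S A Rw t w)) *\<^sub>R v (fst (sample S A Rw t w))) \<in> borel_measurable M"
      if [measurable]: "f \<in> borel_measurable M" for t f
    proof -
      have "(\<lambda>w. delta (f w) s *\<^sub>R v s) \<in> borel_measurable M" for s
        unfolding td_err_def by measurable
      from sample_meas[of "\<lambda>s _ _ w. delta (f w) s *\<^sub>R v s" t, OF this] show ?thesis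
        by (simp add: sample_def)
    qed
    show "delta x s *\<^sub>R v s = (\<Sum>z\<in>moves. move_prob s z *\<^sub>R (delta x (fst (s, z)) *\<^sub>R v (fst (s, z))))" for x s
      by (simp only: fst_conv scaleR_sum_left[symmetric] move_prob_sum scaleR_one)
    show "ghat_direct t x w = ghat_direct t x w'" if "hist (Suc t) w = hist (Suc t) w'" for t x w w'
      using adapted[OF that] by simp
  qed (fact CC CC_bound thstar_in theta0_in etl_meas etl_int etl_rate etl_nonneg gradient_lipschitz)+
qed

text \<open>Importance weighting averages \<open>u\<close> to \<open>v\<close>, while
  \<open>delta\<close> depends on the state only. So the conditional mean is the direct direction,
  and both methods share their rates.\<close>

lemma td_sgd:
  obtains Kg where "markov_sgd M S A Rw P R b mu CC thstar theta0 r Kg (Vb * Vb) etl ghat_tdsgd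
     (dir_tdsgd pol b zeta gamma feat xi ph) (\<lambda>x s. delta x s *\<^sub>R v s)"
proof -
  define k1 where "k1 = Xb + gamma * Nb * r"
  define d where "d = Vb * (2 * r)"
  have k: "0 \<le> k1" "0 \<le> d"
    using bounds_nonneg gamma r_nonneg by (auto simp: k1_def d_def)
  define Kg where "Kg = Rb * (d + k1) * Ub"
  \<comment> \<open>Used twice, with \<open>z = d + k1\<close> for the exact direction and with (d +
    k1) (e + e^2) for the estimation error; this dictates \<open>Kg\<close>.\<close>
  have scale: "norm ((ratio s a * y) *\<^sub>R u s s') \<le> Rb * z * Ub" if "\<bar>y\<bar> \<le> z" for s a s' y z
  proof -
    have "ratio s a * \<bar>y\<bar> * norm (u s s') \<le> Rb * z * Ub"
      using ratio_le u_le that ratio_nonneg bounds_nonneg by (intro mult_mono) auto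
    then show ?thesis by (simp add: abs_mult ratio_nonneg)
  qed
  show ?thesis
  proof (rule that[of Kg], unfold_locales)
    show "norm (dir_tdsgd pol b zeta gamma feat xi ph x (s, z)) \<le> Kg" if "x \<in> CC" for x s z
    proof -
      obtain a q s' where z: "z = (a, q, s')" by (cases z)
      have "\<bar>delta x s\<bar> \<le> d + k1" using delta_bound[OF that, of s] k by (simp add: d_def)
      then show ?thesis unfolding z dir_tdsgd_eq Kg_def by (rule scale)
    qed
    show "norm (ghat_tdsgd t x w - dir_tdsgd pol b zeta gamma feat xi ph x (sample S A Rw t w))
        \<le> Kg * (etl t w + (etl t w)\<^sup>2)" if w: "w \<in> space M" and x: "x \<in> CC" for t x w
    proof -
      let ?e = "etl t w"
      have e: "0 \<le> ?e" by (rule etl_nonneg[OF w])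
      have "k1 * ?e \<le> (d + k1) * (?e + ?e\<^sup>2)" using k e by (intro mult_mono) auto
      then have "\<bar>delta_hat t w x (S t w) - delta x (S t w)\<bar> \<le> (d + k1) * (?e + ?e\<^sup>2)"
        using delta_hat_err[OF w x, of t] unfolding k1_def[symmetric] by linarith
      from scale[OF this] show ?thesis
        unfolding sample_def dir_tdsgd_eq scaleR_diff_left[symmetric] right_diff_distrib[symmetric]
        by (simp add: Kg_def mult_ac)
    qed
    show "(\<lambda>w. ghat_tdsgd t (f w) w) \<in> borel_measurable M" if "f \<in> borel_measurable M" for t f
      using sample_meas[of "\<lambda>s a s' w. (ratio s a * delta_hat t w (f w) s) *\<^sub>R u s s'" t]
        delta_hat_meas[OF that] unfolding sample_def dir_tdsgd_eq by simp
    show "(\<lambda>w. dir_tdsgd pol b zeta gamma feat xi ph (f w) (sample S A Rw t w)) \<in> borel_measurable M"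
      if [measurable]: "f \<in> borel_measurable M" for t f
    proof -
      have "(\<lambda>w. (ratio s a * delta (f w) s) *\<^sub>R u s s') \<in> borel_measurable M" for s a s'
        unfolding td_err_def by measurable
      from sample_meas[of "\<lambda>s a s' w. (ratio s a * delta (f w) s) *\<^sub>R u s s'" t, OF this] show ?thesis
        by (simp add: sample_def dir_tdsgd_eq)
    qed
    show "delta x s *\<^sub>R v s = (\<Sum>z\<in>moves. move_prob s z *\<^sub>R dir_tdsgd pol b zeta gamma feat xi ph x (s, z))" for x s
    proof -
      have "dir_tdsgd pol b zeta gamma feat xi ph x (s, z)
          = ratio s (fst z) *\<^sub>R (delta x s *\<^sub>R u s (snd (snd z)))" for z
        by (cases z) (simp add: dir_tdsgd_eq)
      then have "(\<Sum>z\<in>moves. move_prob s z *\<^sub>R dir_tdsgd pol b zeta gamma feat xi ph x (s, z))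
        = (\<Sum>a\<in>UNIV. \<Sum>q\<in>Rs. \<Sum>s'\<in>UNIV. (pmf (pol s) a * pmf (R s a) q * pmf (P s a) s') *\<^sub>R (delta x s *\<^sub>R u s s'))"
        using importance_mean[of s "\<lambda>_ s'. delta x s *\<^sub>R u s s'"] by simp
      also have "\<dots> = delta x s *\<^sub>R v s"
        unfolding pol_mean_u[symmetric] by (simp only: scaleR_sum_right scaleR_left_commute)
      finally show ?thesis by simp
    qed
    show "ghat_tdsgd t x w = ghat_tdsgd t x w'" if "hist (Suc t) w = hist (Suc t) w'" for t x w w'
      using adapted[OF that] by simp
  qed (fact CC CC_bound thstar_in theta0_in etl_meas etl_int etl_rate etl_nonneg gradient_lipschitz)+
qed

text \<open>The direction is linear in the weight \<open>1 / mu s\<close>, so its error is the same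
  expression with the difference of weights in that place. Averaging over the move turns the reward
  and \<open>u\<close> into \<open>delta\<close>.\<close>

lemma td0:
  obtains Kg where "markov_sgd M S A Rw P R b mu CC thstar theta0 r Kg (Ib * Vb * Fb) etl ghat_td0
     (dir_td0 pol b zeta gamma feat mu) (\<lambda>x s. - ((1 / mu s) * delta x s) *\<^sub>R (feat s + zeta))"
proof -
  define y where "y = Xb + Ub * r"
  have y: "0 \<le> y" using bounds_nonneg r_nonneg by (simp add: y_def)
  \<comment> \<open>\<open>Ib + 1\<close> covers both uses of \<open>scale\<close>: the exact weight
    is at most Ib + 1, and e \<le> (Ib + 1) (e + e^2).\<close>
  define Kg where "Kg = (Ib + 1) * Rb * y * Fb"
  have scale: "norm (- (m * ratio s a * (q + u s s' \<bullet> x)) *\<^sub>R (feat s + zeta)) \<le> z * Rb * y * Fb"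
    if m: "\<bar>m\<bar> \<le> z" and x: "x \<in> CC" and q: "q \<in> Rs" for m z s a q s' x
  proof -
    have "\<bar>u s s' \<bullet> x\<bar> \<le> norm (u s s') * norm x" by (rule Cauchy_Schwarz_ineq2)
    also have "\<dots> \<le> Ub * r" using u_le CC_bound[OF x] bounds_nonneg by (intro mult_mono) auto
    finally have "\<bar>q + u s s' \<bullet> x\<bar> \<le> y" using rew_le[OF q] by (simp add: y_def)
    moreover have "0 \<le> z" using m by linarith
    ultimately have "\<bar>m\<bar> * ratio s a * \<bar>q + u s s' \<bullet> x\<bar> * norm (feat s + zeta) \<le> z * Rb * y * Fb"
      using m ratio_le feat_zeta_le ratio_nonneg bounds_nonneg y by (intro mult_mono) auto
    then show ?thesis by (simp add: abs_mult ratio_nonneg)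
  qed
  show ?thesis
  proof (rule that[of Kg], unfold_locales)
    show "norm (dir_td0 pol b zeta gamma feat mu x (s, z)) \<le> Kg" if x: "x \<in> CC" and z: "z \<in> moves" for x s z
    proof -
      obtain a q s' where z': "z = (a, q, s')" by (cases z)
      have q: "q \<in> Rs" using z by (simp add: z' moves_def)
      have m: "\<bar>1 / mu s\<bar> \<le> Ib + 1" using inv_mu_le[of s] by (simp add: mu_nonneg)
      show ?thesis unfolding z' dir_td0_eq Kg_def by (rule scale[OF m x q])
    qed
    show "norm (ghat_td0 t x w - dir_td0 pol b zeta gamma feat mu x (sample S A Rw t w))
        \<le> Kg * (etl t w + (etl t w)\<^sup>2)" if w: "w \<in> space M" and x: "x \<in> CC" and q: "Rw t w \<in> Rs" for t x w
    proof -
      let ?e = "etl t w"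
      have e: "0 \<le> ?e" by (rule etl_nonneg[OF w])
      have "1 * ?e \<le> (Ib + 1) * (?e + ?e\<^sup>2)" using e bounds_nonneg by (intro mult_mono) auto
      then have "\<bar>1 / MUest t (data_hist S A Rw t w) (S t w) - 1 / mu (S t w)\<bar> \<le> (Ib + 1) * (?e + ?e\<^sup>2)"
        using MUest_err[OF w, of t] by linarith
      from scale[OF this x q, of "S t w" "A t w" "S (Suc t) w"] show ?thesis
        unfolding sample_def dir_td0_eq scaleR_diff_left[symmetric]
        by (simp only: minus_diff_minus left_diff_distrib[symmetric]) (simp only: Kg_def mult_ac)
    qed
    show "(\<lambda>w. ghat_td0 t (f w) w) \<in> borel_measurable M" if [measurable]: "f \<in> borel_measurable M" for t f
    proof -
      note [measurable] = MUest_meas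
      have "(\<lambda>w. - ((1 / MUest t (data_hist S A Rw t w) s) * ratio s a * (Rw t w + u s s' \<bullet> f w)) *\<^sub>R (feat s + zeta))
          \<in> borel_measurable M" for s a s' by measurable
      from sample_meas[of "\<lambda>s a s' w. - ((1 / MUest t (data_hist S A Rw t w) s) * ratio s a * (Rw t w + u s s' \<bullet> f w)) *\<^sub>R (feat s + zeta)" t, OF this]
      show ?thesis unfolding sample_def dir_td0_eq .
    qed
    show "(\<lambda>w. dir_td0 pol b zeta gamma feat mu (f w) (sample S A Rw t w)) \<in> borel_measurable M"
      if [measurable]: "f \<in> borel_measurable M" for t f
    proof -
      have "(\<lambda>w. - ((1 / mu s) * ratio s a * (Rw t w + u s s' \<bullet> f w)) *\<^sub>R (feat s + zeta))
          \<in> borel_measurable M" for s a s' by measurable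
      from sample_meas[of "\<lambda>s a s' w. - ((1 / mu s) * ratio s a * (Rw t w + u s s' \<bullet> f w)) *\<^sub>R (feat s + zeta)" t, OF this]
      show ?thesis unfolding sample_def dir_td0_eq .
    qed
    show "- ((1 / mu s) * delta x s) *\<^sub>R (feat s + zeta)
        = (\<Sum>z\<in>moves. move_prob s z *\<^sub>R dir_td0 pol b zeta gamma feat mu x (s, z))" for x s
    proof -
      let ?F = "feat s + zeta"
      have "dir_td0 pol b zeta gamma feat mu x (s, z)
          = ratio s (fst z) *\<^sub>R (- ((1 / mu s) * (fst (snd z) + u s (snd (snd z)) \<bullet> x)) *\<^sub>R ?F)" for z
        by (cases z) (simp add: dir_td0_eq)
      then have "(\<Sum>z\<in>moves. move_prob s z *\<^sub>R dir_td0 pol b zeta gamma feat mu x (s, z))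
        = (\<Sum>a\<in>UNIV. \<Sum>q\<in>Rs. \<Sum>s'\<in>UNIV. (pmf (pol s) a * pmf (R s a) q * pmf (P s a) s') *\<^sub>R
             (- ((1 / mu s) * (q + u s s' \<bullet> x)) *\<^sub>R ?F))"
        using importance_mean[of s "\<lambda>q s'. - ((1 / mu s) * (q + u s s' \<bullet> x)) *\<^sub>R ?F"] by simp
      also have "\<dots> = (\<Sum>a\<in>UNIV. \<Sum>q\<in>Rs. \<Sum>s'\<in>UNIV. pmf (pol s) a * pmf (R s a) q * pmf (P s a) s' * q
             + ((pmf (pol s) a * pmf (R s a) q * pmf (P s a) s') *\<^sub>R u s s') \<bullet> x) *\<^sub>R (- (1 / mu s) *\<^sub>R ?F)"
        unfolding scaleR_sum_left unfolding scaleR_scaleR inner_scaleR_left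
        by (intro sum.cong refl arg_cong[of _ _ "\<lambda>k. k *\<^sub>R ?F"]) (simp add: field_simps)
      also have "\<dots> = delta x s *\<^sub>R (- (1 / mu s) *\<^sub>R ?F)"
        unfolding sum.distrib pol_mean_rew inner_sum_left[symmetric] pol_mean_u
        by (simp add: td_err_def v_def)
      finally show ?thesis by (simp add: mult.commute)
    qed
    show "norm (- ((1 / mu s) * delta x s) *\<^sub>R (feat s + zeta) - - ((1 / mu s) * delta y s) *\<^sub>R (feat s + zeta))
        \<le> Ib * Vb * Fb * norm (x - y)" for x y s
    proof -
      have "\<bar>v s \<bullet> (x - y)\<bar> \<le> norm (v s) * norm (x - y)" by (rule Cauchy_Schwarz_ineq2)
      also have "\<dots> \<le> Vb * norm (x - y)" using v_le by (intro mult_right_mono) auto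
      finally have "(1 / mu s) * \<bar>v s \<bullet> (x - y)\<bar> * norm (feat s + zeta) \<le> Ib * (Vb * norm (x - y)) * Fb"
        using inv_mu_le feat_zeta_le bounds_nonneg by (intro mult_mono) (auto simp: mu_nonneg)
      moreover have "- ((1 / mu s) * delta x s) *\<^sub>R (feat s + zeta) - - ((1 / mu s) * delta y s) *\<^sub>R (feat s + zeta)
          = - ((1 / mu s) * (v s \<bullet> (x - y))) *\<^sub>R (feat s + zeta)"
        unfolding delta_diff[symmetric] by (simp only: scaleR_diff_left[symmetric]) (simp add: diff_divide_distrib)
      ultimately show ?thesis
        by (simp only: norm_scaleR abs_minus_cancel abs_mult) (simp add: mu_nonneg mult_ac)
    qed
    show "ghat_td0 t x w = ghat_td0 t x w'" if "hist (Suc t) w = hist (Suc t) w'" for t x w w'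
      using adapted[OF that] by simp
  qed (fact CC CC_bound thstar_in theta0_in etl_meas etl_int etl_rate etl_nonneg)+
qed

text \<open>The pairing of \<open>delta x s *\<^sub>R v s\<close> with \<open>x - thstar\<close> is
  \<open>(delta x s)\<^sup>2\<close>, whose \<open>mu\<close>-average is \<open>2 * L x\<close>.
  This dominates \<open>L x\<close> for the first rate, and strong convexity turns it into a
  contraction for the second.\<close>

lemma gradient_rates:
  assumes sgd: "markov_sgd M S A Rw P R b mu CC thstar theta0 r Kg (Vb * Vb) etl ghat g (\<lambda>x s. delta x s *\<^sub>R v s)"
  shows "0 < eta0 \<Longrightarrow> \<exists>K. \<forall>T\<ge>2. (\<integral>w. L (psgd_avg CC (\<lambda>t. eta0 / sqrt (real t)) ghat theta0 T w) \<partial>M)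
      \<le> K * ln (real T) / sqrt (real T)"
    and "\<lbrakk>0 < c; strongly_convex_on UNIV c L; 1 / c \<le> eta 1; eta 1 \<le> 2 / c;
       \<And>t. 1 \<le> t \<Longrightarrow> eta (Suc t) = exp (- (1/2) * c * eta t) * eta t\<rbrakk> \<Longrightarrow>
     \<exists>K. \<forall>T\<ge>2. (\<integral>w. (norm (psgd_avg CC eta ghat theta0 T w - thstar))\<^sup>2 \<partial>M) \<le> K * (ln (real T))^3 / real T \<and>
      (\<integral>w. L (psgd_avg CC eta ghat theta0 T w) \<partial>M) \<le> K * (ln (real T))^3 / real T"
proof -
  interpret D: markov_sgd M S A Rw P R b mu CC thstar theta0 r Kg "Vb * Vb" etl ghat g "\<lambda>x s. delta x s *\<^sub>R v s"
    by (rule sgd)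
  have gbar: "D.gbar x \<bullet> (x - thstar) = 2 * L x" for x
    unfolding D.gbar_def by (simp add: inner_sum_left loss_eq delta_eq sum_distrib_left power2_eq_square mult.assoc)
  show "0 < eta0 \<Longrightarrow> \<exists>K. \<forall>T\<ge>2. (\<integral>w. L (psgd_avg CC (\<lambda>t. eta0 / sqrt (real t)) ghat theta0 T w) \<partial>M)
      \<le> K * ln (real T) / sqrt (real T)"
    by (rule D.rate_sqrt[OF loss_continuous loss_nonneg loss_convex]) (simp_all add: gbar loss_nonneg)
  assume c: "0 < c" and sc: "strongly_convex_on UNIV c L" and eta: "1 / c \<le> eta 1" "eta 1 \<le> 2 / c"
    "\<And>t. 1 \<le> t \<Longrightarrow> eta (Suc t) = exp (- (1/2) * c * eta t) * eta t"
  show "\<exists>K. \<forall>T\<ge>2. (\<integral>w. (norm (psgd_avg CC eta ghat theta0 T w - thstar))\<^sup>2 \<partial>M) \<le> K * (ln (real T))^3 / real T \<and>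
      (\<integral>w. L (psgd_avg CC eta ghat theta0 T w) \<partial>M) \<le> K * (ln (real T))^3 / real T"
  proof (rule D.rate_log[OF loss_continuous loss_nonneg loss_convex loss_le _ _ c eta])
    show "c * (norm (x - thstar))\<^sup>2 \<le> D.gbar x \<bullet> (x - thstar)" for x
      unfolding gbar by (rule strongly_convex_loss[OF sc c])
  qed (auto intro!: sum_nonneg simp: mu_nonneg)
qed

text \<open>The stationary weight of a state cancels against the inverse weight in the direction, so
  the averaged field is the unweighted sum over states that the contraction hypothesis
  concerns.\<close>

lemma td0_rate:
  assumes c: "0 < c"
    and contr: "is_contraction_towards c (\<lambda>x. - (\<Sum>s\<in>UNIV. delta x s *\<^sub>R (feat s + zeta))) thstar"
    and eta: "1 / c \<le> eta 1" "eta 1 \<le> 2 / c"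
      "\<And>t. 1 \<le> t \<Longrightarrow> eta (Suc t) = exp (- (1/2) * c * eta t) * eta t"
  shows "\<exists>K. \<forall>T\<ge>2. (\<integral>w. (norm (psgd_avg CC eta ghat_td0 theta0 T w - thstar))\<^sup>2 \<partial>M) \<le> K * (ln (real T))^3 / real T \<and>
      (\<integral>w. L (psgd_avg CC eta ghat_td0 theta0 T w) \<partial>M) \<le> K * (ln (real T))^3 / real T"
proof -
  obtain Kg where "markov_sgd M S A Rw P R b mu CC thstar theta0 r Kg (Ib * Vb * Fb) etl ghat_td0
     (dir_td0 pol b zeta gamma feat mu) (\<lambda>x s. - ((1 / mu s) * delta x s) *\<^sub>R (feat s + zeta))"
    by (rule td0)
  then interpret D: markov_sgd M S A Rw P R b mu CC thstar theta0 r Kg "Ib * Vb * Fb" etl ghat_td0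
     "dir_td0 pol b zeta gamma feat mu" "\<lambda>x s. - ((1 / mu s) * delta x s) *\<^sub>R (feat s + zeta)" .
  have "D.gbar = (\<lambda>x. - (\<Sum>s\<in>UNIV. delta x s *\<^sub>R (feat s + zeta)))"
  proof
    fix x
    have "mu s * - (1 / mu s * delta x s) = - delta x s" for s using mu_pos[of s] by simp
    then show "D.gbar x = - (\<Sum>s\<in>UNIV. delta x s *\<^sub>R (feat s + zeta))"
      unfolding D.gbar_def scaleR_scaleR by (simp only: sum_negf[symmetric] scaleR_minus_left)
  qed
  with contr have "c * (norm (x - thstar))\<^sup>2 \<le> D.gbar x \<bullet> (x - thstar)" for x
    by (simp add: is_contraction_towards_def inner_commute)
  then show ?thesis
    by (intro D.rate_log[OF loss_continuous loss_nonneg loss_convex loss_le _ _ c eta])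
      (auto intro!: sum_nonneg simp: mu_nonneg)
qed

end

theorem theorem3:
  fixes M :: "'w measure"
    and S :: "nat \<Rightarrow> 'w \<Rightarrow> 's::finite" and A :: "nat \<Rightarrow> 'w \<Rightarrow> 'a::finite" and Rw :: "nat \<Rightarrow> 'w \<Rightarrow> real"
    and P :: "'s \<Rightarrow> 'a \<Rightarrow> 's pmf" and R :: "'s \<Rightarrow> 'a \<Rightarrow> real pmf"
    and pol b :: "'s \<Rightarrow> 'a pmf" and gamma :: real
    and feat :: "'s \<Rightarrow> real^'d::finite" and zeta :: "real^'d"
    and mu :: "'s \<Rightarrow> real" and CC :: "(real^'d) set" and thstar theta0 :: "real^'d"
    and Cpi Mr C0 C1 :: real
    and PSest :: "nat \<Rightarrow> ('s \<times> 'a \<times> real \<times> 's) list \<Rightarrow> 's \<Rightarrow> 's \<Rightarrow> real"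
    and PRest :: "nat \<Rightarrow> ('s \<times> 'a \<times> real \<times> 's) list \<Rightarrow> 's \<Rightarrow> real \<Rightarrow> real"
    and MUest :: "nat \<Rightarrow> ('s \<times> 'a \<times> real \<times> 's) list \<Rightarrow> 's \<Rightarrow> real"
    and etl :: "nat \<Rightarrow> 'w \<Rightarrow> real"
  assumes
    \<comment> \<open>MDP, discount, features\<close>
    fin_rew: "\<And>s a. finite (set_pmf (R s a))"
    and gamma: "0 < gamma" "gamma \<le> 1"
    and zeta_lt1: "gamma < 1 \<Longrightarrow> zeta = 0"
    and zeta_eq1: "gamma = 1 \<Longrightarrow> \<forall>s. zeta \<bullet> feat s = 0"
    \<comment> \<open>mu is the stationary distribution of P^b\<close>
    and stat: "is_stationary (kernel_pol b P) mu"
    \<comment> \<open>theta* solves the Bellman equation\<close>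
    and thstar: "\<And>s. td_err zeta gamma feat (xi_of (rew_support R) (rew_pol pol R))
                          (phi_of feat (kernel_pol pol P)) thstar s = 0"
    \<comment> \<open>coverage assumption\<close>
    and Cpi: "0 < Cpi" "\<And>s a. pmf (pol s) a \<le> Cpi * mu s * pmf (b s) a"
    \<comment> \<open>(B1)\<close>
    and CC: "closed CC" "convex CC" "thstar \<in> CC" "CC \<subseteq> {th. norm th \<le> C1}" "0 < C1"
    and B1_rew: "0 < Mr" "\<And>s a r. r \<in> set_pmf (R s a) \<Longrightarrow> \<bar>r\<bar> < Mr"
    and B1_feat: "0 < C0" "\<And>i. \<bar>zeta $ i\<bar> \<le> C0" "\<And>s i. \<bar>feat s $ i\<bar> \<le> C0"
    \<comment> \<open>(B2)\<close>
    and B2: "irreducible_kernel (kernel_pol b P)" "\<exists>tau. has_mixing_time (kernel_pol b P) mu tau"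
    \<comment> \<open>data: trajectory of the MDP run under b, on a probability space M\<close>
    and M: "prob_space M"
    and meas: "\<And>t. S t \<in> measurable M (count_space UNIV)" "\<And>t. A t \<in> measurable M (count_space UNIV)"
              "\<And>t. Rw t \<in> borel_measurable M"
    and path_law: "\<And>n ss as rs.
       measure M {w \<in> space M. (\<forall>i<n. S i w = ss i \<and> A i w = as i \<and> Rw i w = rs i) \<and> S n w = ss n}
       = measure M {w \<in> space M. S 0 w = ss 0} *
         (\<Prod>i<n. pmf (b (ss i)) (as i) * pmf (R (ss i) (as i)) (rs i) * pmf (P (ss i) (as i)) (ss (Suc i)))"
    \<comment> \<open>data-based estimates (functions of z_0..z_t) are random variables\<close>
    and est_meas: "\<And>t s s'. (\<lambda>w. PSest t (data_hist S A Rw t w) s s') \<in> borel_measurable M"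
                  "\<And>t s r. (\<lambda>w. PRest t (data_hist S A Rw t w) s r) \<in> borel_measurable M"
                  "\<And>t s. (\<lambda>w. MUest t (data_hist S A Rw t w) s) \<in> borel_measurable M"
    \<comment> \<open>(B3)\<close>
    and etl_meas: "\<And>t. etl t \<in> borel_measurable M"
    and etl_int: "\<And>t. integrable M (\<lambda>w. (etl t w)\<^sup>2)"
    and etl_rate: "\<exists>K. \<forall>t\<ge>1. (\<integral>w. (etl t w)\<^sup>2 \<partial>M) \<le> K / real t"
    and B3_ps: "\<And>t w s'. w \<in> space M \<Longrightarrow>
        \<bar>PSest t (data_hist S A Rw t w) (S t w) s' - kernel_pol pol P (S t w) s'\<bar> \<le> etl t w"
    and B3_pr: "\<And>t w r. w \<in> space M \<Longrightarrow>
        \<bar>PRest t (data_hist S A Rw t w) (S t w) r - rew_pol pol R (S t w) r\<bar> \<le> etl t w"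
    and B3_mu: "\<And>t w. w \<in> space M \<Longrightarrow>
        \<bar>1 / MUest t (data_hist S A Rw t w) (S t w) - 1 / mu (S t w)\<bar> \<le> etl t w"
    and theta0: "theta0 \<in> CC"
  shows
   "let L = loss mu zeta gamma feat (xi_of (rew_support R) (rew_pol pol R)) (phi_of feat (kernel_pol pol P));
        gD = (\<lambda>t th w. dir_direct zeta gamma feat
                 (xi_of (rew_support R) (PRest t (data_hist S A Rw t w)))
                 (phi_of feat (PSest t (data_hist S A Rw t w))) th (S t w));
        gT = (\<lambda>t th w. dir_tdsgd pol b zeta gamma feat
                 (xi_of (rew_support R) (PRest t (data_hist S A Rw t w)))
                 (phi_of feat (PSest t (data_hist S A Rw t w))) th (sample S A Rw t w));
        g0 = (\<lambda>t th w. dir_td0 pol b zeta gamma feat (MUest t (data_hist S A Rw t w)) th (sample S A Rw t w));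
        gbar = (\<lambda>th. - (\<Sum>s\<in>UNIV. td_err zeta gamma feat (xi_of (rew_support R) (rew_pol pol R))
                          (phi_of feat (kernel_pol pol P)) th s *\<^sub>R (feat s + zeta)));
        steps_b = (\<lambda>c eta::nat \<Rightarrow> real. 1 / c \<le> eta 1 \<and> eta 1 \<le> 2 / c \<and>
                     (\<forall>t\<ge>1. eta (Suc t) = exp (- (1/2) * c * eta t) * eta t));
        rates_b = (\<lambda>c g. \<forall>eta. steps_b c eta \<longrightarrow> (\<exists>K. \<forall>T\<ge>2.
            (\<integral>w. (norm (psgd_avg CC eta g theta0 T w - thstar))\<^sup>2 \<partial>M) \<le> K * (ln (real T))^3 / real T \<and>
            (\<integral>w. L (psgd_avg CC eta g theta0 T w) \<partial>M) - L thstar \<le> K * (ln (real T))^3 / real T))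
    in
     (\<forall>g \<in> {gD, gT}. \<forall>eta0 > 0. \<exists>K. \<forall>T\<ge>2.
        (\<integral>w. L (psgd_avg CC (\<lambda>t. eta0 / sqrt (real t)) g theta0 T w) \<partial>M) - L thstar
          \<le> K * ln (real T) / sqrt (real T))
   \<and> (\<forall>c > 0. strongly_convex_on UNIV c L \<longrightarrow> (\<forall>g \<in> {gD, gT}. rates_b c g))
   \<and> (\<forall>c > 0. is_contraction_towards c gbar thstar \<longrightarrow> rates_b c g0)"
proof -
  interpret prob_space M by (rule M)
  interpret td_learning M S A Rw P R b mu pol gamma feat zeta CC thstar theta0 C1 PSest PRest MUest etl
  proof unfold_locales
    \<comment> \<open>At an action that \<open>b\<close> never takes, the ratio bound forces the
      target probability to 0.\<close>
    show "pmf (pol s) a = 0" if "pmf (b s) a = 0" for s a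
      using Cpi(2)[of s a] that by (simp add: order_antisym)
    show "norm x \<le> C1" if "x \<in> CC" for x using CC(4) that by auto
  qed (fact fin_rew meas path_law kernel_pol_nonneg kernel_pol_row stat B2(1) gamma(1) thstar CC(1-3) theta0
      est_meas etl_meas etl_int etl_rate B3_ps B3_pr B3_mu)+
  obtain KD where D: "markov_sgd M S A Rw P R b mu CC thstar theta0 C1 KD (Vb * Vb) etl ghat_direct
     (\<lambda>x z. delta x (fst z) *\<^sub>R v (fst z)) (\<lambda>x s. delta x s *\<^sub>R v s)"
    by (rule direct_sgd)
  obtain KT where T: "markov_sgd M S A Rw P R b mu CC thstar theta0 C1 KT (Vb * Vb) etl ghat_tdsgd
     (dir_tdsgd pol b zeta gamma feat xi ph) (\<lambda>x s. delta x s *\<^sub>R v s)"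
    by (rule td_sgd)
  note D_rates = gradient_rates[OF D] and T_rates = gradient_rates[OF T]
  show ?thesis
    \<comment> \<open>The loss vanishes at \<open>thstar\<close>, so the excess loss is the loss
      itself.\<close>
    unfolding Let_def loss_thstar diff_zero
  proof (intro conjI)
    show "\<forall>g\<in>{ghat_direct, ghat_tdsgd}. \<forall>eta0>0. \<exists>K. \<forall>T\<ge>2.
        (\<integral>w. L (psgd_avg CC (\<lambda>t. eta0 / sqrt (real t)) g theta0 T w) \<partial>M) \<le> K * ln (real T) / sqrt (real T)"
      using D_rates(1) T_rates(1) by simp
    show "\<forall>c>0. strongly_convex_on UNIV c L \<longrightarrow> (\<forall>g\<in>{ghat_direct, ghat_tdsgd}. \<forall>eta.
        1 / c \<le> eta 1 \<and> eta 1 \<le> 2 / c \<and> (\<forall>t\<ge>1. eta (Suc t) = exp (- (1/2) * c * eta t) * eta t) \<longrightarrow>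
        (\<exists>K. \<forall>T\<ge>2.
          (\<integral>w. (norm (psgd_avg CC eta g theta0 T w - thstar))\<^sup>2 \<partial>M) \<le> K * (ln (real T))^3 / real T \<and>
          (\<integral>w. L (psgd_avg CC eta g theta0 T w) \<partial>M) \<le> K * (ln (real T))^3 / real T))"
      using D_rates(2) T_rates(2) by simp
    show "\<forall>c>0. is_contraction_towards c (\<lambda>th. - (\<Sum>s\<in>UNIV. delta th s *\<^sub>R (feat s + zeta))) thstar \<longrightarrow>
        (\<forall>eta. 1 / c \<le> eta 1 \<and> eta 1 \<le> 2 / c \<and>
          (\<forall>t\<ge>1. eta (Suc t) = exp (- (1/2) * c * eta t) * eta t) \<longrightarrow>
        (\<exists>K. \<forall>T\<ge>2.
          (\<integral>w. (norm (psgd_avg CC eta ghat_td0 theta0 T w - thstar))\<^sup>2 \<partial>M) \<le> K * (ln (real T))^3 / real T \<and>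
          (\<integral>w. L (psgd_avg CC eta ghat_td0 theta0 T w) \<partial>M) \<le> K * (ln (real T))^3 / real T))"
      using td0_rate by blast
  qed
qed

end
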